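(* Let $n \geq 2$. For each $k \in \mathbb{N}$, let $R_k^{\mathcal{D}}$ denote any $n$-dimensional unit-measure cuboid which minimises $\lambda_k$ among all $n$-dimensional unit-measure cuboids, and let $a_{1,k}^* \leq \dots \leq a_{n,k}^*$ be its side-lengths. Then, for any admissible exponent $\theta_n$ (as defined in the context), as $k \to \infty$, $$a_{n,k}^* = 1 + O\bigl(k^{(\theta_n-(n-1))/(2n)}\bigr).$$ That is, any sequence of minimising $n$-dimensional cuboids $(R_k^{\mathcal{D}})_k$ for $\lambda_k$ converges to the $n$-dimensional unit cube as $k \to \infty$ (all side-lengths $a_{i,k}^*$ tend to $1$).
   Context: $\mathbb{N}=\{1,2,\dots\}$. An $n$-dimensional unit-measure cuboid is a domain $R=\prod_{i=1}^n (0,a_i)\subset\mathbb{R}^n$ with $a_i>0$, $\prod_{i=1}^n a_i=1$, with side-lengths labelled so that $a_1\le\dots\le a_n$. $\lambda_1(R)\le\lambda_2(R)\le\dots$ are the eigenvalues of the Dirichlet Laplacian on $R$, repeated according to multiplicity; they are the numbers $\sum_{j=1}^n \pi^2 i_j^2/a_j^2$ with $i_1,\dots,i_n$ positive integers, listed in non-decreasing order. For every $k\in\mathbb{N}$ a unit-measure cuboid minimising $\lambda_k$ exists (it need not be unique). Admissible exponent: $\theta_n$ denotes any exponent such that for all $a_1,\dots,a_n>0$, $$\#\{z\in\mathbb{Z}^n: a_1^{-2}z_1^2+\dots+a_n^{-2}z_n^2\le t^2\}-\omega_n t^n\prod_{i=1}^n a_i = O(t^{\theta_n}),\quad t\to\infty,$$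 uniformly for $a_1,\dots,a_n$ in compact subsets of $(0,\infty)$, where $\omega_n$ is the volume of the unit ball in $\mathbb{R}^n$. It is known that for every $n\ge2$ there are admissible exponents with $\theta_n<n-1$. *)

theory Defs
  imports "HOL-Analysis.Analysis" "HOL-Library.Landau_Symbols"
begin

text \<open>
  Dimension \<open>n\<close> is \<open>CARD('n)\<close>. For cuboids the index type is linearly ordered, so that the labelling
  \<open>a\<^sub>1 \<le> \<dots> \<le> a\<^sub>n\<close> makes sense; the last index is \<open>Max UNIV\<close>.
\<close>

text \<open>\<open>u\<close> is twice continuously differentiable on the open set \<open>\<Omega>\<close>, with gradient \<open>g\<close> and Hessian
  \<open>H\<close>, and its Laplacian is \<open>L\<close> there.\<close>

definition has_laplacian_on ::
  "(real ^ 'n::finite \<Rightarrow> real) \<Rightarrow> (real ^ 'n \<Rightarrow> real) \<Rightarrow> (real ^ 'n) set \<Rightarrow> bool" where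
  "has_laplacian_on u L \<Omega> \<longleftrightarrow>
     (\<exists>(g :: real ^ 'n \<Rightarrow> real ^ 'n) (H :: real ^ 'n \<Rightarrow> real ^ 'n ^ 'n).
        (\<forall>x\<in>\<Omega>. (u has_derivative (\<lambda>h. g x \<bullet> h)) (at x)) \<and>
        (\<forall>x\<in>\<Omega>. (g has_derivative (\<lambda>h. H x *v h)) (at x)) \<and>
        continuous_on \<Omega> H \<and>
        (\<forall>x\<in>\<Omega>. L x = trace (H x)))"

text \<open>Functions on \<open>closure \<Omega>\<close> that are continuous and vanish on the boundary are identified with
  their extensions by zero. For bounded open \<open>\<Omega>\<close> these are exactly the bounded continuous functions
  on the whole space that vanish outside \<open>\<Omega>\<close>, and that type provides the vector space structure
  needed to speak of the dimension of an eigenspace.\<close>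

definition dirichlet_eigenspace ::
  "(real ^ 'n::finite) set \<Rightarrow> real \<Rightarrow> ((real ^ 'n) \<Rightarrow>\<^sub>C real) set" where
  "dirichlet_eigenspace \<Omega> \<mu> =
     {u. (\<forall>x. x \<notin> \<Omega> \<longrightarrow> apply_bcontfun u x = 0) \<and>
         has_laplacian_on (apply_bcontfun u) (\<lambda>x. - \<mu> * apply_bcontfun u x) \<Omega>}"

definition dirichlet_eigenvalues :: "(real ^ 'n::finite) set \<Rightarrow> real set" where
  "dirichlet_eigenvalues \<Omega> = {\<mu>. \<exists>u\<in>dirichlet_eigenspace \<Omega> \<mu>. u \<noteq> 0}"

text \<open>Number of eigenvalues up to \<open>x\<close>, with multiplicity. The sum and \<open>dim\<close> would be \<open>0\<close> in infinite
  situations; for cuboids the spectrum is discrete with finite multiplicities.\<close>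

definition dirichlet_count :: "(real ^ 'n::finite) set \<Rightarrow> real \<Rightarrow> nat" where
  "dirichlet_count \<Omega> x =
     (\<Sum>\<mu> \<in> {\<mu> \<in> dirichlet_eigenvalues \<Omega>. \<mu> \<le> x}. dim (dirichlet_eigenspace \<Omega> \<mu>))"

text \<open>The \<open>k\<close>-th entry (\<open>k \<ge> 1\<close>) of the non-decreasing list of eigenvalues with multiplicity.\<close>

definition dirichlet_lambda :: "nat \<Rightarrow> (real ^ 'n::finite) set \<Rightarrow> real" where
  "dirichlet_lambda k \<Omega> = Inf {x. k \<le> dirichlet_count \<Omega> x}"

text \<open>A cuboid is represented by its vector \<open>a\<close> of side-lengths; the domain itself is \<open>box 0 a\<close>.\<close>

definition unit_cuboid :: "real ^ 'n::{finite,linorder} \<Rightarrow> bool" where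
  "unit_cuboid a \<longleftrightarrow>
     (\<forall>i. 0 < a $ i) \<and> (\<Prod>i\<in>UNIV. a $ i) = 1 \<and> (\<forall>i j. i \<le> j \<longrightarrow> a $ i \<le> a $ j)"

definition dirichlet_minimiser :: "nat \<Rightarrow> real ^ 'n::{finite,linorder} \<Rightarrow> bool" where
  "dirichlet_minimiser k a \<longleftrightarrow>
     unit_cuboid a \<and>
     (\<forall>b :: (real, 'n) vec. unit_cuboid b \<longrightarrow> dirichlet_lambda k (box 0 a) \<le> dirichlet_lambda k (box 0 b))"

definition admissible_exponent :: "'n::finite itself \<Rightarrow> real \<Rightarrow> bool" where
  "admissible_exponent (_ :: 'n itself) \<theta> \<longleftrightarrow>
     (\<forall>K :: real set. compact K \<and> K \<subseteq> {0<..} \<longrightarrow>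
       (\<exists>C. \<forall>\<^sub>F t in at_top. \<forall>a :: real ^ 'n. (\<forall>i. a $ i \<in> K) \<longrightarrow>
          \<bar>real (card {z :: int ^ 'n. (\<Sum>i\<in>UNIV. (real_of_int (z $ i))\<^sup>2 / (a $ i)\<^sup>2) \<le> t\<^sup>2})
            - measure lborel (ball (0 :: real ^ 'n) 1) * t ^ CARD('n) * (\<Prod>i\<in>UNIV. a $ i)\<bar>
          \<le> C * t powr \<theta>))"

end

theory Submission
  imports Defs
begin

text \<open>
  Stone--Weierstrass and a maximum principle show that the products of sines exhaust the Dirichlet
  spectrum of a cuboid, so eigenvalues are counted by the lattice points with positive coordinates in
  an ellipsoid. Symmetry gives
  \<open>2\<^sup>n pos_count a t = card (full_points a t) - c (\<Sum>i. 1 / a\<^sub>i) t\<^sup>n\<^sup>-\<^sup>1 + O(t\<^sup>n\<^sup>-\<^sup>2)\<close> for a unit cuboid, with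
  \<open>c\<close> the volume of the unit ball in dimension \<open>n - 1\<close>. Comparing a minimiser with the unit cube at its own
  eigenvalue leaves \<open>c (\<Sum>i. 1 / a\<^sub>i - n) t\<^sup>n\<^sup>-\<^sup>1\<close> bounded by the remainder of the lattice point problem
  plus \<open>O(t\<^sup>n\<^sup>-\<^sup>2)\<close>, and \<open>\<Sum>i. 1 / a\<^sub>i - n\<close> controls the square of \<open>a\<^sub>n - 1\<close> by the
  arithmetic-geometric mean inequality. The sides stay in a compact set because a short side forces
  a large boundary term already in the upper bound for \<open>pos_count\<close>.

  An admissible exponent at least \<open>n - 1\<close> says nothing, so the limit needs an independent remainder
  \<open>o(t\<^sup>n\<^sup>-\<^sup>1)\<close>. It comes from smoothing with a concentrated periodic trigonometric polynomial, whose
  nonconstant waves integrate over the ellipsoid to \<open>o(t\<^sup>n\<^sup>-\<^sup>1)\<close> because the Fourier transform of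
  the ball at \<open>v\<close> is \<open>o(1 / norm v)\<close>.
\<close>

section \<open>The Dirichlet spectrum of a cuboid\<close>

text \<open>Eigenfunctions are only continuous up to the boundary, with no control of their
  gradients there, so Green's identity is out of reach. A sup norm bound for 1 - \<Delta> replaces
  it: an eigenfunction u is compared with 1 + \<mu> times the resolvent of a finite sum of modes
  close to u. All volumes are taken in dimension n. Sections by coordinate hyperplanes are thickened
  to slabs of width one in the same space, so the constant of the boundary term appears as the
  measure of a \<open>full_slab\<close>. Counts jump at eigenvalues: the cube is known to have fewer
  than k of them only strictly below the eigenvalue of the minimiser. Bounds for the cube are
  therefore used at s < T and continued to T by continuity. The exponent arises in two steps. The
  square of the deviation is of order T^(\<theta> - (n-1)), so a root halves the exponent, and k
  \<le> V T^n converts T into k at the cost of a factor n. The terms of order T^(n-2) do no harm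
  because an admissible exponent is never below n - 2.\<close>

lemma has_derivative_prod_coordinates:
  fixes x :: "real ^ 'n::finite" and \<psi> \<psi>' :: "'n \<Rightarrow> real \<Rightarrow> real"
  assumes "\<And>i. (\<psi> i has_real_derivative \<psi>' i (x $ i)) (at (x $ i))"
  shows "((\<lambda>x. \<Prod>i\<in>UNIV. \<psi> i (x $ i)) has_derivative
    (\<lambda>h. (\<chi> i. \<psi>' i (x $ i) * (\<Prod>l\<in>UNIV - {i}. \<psi> l (x $ l))) \<bullet> h)) (at x)"
proof -
  have "((\<lambda>x. \<psi> i (x $ i)) has_derivative (\<lambda>h. \<psi>' i (x $ i) * h $ i)) (at x)" for i
  proof -
    have 1: "((\<lambda>x::real^'n. x $ i) has_derivative (\<lambda>h. h $ i)) (at x)"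
      by (rule bounded_linear_imp_has_derivative) (rule bounded_linear_vec_nth)
    show ?thesis
      using has_derivative_compose[OF 1, of "\<psi> i"] assms[of i]
      by (simp add: has_field_derivative_def)
  qed
  then have "((\<lambda>x. \<Prod>i\<in>UNIV. \<psi> i (x $ i)) has_derivative
     (\<lambda>h. \<Sum>i\<in>UNIV. (\<psi>' i (x $ i) * h $ i) * (\<Prod>l\<in>UNIV - {i}. \<psi> l (x $ l)))) (at x)"
    by (intro has_derivative_prod)
  moreover have "(\<lambda>h. \<Sum>i\<in>UNIV. (\<psi>' i (x $ i) * h $ i) * (\<Prod>l\<in>UNIV - {i}. \<psi> l (x $ l)))
      = (\<lambda>h. (\<chi> i. \<psi>' i (x $ i) * (\<Prod>l\<in>UNIV - {i}. \<psi> l (x $ l))) \<bullet> h)"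
    by (auto simp: inner_vec_def mult_ac intro!: sum.cong)
  ultimately show ?thesis by simp
qed

lemma has_laplacian_on_prod_coordinates:
  fixes \<psi> \<psi>' \<psi>'' :: "'n::finite \<Rightarrow> real \<Rightarrow> real"
  assumes d1: "\<And>i y. (\<psi> i has_real_derivative \<psi>' i y) (at y)"
    and d2: "\<And>i y. (\<psi>' i has_real_derivative \<psi>'' i y) (at y)"
    and c: "\<And>i. continuous_on UNIV (\<psi>'' i)"
    and u: "\<And>x. x \<in> \<Omega> \<Longrightarrow> u x = (\<Prod>i\<in>UNIV. \<psi> i (x $ i))" and "open \<Omega>"
    and L: "\<And>x. x \<in> \<Omega> \<Longrightarrow> L x = (\<Sum>m\<in>UNIV. \<psi>'' m (x $ m) * (\<Prod>l\<in>UNIV - {m}. \<psi> l (x $ l)))"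
  shows "has_laplacian_on u L \<Omega>"
proof -
  \<comment> \<open>Differentiating the product in coordinate m only exchanges its m-th factor. Each
    component of the gradient is therefore again a product over the coordinates, with factors
    \<open>D m\<close>, and the first-order rule applies to it a second time.\<close>
  define D where "D m = \<psi>(m := \<psi>' m)" for m
  define D' where "D' m = \<psi>'(m := \<psi>'' m)" for m
  define g where "g x = (\<chi> i. \<psi>' i (x $ i) * (\<Prod>l\<in>UNIV - {i}. \<psi> l (x $ l)))" for x :: "real^'n"
  define H where "H x = (\<chi> m i. D' m i (x $ i) * (\<Prod>l\<in>UNIV - {i}. D m l (x $ l)))" for x :: "real^'n"
  have gD: "g x = (\<chi> m. \<Prod>i\<in>UNIV. D m i (x $ i))" for x
  proof -
    have "(\<Prod>i\<in>UNIV. D m i (x $ i)) = D m m (x $ m) * (\<Prod>i\<in>UNIV - {m}. D m i (x $ i))" for m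
      by (rule prod.remove) auto
    then show ?thesis
      unfolding g_def vec_eq_iff by (auto simp: D_def intro!: prod.cong)
  qed
  have cont1: "continuous_on UNIV (\<psi> i)" "continuous_on UNIV (\<psi>' i)" for i
    using d1 d2 by (meson DERIV_isCont continuous_at_imp_continuous_on)+
  have contD: "continuous_on UNIV (D m i)" "continuous_on UNIV (D' m i)" for m i
    by (auto simp: D_def D'_def intro: cont1 c)
  have contx: "continuous_on S (\<lambda>x. f (x $ i))" if "continuous_on UNIV f"
    for f :: "real \<Rightarrow> real" and S :: "(real^'n) set" and i
    by (rule continuous_on_compose2[OF that]) (auto intro: continuous_intros)
  show ?thesis
    unfolding has_laplacian_on_def
  proof (intro exI conjI ballI)
    fix x assume x: "x \<in> \<Omega>"
    show "(u has_derivative (\<lambda>h. g x \<bullet> h)) (at x)"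
      using has_derivative_prod_coordinates[of \<psi> \<psi>' x] d1 x u \<open>open \<Omega>\<close> unfolding g_def
      by (auto intro: has_derivative_transform_within_open)
    have "((\<lambda>x. g x $ m) has_derivative (\<lambda>h. (H x *v h) $ m)) (at x)" for m
    proof -
      have "(D m i has_real_derivative D' m i (x $ i)) (at (x $ i))" for i
        by (auto simp: D_def D'_def d1 d2)
      from has_derivative_prod_coordinates[of "D m" "D' m" x, OF this] show ?thesis
        unfolding gD H_def by (simp add: matrix_vector_mult_def inner_vec_def)
    qed
    then have "((\<lambda>x. \<Sum>m\<in>UNIV. g x $ m *\<^sub>R (axis m 1 :: real^'n)) has_derivative
        (\<lambda>h. \<Sum>m\<in>UNIV. (H x *v h) $ m *\<^sub>R axis m 1)) (at x)"
      by (intro has_derivative_sum has_derivative_scaleR_left)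
    moreover have "(\<Sum>m\<in>UNIV. y $ m *\<^sub>R axis m 1) = y" for y :: "real^'n"
      using basis_expansion[of y] by (simp add: scalar_mult_eq_scaleR)
    then have "(\<lambda>x. \<Sum>m\<in>UNIV. g x $ m *\<^sub>R axis m 1) = g"
      "(\<lambda>h. \<Sum>m\<in>UNIV. (H x *v h) $ m *\<^sub>R axis m 1) = (\<lambda>h. H x *v h)" by auto
    ultimately show "(g has_derivative (\<lambda>h. H x *v h)) (at x)"
      by simp
    show "L x = trace (H x)"
      using L[OF x] by (simp add: trace_def H_def D_def D'_def)
  next
    show "continuous_on \<Omega> H"
      unfolding H_def by (intro continuous_intros contx contD)
  qed
qed

lemma has_laplacian_on_add:
  assumes "has_laplacian_on u L \<Omega>" "has_laplacian_on v M \<Omega>"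
  shows "has_laplacian_on (\<lambda>x. u x + v x) (\<lambda>x. L x + M x) \<Omega>"
proof -
  obtain g H where 1: "\<forall>x\<in>\<Omega>. (u has_derivative (\<lambda>h. g x \<bullet> h)) (at x)"
     "\<forall>x\<in>\<Omega>. (g has_derivative (\<lambda>h. H x *v h)) (at x)" "continuous_on \<Omega> H" "\<forall>x\<in>\<Omega>. L x = trace (H x)"
    using assms(1) unfolding has_laplacian_on_def by blast
  obtain g' H' where 2: "\<forall>x\<in>\<Omega>. (v has_derivative (\<lambda>h. g' x \<bullet> h)) (at x)"
     "\<forall>x\<in>\<Omega>. (g' has_derivative (\<lambda>h. H' x *v h)) (at x)" "continuous_on \<Omega> H'" "\<forall>x\<in>\<Omega>. M x = trace (H' x)"
    using assms(2) unfolding has_laplacian_on_def by blast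
  show ?thesis unfolding has_laplacian_on_def
    by (rule exI[of _ "\<lambda>x. g x + g' x"], rule exI[of _ "\<lambda>x. H x + H' x"])
      (use 1 2 in \<open>auto simp: inner_add_left[abs_def] matrix_vector_mult_add_rdistrib[abs_def] trace_add
         intro!: has_derivative_eq_rhs[OF has_derivative_add] continuous_on_add\<close>)
qed

lemma has_laplacian_on_scale:
  assumes "has_laplacian_on u L \<Omega>"
  shows "has_laplacian_on (\<lambda>x. c * u x) (\<lambda>x. c * L x) \<Omega>"
proof -
  obtain g H where 1: "\<forall>x\<in>\<Omega>. (u has_derivative (\<lambda>h. g x \<bullet> h)) (at x)"
     "\<forall>x\<in>\<Omega>. (g has_derivative (\<lambda>h. H x *v h)) (at x)" "continuous_on \<Omega> H" "\<forall>x\<in>\<Omega>. L x = trace (H x)"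
    using assms(1) unfolding has_laplacian_on_def by blast
  show ?thesis unfolding has_laplacian_on_def
    by (rule exI[of _ "\<lambda>x. c *\<^sub>R g x"], rule exI[of _ "\<lambda>x. c *\<^sub>R H x"])
      (use 1 in \<open>auto simp: scaleR_matrix_vector_assoc[symmetric] trace_def sum_distrib_left
         intro!: has_derivative_eq_rhs[OF has_derivative_mult_right]
           has_derivative_eq_rhs[OF has_derivative_scaleR_right] continuous_on_scaleR\<close>)
qed

text \<open>A positive diagonal entry of the Hessian would make the partial derivative, which
  vanishes at the maximum, positive just after it along that coordinate line, and the mean value
  theorem would then produce a larger value of \<open>u\<close>. So each diagonal entry is
  nonpositive, and with them the trace.\<close>

lemma laplacian_nonpos_at_maximum:
  assumes L: "has_laplacian_on u L \<Omega>" and "open \<Omega>" and x: "x \<in> \<Omega>"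
    and max: "\<And>y. y \<in> \<Omega> \<Longrightarrow> u y \<le> u x"
  shows "L x \<le> 0"
proof -
  obtain g H where 1: "\<forall>x\<in>\<Omega>. (u has_derivative (\<lambda>h. g x \<bullet> h)) (at x)"
     "\<forall>x\<in>\<Omega>. (g has_derivative (\<lambda>h. H x *v h)) (at x)" "\<forall>x\<in>\<Omega>. L x = trace (H x)"
    using L unfolding has_laplacian_on_def by blast
  have "H x $ i $ i \<le> 0" for i
  proof (rule ccontr)
    assume neg: "\<not> ?thesis"
    define e :: "real^'a" where "e = axis i 1"
    define p where "p s = x + s *\<^sub>R e" for s
    obtain d0 where d0: "d0 > 0" "ball x d0 \<subseteq> \<Omega>" using \<open>open \<Omega>\<close> x open_contains_ball by blast
    have ne: "norm e = 1" by (simp add: e_def)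
    have pin: "p s \<in> \<Omega>" if "\<bar>s\<bar> < d0" for s
    proof -
      have "dist x (p s) < d0" using that ne by (simp add: p_def dist_norm)
      then show ?thesis using d0 by auto
    qed
    have dp: "(p has_derivative (\<lambda>h. h *\<^sub>R e)) (at s)" for s
      unfolding p_def by (auto intro!: derivative_eq_intros)
    have du: "((\<lambda>s. u (p s)) has_real_derivative g (p s) $ i) (at s)" if "\<bar>s\<bar> < d0" for s
      using has_derivative_compose[OF dp, of u "\<lambda>h. g (p s) \<bullet> h" s] 1 pin[OF that]
      by (simp add: has_field_derivative_def e_def inner_axis mult_ac) (metis mult_commute_abs)
    have gi: "((\<lambda>s. g (p s) $ i) has_real_derivative H x $ i $ i) (at 0)"
    proof -
      have "(g has_derivative (\<lambda>h. H x *v h)) (at (p 0))" using 1 x by (simp add: p_def)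
      from has_derivative_compose[OF dp this]
      have "((\<lambda>s. g (p s) $ i) has_derivative (\<lambda>h. (H x *v (h *\<^sub>R e)) $ i)) (at 0)"
        by (rule bounded_linear.has_derivative[OF bounded_linear_vec_nth])
      moreover have "(\<lambda>h. (H x *v (h *\<^sub>R e)) $ i) = (*) (H x $ i $ i)"
        by (auto simp: e_def matrix_vector_mult_def axis_def if_distrib cong: if_cong)
      ultimately show ?thesis by (simp add: has_field_derivative_def)
    qed
    have gx0: "g x $ i = 0"
    proof -
      have "((\<lambda>s. u (p s)) has_real_derivative g (p 0) $ i) (at 0)" using du d0 by auto
      then have "g (p 0) $ i = 0"
        by (rule DERIV_local_max[of _ _ _ d0]) (use d0 pin max in \<open>auto simp: p_def\<close>)
      then show ?thesis by (simp add: p_def)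
    qed
    obtain d1 where d1: "d1 > 0" "\<And>h. 0 < h \<Longrightarrow> h < d1 \<Longrightarrow> g (p 0) $ i < g (p (0 + h)) $ i"
      using DERIV_pos_inc_right[OF gi] neg by force
    define s where "s = min d0 d1 / 2"
    have s: "0 < s" "s < d0" "s < d1" using d0 d1 by (auto simp: s_def)
    have "\<exists>z. 0 < z \<and> z < s \<and> u (p s) - u (p 0) = (s - 0) * (g (p z) $ i)"
      by (rule MVT2) (use s du in auto)
    then obtain z where z: "0 < z" "z < s" "u (p s) - u (p 0) = s * (g (p z) $ i)" by auto
    have "g (p z) $ i > 0" using d1(2)[of z] z s gx0 by (simp add: p_def)
    then have "u (p s) > u (p 0)" using z s by (smt (verit) mult_pos_pos)
    moreover have "u (p s) \<le> u x" using max pin[of s] s by auto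
    ultimately show False by (simp add: p_def)
  qed
  then show ?thesis using 1 x by (auto simp: trace_def intro: sum_nonpos)
qed

text \<open>At an interior maximum the Laplacian is nonpositive, so v \<le> v - L \<le> M there, and
  off the open box v is zero; the same holds for -v. This is the sup norm bound, with constant one,
  for the resolvent of the Laplacian, and at the boundary it works from continuity alone.\<close>

lemma maximum_principle:
  fixes a :: "real^'n::finite"
  assumes L: "has_laplacian_on v L (box 0 a)" and c: "continuous_on UNIV v"
    and out: "\<And>x. x \<notin> box 0 a \<Longrightarrow> v x = 0"
    and M: "\<And>x. x \<in> box 0 a \<Longrightarrow> \<bar>v x - L x\<bar> \<le> M" and "M \<ge> 0"
  shows "\<bar>v x\<bar> \<le> M"
proof -
  have one: "v x \<le> M" if L: "has_laplacian_on v L (box 0 a)" and c: "continuous_on UNIV v"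
    and out: "\<And>x. x \<notin> box 0 a \<Longrightarrow> v x = 0"
    and M: "\<And>x. x \<in> box 0 a \<Longrightarrow> \<bar>v x - L x\<bar> \<le> M" for v L x
  proof (cases "x \<in> box 0 a")
    case True
    then have ne: "cbox 0 a \<noteq> {}" using box_subset_cbox by blast
    obtain y where y: "y \<in> cbox 0 a" "\<And>z. z \<in> cbox 0 a \<Longrightarrow> v z \<le> v y"
      using continuous_attains_sup[OF compact_cbox ne continuous_on_subset[OF c]] by blast
    show ?thesis
    proof (cases "y \<in> box 0 a")
      case in_box: True
      have "L y \<le> 0"
        by (rule laplacian_nonpos_at_maximum[OF L open_box in_box]) (use y box_subset_cbox in blast)
      then have "v y \<le> M" using M[OF in_box] by linarith
      then show ?thesis using y(2)[of x] True box_subset_cbox[of 0 a] by fastforce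
    next
      case False
      then show ?thesis using y(2)[of x] True box_subset_cbox[of 0 a] out[OF False] \<open>M \<ge> 0\<close> by fastforce
    qed
  qed (use that \<open>M \<ge> 0\<close> in auto)
  have "v x \<le> M" by (rule one[OF L c out M])
  moreover have "- v x \<le> M"
    by (rule one[of "\<lambda>x. - v x" "\<lambda>x. - L x"])
      (use has_laplacian_on_scale[OF L, of "-1"] c out M in \<open>auto intro!: continuous_intros simp: abs_minus_commute\<close>)
  ultimately show ?thesis by linarith
qed

section \<open>Sine modes of a cuboid\<close>

definition positive_points :: "(int ^ 'n::finite) set" where
  "positive_points = {j. \<forall>i. 0 < j $ i}"

lemma finite_bounded_int_vec: "finite {z :: int ^ 'n::finite. \<forall>i. \<bar>z $ i\<bar> \<le> B}"
proof (rule inj_on_finite[of vec_nth _ "PiE UNIV (\<lambda>_. {-B..B})"])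
  show "finite (PiE (UNIV :: 'n set) (\<lambda>_. {-B..B}))" by (rule finite_PiE) auto
qed (auto simp: inj_on_def vec_nth_inject abs_le_iff minus_le_iff)

locale positive_cuboid =
  fixes a :: "real ^ 'n::finite"
  assumes side_pos: "0 < a $ i"
begin

text \<open>Clamping each coordinate to the side before applying the sine gives the extension by
  zero, since the sine vanishes at both ends; the function is then continuous on the whole space.
  All integer vectors serve as indices because the product formula for sine and cosine can lead to
  an index with a zero coordinate, whose mode is zero.\<close>

definition sine_mode :: "int ^ 'n \<Rightarrow> (real ^ 'n) \<Rightarrow>\<^sub>C real" where
  "sine_mode j = Bcontfun (\<lambda>x. \<Prod>i\<in>UNIV. sin (pi * j $ i / a $ i * max 0 (min (a $ i) (x $ i))))"

definition mode_eigenvalue :: "int ^ 'n \<Rightarrow> real" where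
  "mode_eigenvalue j = (\<Sum>i\<in>UNIV. (pi * j $ i / a $ i)\<^sup>2)"

lemma apply_sine_mode:
  "apply_bcontfun (sine_mode j) x = (\<Prod>i\<in>UNIV. sin (pi * j $ i / a $ i * max 0 (min (a $ i) (x $ i))))"
proof -
  let ?f = "\<lambda>x. \<Prod>i\<in>UNIV. sin (pi * j $ i / a $ i * max 0 (min (a $ i) (x $ i)))"
  have "?f \<in> bcontfun"
  proof (rule bcontfun_normI)
    show "continuous_on UNIV ?f" by (intro continuous_intros)
    show "norm (?f x) \<le> 1" for x
      by (auto simp: abs_prod intro!: prod_le_1)
  qed
  then show ?thesis by (simp add: sine_mode_def Bcontfun_inverse)
qed

lemma mem_box_cuboid: "x \<in> box 0 a \<longleftrightarrow> (\<forall>i. 0 < x $ i \<and> x $ i < a $ i)"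
  and mem_cbox_cuboid: "x \<in> cbox 0 a \<longleftrightarrow> (\<forall>i. 0 \<le> x $ i \<and> x $ i \<le> a $ i)"
  by (auto simp: mem_box_cart)

lemma box_nonempty: "box 0 a \<noteq> {}" "cbox 0 a \<noteq> {}"
proof -
  have "(1/2) *\<^sub>R a \<in> box 0 a" using side_pos by (simp add: mem_box_cuboid)
  then show "box 0 a \<noteq> {}" "cbox 0 a \<noteq> {}" using box_subset_cbox by blast+
qed

lemma apply_sine_mode_cbox:
  assumes "x \<in> cbox 0 a"
  shows "apply_bcontfun (sine_mode j) x = (\<Prod>i\<in>UNIV. sin (pi * j $ i / a $ i * x $ i))"
  using assms by (simp add: apply_sine_mode mem_cbox_cuboid)

lemma sine_mode_outside:
  assumes "x \<notin> box 0 a"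
  shows "apply_bcontfun (sine_mode j) x = 0"
proof -
  obtain i where "x $ i \<le> 0 \<or> a $ i \<le> x $ i"
    using assms by (auto simp: mem_box_cuboid not_less)
  then have "sin (pi * j $ i / a $ i * max 0 (min (a $ i) (x $ i))) = 0"
  proof
    assume "x $ i \<le> 0"
    then show ?thesis using side_pos[of i] by simp
  next
    assume "a $ i \<le> x $ i"
    then show ?thesis using side_pos[of i] sin_npi_int[of "j $ i"] by (simp add: mult.commute)
  qed
  then show ?thesis by (auto simp: apply_sine_mode)
qed

lemma has_laplacian_on_sine_mode:
  "has_laplacian_on (apply_bcontfun (sine_mode j))
     (\<lambda>x. - mode_eigenvalue j * apply_bcontfun (sine_mode j) x) (box 0 a)"
proof (rule has_laplacian_on_prod_coordinates[where
      \<psi> = "\<lambda>i y. sin (pi * j $ i / a $ i * y)" and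
      \<psi>' = "\<lambda>i y. pi * j $ i / a $ i * cos (pi * j $ i / a $ i * y)" and
      \<psi>'' = "\<lambda>i y. - (pi * j $ i / a $ i)\<^sup>2 * sin (pi * j $ i / a $ i * y)"])
  fix x assume x: "x \<in> box 0 a"
  then have x': "x \<in> cbox 0 a" using box_subset_cbox by blast
  have "(\<Prod>i\<in>UNIV. sin (pi * j $ i / a $ i * x $ i)) =
     sin (pi * j $ m / a $ m * x $ m) * (\<Prod>i\<in>UNIV - {m}. sin (pi * j $ i / a $ i * x $ i))" for m
    by (rule prod.remove) auto
  then show "- mode_eigenvalue j * apply_bcontfun (sine_mode j) x =
     (\<Sum>m\<in>UNIV. - (pi * j $ m / a $ m)\<^sup>2 * sin (pi * j $ m / a $ m * x $ m) *
        (\<Prod>l\<in>UNIV - {m}. sin (pi * j $ l / a $ l * x $ l)))"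
    unfolding apply_sine_mode_cbox[OF x'] mode_eigenvalue_def
    by (simp add: sum_distrib_right sum_negf mult.assoc)
qed (use side_pos in \<open>auto intro!: derivative_eq_intros continuous_intros
      simp: less_imp_neq[THEN not_sym] power2_eq_square apply_sine_mode_cbox subsetD[OF box_subset_cbox]\<close>)

lemma mode_eigenvalue_nonneg: "0 \<le> mode_eigenvalue j"
  by (auto simp: mode_eigenvalue_def intro: sum_nonneg)

lemma finite_modes_le: "finite {j. mode_eigenvalue j \<le> x}"
proof -
  define A where "A = (\<Sum>i\<in>UNIV. a $ i)"
  define B where "B = \<lceil>A * (1 + \<bar>x\<bar>) / pi\<rceil>"
  have "\<bar>j $ i\<bar> \<le> B" if "mode_eigenvalue j \<le> x" for j i
  proof -
    have "(pi * j $ i / a $ i)\<^sup>2 \<le> mode_eigenvalue j"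
      unfolding mode_eigenvalue_def by (rule member_le_sum) auto
    also have "\<dots> \<le> (1 + \<bar>x\<bar>)\<^sup>2"
    proof -
      have "0 \<le> x * x" by simp
      then have "x \<le> 1 + (x * x + \<bar>x\<bar> * 2)" by linarith
      with that show ?thesis by (simp add: power2_eq_square algebra_simps)
    qed
    finally have "\<bar>pi * j $ i / a $ i\<bar> \<le> 1 + \<bar>x\<bar>" by (simp add: abs_le_square_iff[symmetric])
    then have "pi * \<bar>real_of_int (j $ i)\<bar> \<le> a $ i * (1 + \<bar>x\<bar>)"
      using side_pos[of i] by (simp add: abs_mult field_simps)
    also have "a $ i * (1 + \<bar>x\<bar>) \<le> A * (1 + \<bar>x\<bar>)"
      unfolding A_def using side_pos by (intro mult_right_mono member_le_sum) (auto intro: less_imp_le)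
    finally have "\<bar>real_of_int (j $ i)\<bar> \<le> A * (1 + \<bar>x\<bar>) / pi" by (simp add: field_simps)
    then show ?thesis unfolding B_def by linarith
  qed
  then show ?thesis by (intro finite_subset[OF _ finite_bounded_int_vec[of B]]) auto
qed

lemma eigenspace_subspace: "subspace (dirichlet_eigenspace (box 0 a) \<mu>)"
proof (rule subspaceI)
  show "0 \<in> dirichlet_eigenspace (box 0 a) \<mu>"
    using has_laplacian_on_scale[OF has_laplacian_on_sine_mode[of 1], of 0]
    by (simp add: dirichlet_eigenspace_def)
next
  fix u v assume "u \<in> dirichlet_eigenspace (box 0 a) \<mu>" "v \<in> dirichlet_eigenspace (box 0 a) \<mu>"
  then show "u + v \<in> dirichlet_eigenspace (box 0 a) \<mu>"
    using has_laplacian_on_add[of u _ "box 0 a" v]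
    by (fastforce simp: dirichlet_eigenspace_def plus_bcontfun.rep_eq algebra_simps)
next
  fix c u assume "u \<in> dirichlet_eigenspace (box 0 a) \<mu>"
  then show "c *\<^sub>R u \<in> dirichlet_eigenspace (box 0 a) \<mu>"
    using has_laplacian_on_scale[of u _ "box 0 a" c]
    by (fastforce simp: dirichlet_eigenspace_def scaleR_bcontfun.rep_eq algebra_simps)
qed

lemma sine_mode_in_eigenspace: "sine_mode j \<in> dirichlet_eigenspace (box 0 a) (mode_eigenvalue j)"
  using has_laplacian_on_sine_mode by (simp add: dirichlet_eigenspace_def sine_mode_outside)

section \<open>The L2 pairing over the cuboid\<close>

definition ip :: "((real ^ 'n) \<Rightarrow>\<^sub>C real) \<Rightarrow> ((real ^ 'n) \<Rightarrow>\<^sub>C real) \<Rightarrow> real" where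
  "ip u v = integral (cbox 0 a) (\<lambda>x. apply_bcontfun u x * apply_bcontfun v x)"

lemma ip_integrable:
  fixes u v :: "(real ^ 'n) \<Rightarrow>\<^sub>C real"
  shows "(\<lambda>x. apply_bcontfun u x * apply_bcontfun v x) integrable_on cbox 0 a"
  by (intro integrable_continuous continuous_intros) auto

lemma ip_add: "ip (u + v) w = ip u w + ip v w"
  unfolding ip_def plus_bcontfun.rep_eq distrib_right
  by (rule integral_add) (rule ip_integrable)+

lemma ip_scale: "ip (c *\<^sub>R u) w = c * ip u w"
  unfolding ip_def by (simp add: scaleR_bcontfun.rep_eq mult.assoc)

lemma ip_zero [simp]: "ip 0 w = 0"
  by (simp add: ip_def)

lemma ip_diff: "ip (u - v) w = ip u w - ip v w"
  using ip_add[of "u - v" v w] by simp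

lemma ip_commute: "ip u v = ip v u"
  by (simp add: ip_def mult.commute)

lemma ip_sum: "ip (\<Sum>j\<in>J. f j) w = (\<Sum>j\<in>J. ip (f j) w)"
  by (induction J rule: infinite_finite_induct) (simp_all add: ip_add)

lemma ip_bound:
  assumes "\<And>x. x \<in> cbox 0 a \<Longrightarrow> \<bar>apply_bcontfun u x\<bar> \<le> \<epsilon>" "\<And>x. \<bar>apply_bcontfun v x\<bar> \<le> B" "B \<ge> 0" "\<epsilon> \<ge> 0"
  shows "\<bar>ip u v\<bar> \<le> \<epsilon> * B * measure lborel (cbox 0 a)"
  unfolding ip_def real_norm_def[symmetric]
proof (rule has_integral_bound[OF _ integrable_integral[OF ip_integrable]])
  fix x assume "x \<in> cbox 0 a"
  then show "norm (apply_bcontfun u x * apply_bcontfun v x) \<le> \<epsilon> * B"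
    using assms by (auto simp: abs_mult intro!: mult_mono)
qed (use assms in auto)

lemma ip_self_eq_0:
  assumes "ip u u = 0" "\<And>x. x \<notin> box 0 a \<Longrightarrow> apply_bcontfun u x = 0"
  shows "u = 0"
proof -
  have "apply_bcontfun u x * apply_bcontfun u x = 0" if "x \<in> cbox 0 a" for x
    by (rule has_integral_0_cbox_imp_0[of 0 a "\<lambda>x. apply_bcontfun u x * apply_bcontfun u x"])
      (use that assms(1) box_nonempty ip_integrable[of u u] in
        \<open>auto simp: ip_def integrable_integral has_integral_iff intro!: continuous_intros\<close>)
  then have "apply_bcontfun u x = 0" for x
    using assms(2) box_subset_cbox[of 0 a] by (cases "x \<in> cbox 0 a") auto
  then show ?thesis by (intro bcontfun_eqI) simp
qed

end

text \<open>Lebesgue measure on \<open>real ^ 'n\<close> is the image of a product measure indexed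
  by \<open>Basis\<close>, so the product rule for integrals is transported along the bijection
  between coordinates and axis vectors; \<open>ix\<close> inverts that bijection.\<close>

lemma lborel_integral_prod_coordinates:
  fixes f :: "'n::finite \<Rightarrow> real \<Rightarrow> real"
  assumes f: "\<And>i. integrable lborel (f i)"
  shows "(LINT x|lborel. (\<Prod>i\<in>UNIV. f i ((x :: real ^ 'n) $ i))) = (\<Prod>i\<in>UNIV. (LINT y|lborel. f i y))"
proof -
  interpret product_sigma_finite "\<lambda>b :: real ^ 'n. lborel :: real measure"
    by unfold_locales
  define ix where "ix b = (SOME i. b = axis i (1::real))" for b :: "real ^ 'n"
  have ix: "ix (axis i 1) = i" for i
    unfolding ix_def by (rule some_equality) (auto simp: axis_eq_axis)
  have Basis: "Basis = range (\<lambda>i. axis i 1 :: real ^ 'n)"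
    by (auto simp: Basis_vec_def)
  have inj: "inj (\<lambda>i. axis i 1 :: real ^ 'n)"
    by (auto simp: inj_on_def axis_eq_axis)
  have comp: "(\<Sum>b\<in>Basis. g b *\<^sub>R b) $ i = g (axis i 1)" for g :: "real ^ 'n \<Rightarrow> real" and i
    unfolding Basis sum.reindex[OF inj] by (simp add: axis_def if_distrib cong: if_cong)
  have meas: "(\<lambda>x::real^'n. \<Prod>i\<in>UNIV. f i (x $ i)) \<in> borel_measurable borel"
  proof -
    have [measurable]: "f i \<in> borel_measurable borel" for i
      using borel_measurable_integrable[OF f[of i]] by simp
    have [measurable]: "(\<lambda>x::real^'n. x $ i) \<in> borel_measurable borel" for i
      by (intro borel_measurable_continuous_onI continuous_intros)
    show ?thesis by measurable
  qed
  have "(LINT x|lborel. (\<Prod>i\<in>UNIV. f i ((x :: real ^ 'n) $ i))) =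
     (LINT g|(\<Pi>\<^sub>M b\<in>Basis. lborel). (\<Prod>i\<in>UNIV. f i ((\<Sum>b\<in>Basis. g b *\<^sub>R (b :: real^'n)) $ i)))"
    unfolding lborel_eq[where 'a="real^'n"]
    by (rule integral_distr) (use meas in measurable)
  also have "\<dots> = (LINT g|(\<Pi>\<^sub>M b\<in>Basis. lborel). (\<Prod>b\<in>Basis. f (ix b) (g b)))"
    unfolding comp by (simp add: Basis prod.reindex[OF inj] ix)
  also have "\<dots> = (\<Prod>b\<in>(Basis :: (real^'n) set). (LINT y|lborel. f (ix b) y))"
    by (rule product_integral_prod) (use f in auto)
  also have "\<dots> = (\<Prod>i\<in>UNIV. (LINT y|lborel. f i y))"
    by (simp add: Basis prod.reindex[OF inj] ix)
  finally show ?thesis .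
qed

lemma integral_sin_sin_orthogonal:
  fixes L :: real and m k :: int
  assumes "0 < L" "0 < m" "0 < k" "m \<noteq> k"
  shows "integral {0..L} (\<lambda>y. sin (pi * m / L * y) * sin (pi * k / L * y)) = 0"
proof -
  \<comment> \<open>Antiderivative read off from sin A sin B = (cos (A - B) - cos (A + B)) / 2. Both
    frequencies are nonzero because m and k are positive and different, and both sines vanish at 0
    and at L.\<close>
  define F where "F y = (sin (pi * (m - k) / L * y) / (pi * (m - k) / L) -
     sin (pi * (m + k) / L * y) / (pi * (m + k) / L)) / 2" for y
  have nz: "real_of_int m - real_of_int k \<noteq> 0" "real_of_int m + real_of_int k \<noteq> 0" using assms by auto
  have "((\<lambda>y. sin (pi * m / L * y) * sin (pi * k / L * y)) has_integral F L - F 0) {0..L}"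
  proof (rule fundamental_theorem_of_calculus)
    fix y assume "y \<in> {0..L}"
    have "(F has_real_derivative (cos (pi * (m - k) / L * y) - cos (pi * (m + k) / L * y)) / 2) (at y within {0..L})"
      unfolding F_def using nz assms by (auto intro!: derivative_eq_intros)
    also have "(cos (pi * (m - k) / L * y) - cos (pi * (m + k) / L * y)) / 2 = sin (pi * m / L * y) * sin (pi * k / L * y)"
    proof -
      have "pi * m / L * y - pi * k / L * y = pi * (m - k) / L * y" "pi * m / L * y + pi * k / L * y = pi * (m + k) / L * y"
        by (simp_all add: algebra_simps add_divide_distrib diff_divide_distrib)
      then show ?thesis by (simp add: sin_times_sin)
    qed
    finally show "(F has_vector_derivative sin (pi * m / L * y) * sin (pi * k / L * y)) (at y within {0..L})"
      by (simp add: has_real_derivative_iff_has_vector_derivative)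
  qed (use assms in auto)
  moreover have "F L - F 0 = 0"
    using assms sin_npi_int[of "m - k"] sin_npi_int[of "m + k"] by (simp add: F_def mult.commute)
  ultimately show ?thesis by (simp add: integral_unique)
qed

section \<open>Orthogonality of the modes and density of their span\<close>

context positive_cuboid begin

text \<open>The integral factorises over the coordinates, and one coordinate in which the indices
  differ already contributes a zero factor.\<close>

lemma ip_sine_modes:
  assumes "j \<in> positive_points" "l \<in> positive_points" "j \<noteq> l"
  shows "ip (sine_mode j) (sine_mode l) = 0"
proof -
  define f where "f i y = indicator {0..a $ i} y * (sin (pi * j $ i / a $ i * y) * sin (pi * l $ i / a $ i * y))" for i and y :: real
  have f: "integrable lborel (f i)" "(LINT y|lborel. f i y) =
      integral {0..a $ i} (\<lambda>y. sin (pi * j $ i / a $ i * y) * sin (pi * l $ i / a $ i * y))" for i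
  proof -
    have *: "set_integrable lborel {0..a $ i} (\<lambda>y. sin (pi * j $ i / a $ i * y) * sin (pi * l $ i / a $ i * y))"
      by (rule borel_integrable_atLeastAtMost') (use side_pos in \<open>auto intro!: continuous_intros simp: less_imp_neq[THEN not_sym]\<close>)
    then show "integrable lborel (f i)" by (simp add: set_integrable_def f_def[abs_def])
    show "(LINT y|lborel. f i y) = integral {0..a $ i} (\<lambda>y. sin (pi * j $ i / a $ i * y) * sin (pi * l $ i / a $ i * y))"
      using set_borel_integral_eq_integral(2)[OF *] by (simp add: set_lebesgue_integral_def f_def)
  qed
  obtain i where i: "j $ i \<noteq> l $ i" using assms(3) by (auto simp: vec_eq_iff)
  have set_int: "set_integrable lborel (cbox 0 a) (\<lambda>x. apply_bcontfun (sine_mode j) x * apply_bcontfun (sine_mode l) x)"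
    unfolding set_integrable_def
    by (rule borel_integrable_compact) (auto intro!: continuous_intros)
  have "ip (sine_mode j) (sine_mode l) = (LINT x:cbox 0 a|lborel. apply_bcontfun (sine_mode j) x * apply_bcontfun (sine_mode l) x)"
    unfolding ip_def using set_borel_integral_eq_integral(2)[OF set_int] by simp
  also have "\<dots> = (LINT x|lborel. (\<Prod>i\<in>UNIV. f i (x $ i)))"
    unfolding set_lebesgue_integral_def
  proof (rule Bochner_Integration.integral_cong[OF refl])
    fix x :: "real^'n"
    show "indicator (cbox 0 a) x *\<^sub>R (apply_bcontfun (sine_mode j) x * apply_bcontfun (sine_mode l) x) = (\<Prod>i\<in>UNIV. f i (x $ i))"
    proof (cases "x \<in> cbox 0 a")
      case True
      then show ?thesis by (simp add: apply_sine_mode_cbox f_def prod.distrib mem_cbox_cuboid)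
    next
      case False
      then obtain i where "\<not> (0 \<le> x $ i \<and> x $ i \<le> a $ i)" by (auto simp: mem_cbox_cuboid)
      then have "f i (x $ i) = 0" by (simp add: f_def)
      then show ?thesis using False by auto
    qed
  qed
  also have "\<dots> = (\<Prod>i\<in>UNIV. (LINT y|lborel. f i y))"
    by (rule lborel_integral_prod_coordinates[OF f(1)])
  finally have eq: "ip (sine_mode j) (sine_mode l) = (\<Prod>i\<in>UNIV. (LINT y|lborel. f i y))" .
  have "(LINT y|lborel. f i y) = 0"
    unfolding f(2) by (rule integral_sin_sin_orthogonal) (use i assms side_pos in \<open>auto simp: positive_points_def\<close>)
  then show ?thesis unfolding eq by auto
qed

text \<open>The ground state has no zero inside the cuboid, so a function that vanishes near the
  boundary can be divided by it. This turns approximation by sums of modes into approximation of the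
  quotient by polynomials in cosines.\<close>

lemma first_sine_mode_pos:
  assumes "x \<in> box 0 a"
  shows "0 < apply_bcontfun (sine_mode 1) x"
proof -
  have "x \<in> cbox 0 a" using assms box_subset_cbox by blast
  moreover have "0 < sin (pi * 1 / a $ i * x $ i)" for i
    by (rule sin_gt_zero) (use assms side_pos[of i] in \<open>auto simp: mem_box_cuboid field_simps\<close>)
  ultimately show ?thesis by (auto simp: apply_sine_mode_cbox intro!: prod_pos)
qed

lemma ip_sine_mode_self:
  assumes "j \<in> positive_points"
  shows "ip (sine_mode j) (sine_mode j) \<noteq> 0"
proof
  assume "ip (sine_mode j) (sine_mode j) = 0"
  then have z: "sine_mode j = 0" by (rule ip_self_eq_0) (rule sine_mode_outside)
  \<comment> \<open>At this point each sine has the argument pi / 2, so the mode takes the value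
    1.\<close>
  define x where "x = (\<chi> i. a $ i / (2 * j $ i))"
  have j: "0 < j $ i" for i using assms by (simp add: positive_points_def)
  have "x \<in> cbox 0 a"
  proof -
    have "a $ i / (2 * j $ i) \<le> a $ i" for i
    proof -
      have "1 \<le> real_of_int (2 * j $ i)" using j[of i] by linarith
      then show ?thesis using side_pos[of i] by (simp add: divide_le_eq)
    qed
    then show ?thesis using side_pos j by (auto simp: mem_cbox_cuboid x_def intro!: divide_nonneg_pos less_imp_le[OF side_pos])
  qed
  then have "apply_bcontfun (sine_mode j) x = (\<Prod>i\<in>UNIV. sin (pi / 2))"
    using side_pos j by (auto simp: apply_sine_mode_cbox x_def less_imp_neq[THEN not_sym] intro!: prod.cong)
  then show False using z by simp
qed

text \<open>Multiplication by the cosine of one coordinate shifts the index by one up and down,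
  because sin A cos B = (sin (A + B) + sin (A - B)) / 2.\<close>

lemma span_modes_times_cos:
  assumes p: "p \<in> span (sine_mode ` positive_points)"
  shows "\<exists>q\<in>span (sine_mode ` positive_points). \<forall>x\<in>cbox 0 a.
    apply_bcontfun q x = cos (pi / a $ m * x $ m) * apply_bcontfun p x"
  using p
proof (induction rule: span_induct_alt)
  case base
  show ?case by (rule bexI[of _ 0]) (auto intro: span_zero)
next
  case (step c u p)
  then obtain j q where j: "j \<in> positive_points" "u = sine_mode j"
    and q: "q \<in> span (sine_mode ` positive_points)"
     "\<forall>x\<in>cbox 0 a. apply_bcontfun q x = cos (pi / a $ m * x $ m) * apply_bcontfun p x"
    by auto
  define e where "e = (axis m 1 :: int ^ 'n)"
  have near: "sine_mode (j + e) \<in> span (sine_mode ` positive_points)"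
    using j by (intro span_base imageI) (auto simp: positive_points_def e_def axis_def add_pos_nonneg)
  have near': "sine_mode (j - e) \<in> span (sine_mode ` positive_points)"
  \<comment> \<open>The downward shift can leave the positive indices only through a zero
    coordinate, and there the mode vanishes identically.\<close>
  proof (cases "j $ m = 1")
    case True
    have "sine_mode (j - e) = 0"
    proof (rule bcontfun_eqI)
      fix x
      have "sin (pi * (j - e) $ m / a $ m * max 0 (min (a $ m) (x $ m))) = 0"
        using True by (simp add: e_def)
      then show "apply_bcontfun (sine_mode (j - e)) x = apply_bcontfun 0 x"
        by (auto simp: apply_sine_mode)
    qed
    then show ?thesis by (simp add: span_zero)
  next
    case False
    have "0 < j $ m" using j by (simp add: positive_points_def)
    with False have "1 < j $ m" by linarith
    then have "j - e \<in> positive_points"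
      using j by (auto simp: positive_points_def e_def axis_def)
    then show ?thesis by (intro span_base imageI)
  qed
  have id: "(1/2) * apply_bcontfun (sine_mode (j + e)) x + (1/2) * apply_bcontfun (sine_mode (j - e)) x
    = cos (pi / a $ m * x $ m) * apply_bcontfun (sine_mode j) x" if x: "x \<in> cbox 0 a" for x
  proof -
    define P where "P = (\<Prod>i\<in>UNIV - {m}. sin (pi * j $ i / a $ i * x $ i))"
    have rem: "(\<Prod>i\<in>UNIV. f i) = f m * (\<Prod>i\<in>UNIV - {m}. f i)" for f :: "'n \<Rightarrow> real"
      by (rule prod.remove) auto
    have P: "(\<Prod>i\<in>UNIV - {m}. sin (pi * (j + e) $ i / a $ i * x $ i)) = P"
      "(\<Prod>i\<in>UNIV - {m}. sin (pi * (j - e) $ i / a $ i * x $ i)) = P"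
      by (auto simp: P_def e_def axis_def intro!: prod.cong)
    define A where "A = pi * j $ m / a $ m * x $ m"
    define B where "B = pi / a $ m * x $ m"
    have AB: "pi * (j + e) $ m / a $ m * x $ m = A + B" "pi * (j - e) $ m / a $ m * x $ m = A - B"
      by (simp_all add: A_def B_def e_def algebra_simps add_divide_distrib diff_divide_distrib)
    show ?thesis
      unfolding apply_sine_mode_cbox[OF x] rem P AB
      unfolding A_def[symmetric] B_def[symmetric] P_def[symmetric]
      by (simp add: sin_add sin_diff algebra_simps)
  qed
  show ?case
  proof (rule bexI[of _ "c *\<^sub>R ((1/2) *\<^sub>R sine_mode (j + e) + (1/2) *\<^sub>R sine_mode (j - e)) + q"])
    show "c *\<^sub>R ((1/2) *\<^sub>R sine_mode (j + e) + (1/2) *\<^sub>R sine_mode (j - e)) + q \<in> span (sine_mode ` positive_points)"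
      by (intro span_add span_scale near near' q)
    show "\<forall>x\<in>cbox 0 a. apply_bcontfun (c *\<^sub>R ((1/2) *\<^sub>R sine_mode (j + e) + (1/2) *\<^sub>R sine_mode (j - e)) + q) x
        = cos (pi / a $ m * x $ m) * apply_bcontfun (c *\<^sub>R u + p) x"
    proof
      fix x assume x: "x \<in> cbox 0 a"
      show "apply_bcontfun (c *\<^sub>R ((1/2) *\<^sub>R sine_mode (j + e) + (1/2) *\<^sub>R sine_mode (j - e)) + q) x
        = cos (pi / a $ m * x $ m) * apply_bcontfun (c *\<^sub>R u + p) x"
        unfolding plus_bcontfun.rep_eq scaleR_bcontfun.rep_eq j real_scaleR_def id[OF x] bspec[OF q(2) x]
        by (simp add: algebra_simps)
    qed
  qed
qed

text \<open>Iterating the rule for one cosine makes the span a module over the polynomials in the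
  coordinate cosines. Applied to the ground state: its product with any such polynomial is a finite
  sum of modes.\<close>

lemma span_modes_times_polynomial:
  assumes g: "real_polynomial_function g" and p: "p \<in> span (sine_mode ` positive_points)"
  shows "\<exists>q\<in>span (sine_mode ` positive_points). \<forall>x\<in>cbox 0 a.
    apply_bcontfun q x = g (\<chi> i. cos (pi / a $ i * x $ i)) * apply_bcontfun p x"
  using g p
proof (induction arbitrary: p rule: real_polynomial_function.induct)
  case (linear f)
  obtain q where q: "\<And>m. q m \<in> span (sine_mode ` positive_points)"
    "\<And>m x. x \<in> cbox 0 a \<Longrightarrow> apply_bcontfun (q m) x = cos (pi / a $ m * x $ m) * apply_bcontfun p x"
    using span_modes_times_cos[OF linear(2)] by metis
  have f: "f y = (\<Sum>m\<in>UNIV. y $ m * f (axis m 1))" for y :: "real ^ 'n"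
  proof -
    have "f y = f (\<Sum>m\<in>UNIV. y $ m *\<^sub>R axis m 1)"
      using basis_expansion[of y] by (simp add: scalar_mult_eq_scaleR)
    then show ?thesis
      using linear(1) by (simp add: bounded_linear.linear linear_sum linear_cmul)
  qed
  have ap: "apply_bcontfun (\<Sum>m\<in>S. h m) x = (\<Sum>m\<in>S. apply_bcontfun (h m) x)"
    for S and h :: "'n \<Rightarrow> (real ^ 'n) \<Rightarrow>\<^sub>C real" and x
    by (induction S rule: infinite_finite_induct) (auto simp: plus_bcontfun.rep_eq)
  have "apply_bcontfun (\<Sum>m\<in>UNIV. f (axis m 1) *\<^sub>R q m) x =
      f (\<chi> i. cos (pi / a $ i * x $ i)) * apply_bcontfun p x" if "x \<in> cbox 0 a" for x
    unfolding f[of "\<chi> i. cos (pi / a $ i * x $ i)"] ap using that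
    by (auto simp: scaleR_bcontfun.rep_eq q sum_distrib_right intro!: sum.cong)
  then show ?case
    by (intro bexI[of _ "\<Sum>m\<in>UNIV. f (axis m 1) *\<^sub>R q m"]) (auto intro!: span_sum span_scale q)
next
  case (const c)
  then show ?case by (intro bexI[of _ "c *\<^sub>R p"]) (auto simp: scaleR_bcontfun.rep_eq intro: span_scale)
next
  case (add f g)
  obtain q where q: "q \<in> span (sine_mode ` positive_points)"
    "\<forall>x\<in>cbox 0 a. apply_bcontfun q x = f (\<chi> i. cos (pi / a $ i * x $ i)) * apply_bcontfun p x"
    using add(3)[OF add(5)] by blast
  obtain r where r: "r \<in> span (sine_mode ` positive_points)"
    "\<forall>x\<in>cbox 0 a. apply_bcontfun r x = g (\<chi> i. cos (pi / a $ i * x $ i)) * apply_bcontfun p x"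
    using add(4)[OF add(5)] by blast
  show ?case
    by (intro bexI[of _ "q + r"]) (use q r in \<open>auto simp: plus_bcontfun.rep_eq distrib_right intro: span_add\<close>)
next
  case (mult f g)
  obtain r where r: "r \<in> span (sine_mode ` positive_points)"
    "\<forall>x\<in>cbox 0 a. apply_bcontfun r x = g (\<chi> i. cos (pi / a $ i * x $ i)) * apply_bcontfun p x"
    using mult(4)[OF mult(5)] by blast
  obtain q where q: "q \<in> span (sine_mode ` positive_points)"
    "\<forall>x\<in>cbox 0 a. apply_bcontfun q x = f (\<chi> i. cos (pi / a $ i * x $ i)) * apply_bcontfun r x"
    using mult(3)[OF r(1)] by blast
  show ?case
    by (intro bexI[of _ q]) (use q r in \<open>auto simp: mult.assoc\<close>)
qed

lemma positive_points_1: "(1 :: int ^ 'n) \<in> positive_points"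
  by (simp add: positive_points_def)

text \<open>The substitution y_i = cos (pi x_i / a_i) maps the closed cuboid homeomorphically onto
  [-1, 1]^n, where the quotient of u by the ground state is approximated by a polynomial.
  Multiplying back by the ground state, which is at most one, gives a sum of modes. The obstacle is
  that the quotient may be unbounded near the boundary, so u is first replaced by a nearby function
  that vanishes there.\<close>

lemma span_modes_dense:
  fixes u :: "(real ^ 'n) \<Rightarrow>\<^sub>C real"
  assumes out: "\<And>x. x \<notin> box 0 a \<Longrightarrow> apply_bcontfun u x = 0" and "0 < \<epsilon>"
  shows "\<exists>p\<in>span (sine_mode ` positive_points). \<forall>x\<in>cbox 0 a. \<bar>apply_bcontfun u x - apply_bcontfun p x\<bar> \<le> \<epsilon>"
proof -
  define \<delta> where "\<delta> = \<epsilon> / 2"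
  have d: "0 < \<delta>" using \<open>0 < \<epsilon>\<close> by (simp add: \<delta>_def)
  \<comment> \<open>Soft thresholding: u is diminished by its truncation to [-\<delta>, \<delta>].
    The result is continuous, differs from u by at most \<delta>, and vanishes wherever |u| <
    \<delta>, hence in a neighbourhood of the boundary.\<close>
  define w where "w x = apply_bcontfun u x - max (- \<delta>) (min \<delta> (apply_bcontfun u x))" for x
  define S where "S = apply_bcontfun (sine_mode 1)"
  have wu: "\<bar>apply_bcontfun u x - w x\<bar> \<le> \<delta>" for x using d by (auto simp: w_def)
  have contw: "isCont w x" and contS: "isCont S x" and contu: "isCont (apply_bcontfun u) x" for x
  proof -
    have c: "isCont (apply_bcontfun v) x" for v :: "(real ^ 'n) \<Rightarrow>\<^sub>C real"
      using continuous_on_eq_continuous_at[OF open_UNIV, of "apply_bcontfun v"] by simp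
    show "isCont w x" "isCont S x" "isCont (apply_bcontfun u) x"
      unfolding w_def S_def by (intro continuous_intros c)+
  qed
  have w0: "w x = 0" if "\<bar>apply_bcontfun u x\<bar> < \<delta>" for x
    using that by (auto simp: w_def)
  \<comment> \<open>Where |u| < \<delta> the quotient is locally zero, also at zeros of S by the
    convention for division by zero. Elsewhere u is nonzero, so the point lies inside the cuboid and
    S is positive.\<close>
  have contq: "isCont (\<lambda>x. w x / S x) x" for x
  proof (cases "\<bar>apply_bcontfun u x\<bar> < \<delta>")
    case True
    then have "eventually (\<lambda>y. \<bar>apply_bcontfun u y\<bar> < \<delta>) (nhds x)"
      using contu[of x] by (intro order_tendstoD(2)[of _ "\<bar>apply_bcontfun u x\<bar>"] tendsto_rabs)
        (auto simp: isCont_def tendsto_at_iff_tendsto_nhds)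
    then have "eventually (\<lambda>y. w y / S y = 0) (nhds x)"
      by eventually_elim (simp add: w0)
    from isCont_cong[OF this] show ?thesis by simp
  next
    case False
    then have "apply_bcontfun u x \<noteq> 0" using d by auto
    then have "x \<in> box 0 a" using out by blast
    then have "S x \<noteq> 0" using first_sine_mode_pos[of x] by (simp add: S_def)
    then show ?thesis using contw contS by (intro continuous_intros)
  qed
  \<comment> \<open>The inverse of the cosine substitution; its continuity on the closed cube
    carries the quotient over to the variable y.\<close>
  define \<Phi> where "\<Phi> y = (\<chi> i. a $ i / pi * arccos (y $ i))" for y :: "real ^ 'n"
  let ?C = "cbox (\<chi> i. -1) (\<chi> i. 1) :: (real^'n) set"
  have "continuous_on ?C \<Phi>"
    unfolding \<Phi>_def by (intro continuous_intros) (auto simp: mem_box_cart)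
  then have "continuous_on ?C (\<lambda>y. w (\<Phi> y) / S (\<Phi> y))"
    using continuous_on_compose2[of UNIV "\<lambda>x. w x / S x" ?C \<Phi>] contq
    by (auto simp: continuous_on_eq_continuous_at)
  from Stone_Weierstrass_real_polynomial_function[OF compact_cbox this d]
  obtain g where g: "real_polynomial_function g"
    "\<And>y. y \<in> ?C \<Longrightarrow> \<bar>w (\<Phi> y) / S (\<Phi> y) - g y\<bar> < \<delta>" by blast
  have "sine_mode 1 \<in> span (sine_mode ` positive_points)"
    using positive_points_1 by (intro span_base) auto
  from span_modes_times_polynomial[OF g(1) this]
  obtain p where p: "p \<in> span (sine_mode ` positive_points)"
    "\<forall>x\<in>cbox 0 a. apply_bcontfun p x = g (\<chi> i. cos (pi / a $ i * x $ i)) * S x"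
    unfolding S_def by blast
  have "\<bar>apply_bcontfun u x - apply_bcontfun p x\<bar> \<le> \<epsilon>" if x: "x \<in> cbox 0 a" for x
  proof -
    define y where "y = (\<chi> i. cos (pi / a $ i * x $ i))"
    have "arccos (cos (pi / a $ i * x $ i)) = pi / a $ i * x $ i" for i
      by (rule arccos_cos) (use x side_pos[of i] in \<open>auto simp: mem_cbox_cuboid field_simps\<close>)
    then have "\<Phi> y = x" using side_pos by (simp add: \<Phi>_def y_def vec_eq_iff less_imp_neq[THEN not_sym])
    moreover have "y \<in> ?C" by (auto simp: y_def mem_box_cart)
    ultimately have gy: "\<bar>w x / S x - g y\<bar> \<le> \<delta>" using g(2)[of y] by simp
    have "\<bar>w x - g y * S x\<bar> \<le> \<delta>"
    proof (cases "S x = 0")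
      case True
      then have "x \<notin> box 0 a" using first_sine_mode_pos[of x] by (auto simp: S_def)
      then have "w x = 0" using w0 out d by simp
      then show ?thesis using True d by simp
    next
      case False
      have S1: "\<bar>S x\<bar> \<le> 1" unfolding S_def apply_sine_mode by (auto simp: abs_prod intro!: prod_le_1)
      have "\<bar>w x - g y * S x\<bar> = \<bar>w x / S x - g y\<bar> * \<bar>S x\<bar>"
        using False by (simp add: abs_mult[symmetric] left_diff_distrib)
      also have "\<dots> \<le> \<delta> * 1" using gy S1 d by (intro mult_mono) auto
      finally show ?thesis by simp
    qed
    moreover have "apply_bcontfun p x = g y * S x" using p(2) x by (simp add: y_def)
    ultimately show ?thesis using wu[of x] d unfolding \<delta>_def by linarith
  qed
  then show ?thesis using p(1) by blast
qed

text \<open>The resolvent \<open>(1 - \<Delta>)\<^sup>-\<^sup>1\<close> on combinations of modes.\<close>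

lemma span_modes_resolvent:
  assumes "p \<in> span (sine_mode ` positive_points)"
  shows "\<exists>q L. (\<forall>x. x \<notin> box 0 a \<longrightarrow> apply_bcontfun q x = 0) \<and>
     has_laplacian_on (apply_bcontfun q) L (box 0 a) \<and>
     (\<forall>x\<in>box 0 a. apply_bcontfun q x - L x = apply_bcontfun p x) \<and>
     (\<forall>j\<in>positive_points. (1 + mode_eigenvalue j) * ip q (sine_mode j) = ip p (sine_mode j))"
  using assms
proof (induction rule: span_induct_alt)
  case base
  have "has_laplacian_on (\<lambda>x. 0) (\<lambda>x. 0) (box 0 a)"
    using has_laplacian_on_scale[OF has_laplacian_on_sine_mode[of 1], of 0] by simp
  then show ?case by (intro exI[of _ 0] exI[of _ "\<lambda>x. 0"]) (auto simp: zero_bcontfun.rep_eq[abs_def])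
next
  case (step c u p)
  then obtain j where j: "j \<in> positive_points" "u = sine_mode j" by auto
  from step obtain q L where q: "\<forall>x. x \<notin> box 0 a \<longrightarrow> apply_bcontfun q x = 0"
     "has_laplacian_on (apply_bcontfun q) L (box 0 a)"
     "\<forall>x\<in>box 0 a. apply_bcontfun q x - L x = apply_bcontfun p x"
     "\<forall>j\<in>positive_points. (1 + mode_eigenvalue j) * ip q (sine_mode j) = ip p (sine_mode j)" by blast
  define k where "k = c / (1 + mode_eigenvalue j)"
  have k: "k * (1 + mode_eigenvalue j) = c"
    using mode_eigenvalue_nonneg[of j] by (simp add: k_def)
  let ?q = "k *\<^sub>R sine_mode j + q"
  have "has_laplacian_on (\<lambda>x. k * apply_bcontfun (sine_mode j) x + apply_bcontfun q x)
      (\<lambda>x. k * (- mode_eigenvalue j * apply_bcontfun (sine_mode j) x) + L x) (box 0 a)"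
    by (intro has_laplacian_on_add has_laplacian_on_scale has_laplacian_on_sine_mode q)
  moreover have "k * apply_bcontfun (sine_mode j) x + apply_bcontfun q x
       - (k * (- mode_eigenvalue j * apply_bcontfun (sine_mode j) x) + L x)
       = c * apply_bcontfun (sine_mode j) x + apply_bcontfun p x" if "x \<in> box 0 a" for x
    using q(3) that unfolding k[symmetric] by (simp add: algebra_simps)
  moreover have "(1 + mode_eigenvalue l) * ip ?q (sine_mode l) = ip (c *\<^sub>R u + p) (sine_mode l)"
    if l: "l \<in> positive_points" for l
  proof -
    have "(1 + mode_eigenvalue l) * (k * ip (sine_mode j) (sine_mode l)) = c * ip (sine_mode j) (sine_mode l)"
      using k ip_sine_modes[OF j(1) l] by (cases "j = l") (auto simp: mult_ac)
    then show ?thesis using q(4) l by (simp add: ip_add ip_scale j distrib_left)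
  qed
  ultimately show ?case
    using q(1) j sine_mode_outside
    by (intro exI[of _ ?q] exI[of _ "\<lambda>x. k * (- mode_eigenvalue j * apply_bcontfun (sine_mode j) x) + L x"])
      (auto simp: plus_bcontfun.rep_eq scaleR_bcontfun.rep_eq)
qed

text \<open>Symmetry of the Laplacian would give this at once if integration by parts were available
  for u. It is available for sums of modes in the form (1 + \<lambda>) (q, s) = (p, s), where s is a
  mode with eigenvalue \<lambda> and q is the resolvent of p. Taking p close to u makes u close to
  (1 + \<mu>) q, so in the limit (1 + \<lambda>) (u, s) = (1 + \<mu>) (u, s), and \<lambda> \<noteq>
  \<mu> leaves zero.\<close>

lemma eigenfunction_orthogonal:
  assumes u: "u \<in> dirichlet_eigenspace (box 0 a) \<mu>" and j: "j \<in> positive_points"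
    and ne: "mode_eigenvalue j \<noteq> \<mu>"
  shows "ip u (sine_mode j) = 0"
proof -
  have out: "\<And>x. x \<notin> box 0 a \<Longrightarrow> apply_bcontfun u x = 0"
    and Lu: "has_laplacian_on (apply_bcontfun u) (\<lambda>x. - \<mu> * apply_bcontfun u x) (box 0 a)"
    using u by (auto simp: dirichlet_eigenspace_def)
  define V where "V = measure lborel (cbox 0 a)"
  have bound: "\<bar>(mode_eigenvalue j - \<mu>) * ip u (sine_mode j)\<bar> \<le> \<epsilon> * (\<bar>1 + \<mu>\<bar> * (2 + mode_eigenvalue j) * V)"
    if "0 < \<epsilon>" for \<epsilon>
  proof -
    obtain p where p: "p \<in> span (sine_mode ` positive_points)"
      "\<forall>x\<in>cbox 0 a. \<bar>apply_bcontfun u x - apply_bcontfun p x\<bar> \<le> \<epsilon>"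
      using span_modes_dense[OF out \<open>0 < \<epsilon>\<close>] by blast
    obtain q L where q: "\<forall>x. x \<notin> box 0 a \<longrightarrow> apply_bcontfun q x = 0"
     "has_laplacian_on (apply_bcontfun q) L (box 0 a)"
     "\<forall>x\<in>box 0 a. apply_bcontfun q x - L x = apply_bcontfun p x"
     "\<forall>j\<in>positive_points. (1 + mode_eigenvalue j) * ip q (sine_mode j) = ip p (sine_mode j)"
      using span_modes_resolvent[OF p(1)] by blast
    \<comment> \<open>Since u - \<Delta> u = (1 + \<mu>) u, this difference satisfies v - \<Delta> v
      = (1 + \<mu>) (u - p), a quantity of size at most |1 + \<mu>| \<epsilon>, and the maximum
      principle passes the bound to v.\<close>
    define v where "v = u + (- (1 + \<mu>)) *\<^sub>R q"
    have v: "apply_bcontfun v x = apply_bcontfun u x + (- (1 + \<mu>)) * apply_bcontfun q x" for x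
      by (simp add: v_def plus_bcontfun.rep_eq scaleR_bcontfun.rep_eq)
    have Lv: "has_laplacian_on (apply_bcontfun v)
        (\<lambda>x. - \<mu> * apply_bcontfun u x + (- (1 + \<mu>)) * L x) (box 0 a)"
      unfolding v[abs_def] by (intro has_laplacian_on_add has_laplacian_on_scale Lu q)
    have vb: "\<bar>apply_bcontfun v x\<bar> \<le> \<bar>1 + \<mu>\<bar> * \<epsilon>" for x
    proof (rule maximum_principle[OF Lv])
      fix x assume x: "x \<in> box 0 a"
      have "apply_bcontfun v x - (- \<mu> * apply_bcontfun u x + (- (1 + \<mu>)) * L x)
          = (1 + \<mu>) * (apply_bcontfun u x - (apply_bcontfun q x - L x))"
        by (simp add: v algebra_simps)
      also have "\<dots> = (1 + \<mu>) * (apply_bcontfun u x - apply_bcontfun p x)" using q(3) x by simp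
      finally show "\<bar>apply_bcontfun v x - (- \<mu> * apply_bcontfun u x + (- (1 + \<mu>)) * L x)\<bar> \<le> \<bar>1 + \<mu>\<bar> * \<epsilon>"
        using p(2) x box_subset_cbox[of 0 a] by (auto simp: abs_mult intro!: mult_left_mono)
    next
      show "continuous_on UNIV (apply_bcontfun v)" by simp
    qed (use out q \<open>0 < \<epsilon>\<close> in \<open>simp_all add: v\<close>)
    have s1: "\<bar>apply_bcontfun (sine_mode j) x\<bar> \<le> 1" for x
      unfolding apply_sine_mode by (auto simp: abs_prod intro!: prod_le_1)
    have b1: "\<bar>ip v (sine_mode j)\<bar> \<le> \<bar>1 + \<mu>\<bar> * \<epsilon> * 1 * V"
      unfolding V_def by (rule ip_bound) (use vb s1 \<open>0 < \<epsilon>\<close> in auto)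
    have b2: "\<bar>ip (u - p) (sine_mode j)\<bar> \<le> \<epsilon> * 1 * V"
      unfolding V_def by (rule ip_bound) (use p(2) s1 \<open>0 < \<epsilon>\<close> in \<open>auto simp: minus_bcontfun.rep_eq\<close>)
    have "(1 + mode_eigenvalue j) * ip v (sine_mode j) =
       (1 + mode_eigenvalue j) * ip u (sine_mode j) - (1 + \<mu>) * ((1 + mode_eigenvalue j) * ip q (sine_mode j))"
      unfolding v_def ip_add ip_scale by (simp add: algebra_simps)
    also have "\<dots> = (1 + mode_eigenvalue j) * ip u (sine_mode j) - (1 + \<mu>) * (ip u (sine_mode j) - ip (u - p) (sine_mode j))"
      using q(4) j by (simp add: ip_diff)
    finally have "(mode_eigenvalue j - \<mu>) * ip u (sine_mode j) =
        (1 + mode_eigenvalue j) * ip v (sine_mode j) - (1 + \<mu>) * ip (u - p) (sine_mode j)"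
      by (simp add: algebra_simps)
    then have "\<bar>(mode_eigenvalue j - \<mu>) * ip u (sine_mode j)\<bar> \<le>
        (1 + mode_eigenvalue j) * \<bar>ip v (sine_mode j)\<bar> + \<bar>1 + \<mu>\<bar> * \<bar>ip (u - p) (sine_mode j)\<bar>"
      using mode_eigenvalue_nonneg[of j]
        abs_triangle_ineq4[of "(1 + mode_eigenvalue j) * ip v (sine_mode j)" "(1 + \<mu>) * ip (u - p) (sine_mode j)"]
      by (simp add: abs_mult)
    also have "\<dots> \<le> (1 + mode_eigenvalue j) * (\<bar>1 + \<mu>\<bar> * \<epsilon> * 1 * V) + \<bar>1 + \<mu>\<bar> * (\<epsilon> * 1 * V)"
      using b1 b2 mode_eigenvalue_nonneg[of j] by (intro add_mono mult_left_mono) auto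
    also have "\<dots> = \<epsilon> * (\<bar>1 + \<mu>\<bar> * (2 + mode_eigenvalue j) * V)" by (simp add: algebra_simps)
    finally show ?thesis .
  qed
  define K where "K = \<bar>1 + \<mu>\<bar> * (2 + mode_eigenvalue j) * V"
  have K: "K \<ge> 0" using mode_eigenvalue_nonneg[of j] by (simp add: K_def V_def)
  have "\<bar>(mode_eigenvalue j - \<mu>) * ip u (sine_mode j)\<bar> \<le> 0"
  proof (rule field_le_epsilon)
    fix e :: real assume "0 < e"
    then have "\<bar>(mode_eigenvalue j - \<mu>) * ip u (sine_mode j)\<bar> \<le> e / (K + 1) * K"
      using bound[of "e / (K + 1)"] K unfolding K_def[symmetric] by simp
    also have "\<dots> \<le> e" using K \<open>0 < e\<close> by (simp add: field_simps)
    finally show "\<bar>(mode_eigenvalue j - \<mu>) * ip u (sine_mode j)\<bar> \<le> 0 + e" by simp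
  qed
  then show ?thesis using ne by simp
qed

section \<open>Completeness of the modes and multiplicities of the eigenvalues\<close>

lemma modes_complete:
  assumes out: "\<And>x. x \<notin> box 0 a \<Longrightarrow> apply_bcontfun u x = 0"
    and orth: "\<And>j. j \<in> positive_points \<Longrightarrow> ip u (sine_mode j) = 0"
  shows "u = 0"
proof -
  have span0: "ip p u = 0" if "p \<in> span (sine_mode ` positive_points)" for p
    using that
    by (induction rule: span_induct_alt) (use orth in \<open>auto simp: ip_add ip_scale ip_commute[of "sine_mode _" u]\<close>)
  define K where "K = norm u * measure lborel (cbox 0 a)"
  have K: "K \<ge> 0" by (simp add: K_def)
  have "\<bar>ip u u\<bar> \<le> 0"
  proof (rule field_le_epsilon)
    fix e :: real assume "0 < e"
    define \<epsilon> where "\<epsilon> = e / (K + 1)"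
    have e: "\<epsilon> > 0" using \<open>0 < e\<close> K by (simp add: \<epsilon>_def)
    obtain p where p: "p \<in> span (sine_mode ` positive_points)"
      "\<forall>x\<in>cbox 0 a. \<bar>apply_bcontfun u x - apply_bcontfun p x\<bar> \<le> \<epsilon>"
      using span_modes_dense[OF out e] by blast
    have "ip u u = ip (u - p) u" using span0[OF p(1)] by (simp add: ip_diff)
    also have "\<bar>\<dots>\<bar> \<le> \<epsilon> * norm u * measure lborel (cbox 0 a)"
      by (rule ip_bound) (use p(2) e norm_bounded[of u] in \<open>auto simp: minus_bcontfun.rep_eq\<close>)
    also have "\<dots> = e / (K + 1) * K" by (simp add: K_def \<epsilon>_def)
    also have "\<dots> \<le> e" using K \<open>0 < e\<close> by (simp add: field_simps)
    finally show "\<bar>ip u u\<bar> \<le> 0 + e" by simp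
  qed
  then show ?thesis using ip_self_eq_0[of u] out by simp
qed

text \<open>Subtracting from an eigenfunction its projection onto the finitely many modes of the
  same eigenvalue leaves an eigenfunction orthogonal to every mode: to those by construction, to the
  others because the eigenvalues differ. Completeness then makes it zero.\<close>

lemma eigenspace_eq_span:
  "dirichlet_eigenspace (box 0 a) \<mu> = span (sine_mode ` {j \<in> positive_points. mode_eigenvalue j = \<mu>})"
proof (intro subset_antisym subsetI)
  define J where "J = {j \<in> positive_points. mode_eigenvalue j = \<mu>}"
  have fin: "finite J" using finite_modes_le[of \<mu>] by (rule finite_subset[rotated]) (auto simp: J_def)
  fix u assume u: "u \<in> dirichlet_eigenspace (box 0 a) \<mu>"
  define s where "s = (\<Sum>j\<in>J. (ip u (sine_mode j) / ip (sine_mode j) (sine_mode j)) *\<^sub>R sine_mode j)"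
  have s: "s \<in> span (sine_mode ` J)"
    unfolding s_def by (intro span_sum span_scale span_base) auto
  have "s \<in> dirichlet_eigenspace (box 0 a) \<mu>"
    unfolding s_def using sine_mode_in_eigenspace
    by (intro subspace_sum[OF eigenspace_subspace] subspace_scale[OF eigenspace_subspace]) (auto simp: J_def)
  then have us: "u - s \<in> dirichlet_eigenspace (box 0 a) \<mu>"
    using u eigenspace_subspace by (intro subspace_diff)
  have "u - s = 0"
  proof (rule modes_complete)
    show "apply_bcontfun (u - s) x = 0" if "x \<notin> box 0 a" for x
      using us that by (simp add: dirichlet_eigenspace_def)
    fix l :: "int ^ 'n" assume l: "l \<in> positive_points"
    show "ip (u - s) (sine_mode l) = 0"
    proof (cases "l \<in> J")
      case True
      have "ip s (sine_mode l) = (\<Sum>j\<in>J. if j = l then ip u (sine_mode l) else 0)"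
        unfolding s_def ip_sum ip_scale
        by (rule sum.cong) (use True ip_sine_modes ip_sine_mode_self in \<open>auto simp: J_def\<close>)
      also have "\<dots> = ip u (sine_mode l)" using True fin by simp
      finally show ?thesis by (simp add: ip_diff)
    next
      case False
      then show ?thesis using eigenfunction_orthogonal[OF us l] l by (auto simp: J_def)
    qed
  qed
  then show "u \<in> span (sine_mode ` {j \<in> positive_points. mode_eigenvalue j = \<mu>})"
    using s by (simp add: J_def)
next
  fix u assume "u \<in> span (sine_mode ` {j \<in> positive_points. mode_eigenvalue j = \<mu>})"
  then show "u \<in> dirichlet_eigenspace (box 0 a) \<mu>"
    using sine_mode_in_eigenspace span_minimal[OF _ eigenspace_subspace, of "sine_mode ` {j \<in> positive_points. mode_eigenvalue j = \<mu>}" \<mu>]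
    by auto
qed

lemma inj_on_sine_mode: "inj_on sine_mode positive_points"
  by (rule inj_onI) (metis ip_sine_modes ip_sine_mode_self)

lemma independent_modes:
  assumes "J \<subseteq> positive_points"
  shows "independent (sine_mode ` J)"
  unfolding dependent_def
proof
  assume "\<exists>v\<in>sine_mode ` J. v \<in> span (sine_mode ` J - {v})"
  then obtain j where j: "j \<in> J" "sine_mode j \<in> span (sine_mode ` J - {sine_mode j})" by blast
  have "ip p (sine_mode j) = 0" if "p \<in> span (sine_mode ` J - {sine_mode j})" for p
    using that
  proof (induction rule: span_induct_alt)
    case (step c u p)
    then obtain l where "l \<in> J" "u = sine_mode l" "l \<noteq> j" by auto
    then show ?case using step assms j ip_sine_modes[of l j] by (auto simp: ip_add ip_scale)
  qed simp
  then show False using ip_sine_mode_self j assms by blast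
qed

lemma dim_eigenspace:
  "dim (dirichlet_eigenspace (box 0 a) \<mu>) = card {j \<in> positive_points. mode_eigenvalue j = \<mu>}"
proof -
  let ?J = "{j \<in> positive_points. mode_eigenvalue j = \<mu>}"
  have "dim (dirichlet_eigenspace (box 0 a) \<mu>) = card (sine_mode ` ?J)"
    unfolding eigenspace_eq_span dim_span
    by (rule dim_eq_card_independent[OF independent_modes]) auto
  also have "\<dots> = card ?J" by (rule card_image) (rule inj_on_subset[OF inj_on_sine_mode], auto)
  finally show ?thesis .
qed

lemma dirichlet_eigenvalues_eq: "dirichlet_eigenvalues (box 0 a) = mode_eigenvalue ` positive_points"
proof (intro subset_antisym subsetI)
  fix \<mu> assume "\<mu> \<in> dirichlet_eigenvalues (box 0 a)"
  then obtain u where u: "u \<in> dirichlet_eigenspace (box 0 a) \<mu>" "u \<noteq> 0" by (auto simp: dirichlet_eigenvalues_def)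
  then have "{j \<in> positive_points. mode_eigenvalue j = \<mu>} \<noteq> {}"
    unfolding eigenspace_eq_span by (metis image_empty singletonD span_empty)
  then show "\<mu> \<in> mode_eigenvalue ` positive_points" by auto
next
  fix \<mu> assume "\<mu> \<in> mode_eigenvalue ` positive_points"
  then obtain j where "j \<in> positive_points" "\<mu> = mode_eigenvalue j" by auto
  moreover have "sine_mode j \<noteq> 0" using ip_sine_mode_self[OF \<open>j \<in> positive_points\<close>] by auto
  ultimately show "\<mu> \<in> dirichlet_eigenvalues (box 0 a)"
    using sine_mode_in_eigenspace[of j] by (auto simp: dirichlet_eigenvalues_def)
qed

theorem dirichlet_count_eq:
  "dirichlet_count (box 0 a) x = card {j \<in> positive_points. mode_eigenvalue j \<le> x}"
proof -
  let ?J = "{j \<in> positive_points. mode_eigenvalue j \<le> x}"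
  have fin: "finite ?J" using finite_modes_le[of x] by (rule finite_subset[rotated]) auto
  have eq: "{\<mu> \<in> dirichlet_eigenvalues (box 0 a). \<mu> \<le> x} = mode_eigenvalue ` ?J"
    unfolding dirichlet_eigenvalues_eq by auto
  have "dirichlet_count (box 0 a) x = (\<Sum>\<mu>\<in>mode_eigenvalue ` ?J. card {j \<in> ?J. mode_eigenvalue j = \<mu>})"
    unfolding dirichlet_count_def eq dim_eigenspace by (rule sum.cong) (auto intro!: arg_cong[of _ _ card])
  also have "\<dots> = card ?J"
    unfolding card_eq_sum by (rule sum.image_gen[OF fin, symmetric])
  finally show ?thesis .
qed

end

section \<open>Lattice points in ellipsoids\<close>

definition real_vec :: "int ^ 'n::finite \<Rightarrow> real ^ 'n" where
  "real_vec z = (\<chi> i. real_of_int (z $ i))"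

text \<open>Division by the sides turns the ellipsoid with semi-axes t a_i into the ball of radius
  t, so that all counting is expressed through one norm.\<close>

definition scaled :: "real ^ 'n::finite \<Rightarrow> real ^ 'n \<Rightarrow> real ^ 'n" where
  "scaled a x = (\<chi> i. x $ i / a $ i)"

definition full_points :: "real ^ 'n::finite \<Rightarrow> real \<Rightarrow> (int ^ 'n) set" where
  "full_points a t = {z. norm (scaled a (real_vec z)) \<le> t}"

text \<open>For t \<ge> 0 this is the eigenvalue counting function of the cuboid at (pi t)^2, by
  \<open>dirichlet_count_eq_pos_count\<close>.\<close>

definition pos_count :: "real ^ 'n::finite \<Rightarrow> real \<Rightarrow> nat" where
  "pos_count a t = card (full_points a t \<inter> positive_points)"

definition ellipsoid :: "real ^ 'n::finite \<Rightarrow> real \<Rightarrow> (real ^ 'n) set" where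
  "ellipsoid a t = {x. norm (scaled a x) \<le> t}"

text \<open>Half-open unit cubes centred at the lattice points for \<open>c = 1/2\<close>; for \<open>c = 1\<close> the lattice
  point is the upper corner.\<close>

definition unit_cell :: "real \<Rightarrow> int ^ 'n::finite \<Rightarrow> (real ^ 'n) set" where
  "unit_cell c z = {x. \<forall>i. \<lfloor>x $ i + c\<rfloor> = z $ i}"

lemma real_vec_nth [simp]: "real_vec z $ i = real_of_int (z $ i)"
  by (simp add: real_vec_def)

lemma scaled_nth [simp]: "scaled a x $ i = x $ i / a $ i"
  by (simp add: scaled_def)

lemma scaled_diff: "scaled a (x - y) = scaled a x - scaled a y"
  by (auto simp: vec_eq_iff diff_divide_distrib)

lemma continuous_scaled [continuous_intros]:
  "continuous_on S f \<Longrightarrow> continuous_on S (\<lambda>x. scaled a (f x))"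
  unfolding scaled_def divide_inverse by (intro continuous_intros)

lemma norm_scaled_power2: "(norm (scaled a x))\<^sup>2 = (\<Sum>i\<in>UNIV. (x $ i)\<^sup>2 / (a $ i)\<^sup>2)"
  by (simp add: norm_vec_def L2_set_def sum_nonneg power_divide)

lemma unit_cell_iff: "(x :: real ^ 'n::finite) \<in> unit_cell c z \<longleftrightarrow> (\<forall>i. real_of_int (z $ i) - c \<le> x $ i \<and> x $ i < real_of_int (z $ i) - c + 1)" for c :: real
  by (auto simp: unit_cell_def floor_eq_iff algebra_simps)

lemma cbox_cart: "cbox l u = {x :: real ^ 'n::finite. \<forall>i. l $ i \<le> x $ i \<and> x $ i \<le> u $ i}"
  by (auto simp: mem_box_cart)

lemma borel_component: "(\<lambda>x :: real ^ 'n::finite. x $ i) \<in> borel_measurable borel"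
  by (intro borel_measurable_continuous_onI continuous_intros)

lemma unit_cell_borel: "unit_cell c z \<in> sets borel"
proof -
  note [measurable] = borel_component
  have "unit_cell c z = {x \<in> space borel. \<forall>i\<in>UNIV. real_of_int (z $ i) - c \<le> x $ i \<and> x $ i < real_of_int (z $ i) - c + 1}"
    by (auto simp: unit_cell_iff)
  also have "\<dots> \<in> sets borel" by measurable
  finally show ?thesis .
qed

lemma bounded_cell: "bounded (unit_cell c z)"
  by (rule bounded_subset[OF bounded_cbox[of "\<chi> i. real_of_int (z $ i) - c" "\<chi> i. real_of_int (z $ i) - c + 1"]])
    (auto simp: unit_cell_iff mem_box_cart less_imp_le)

lemma lmeasurable_cell: "unit_cell c z \<in> lmeasurable"
  using bounded_set_imp_lmeasurable[OF bounded_cell] unit_cell_borel by (metis sets_completionI_sets sets_lborel)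

lemma measure_cell: "measure lebesgue (unit_cell c (z :: int ^ 'n::finite)) = 1"
proof -
  define l where "l = (\<chi> i. real_of_int (z $ i) - c)"
  define u where "u = (\<chi> i. real_of_int (z $ i) - c + 1)"
  have sub: "box l u \<subseteq> unit_cell c z" "unit_cell c z \<subseteq> cbox l u"
    by (auto simp: unit_cell_iff mem_box_cart l_def u_def less_imp_le)
  have c: "measure lebesgue (cbox l u) = 1"
  proof -
    have "cbox l u \<noteq> {}" by (auto simp: cbox_cart l_def u_def intro!: exI[of _ l])
    then show ?thesis by (simp add: content_cbox_cart) (simp add: l_def u_def)
  qed
  moreover have "measure lebesgue (box l u) = measure lebesgue (cbox l u)"
    by (simp add: measure_lborel_box_eq measure_lborel_cbox_eq)
  moreover have "measure lebesgue (box l u) \<le> measure lebesgue (unit_cell c z)"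
    using sub(1) lmeasurable_cell by (intro measure_mono_fmeasurable) auto
  moreover have "measure lebesgue (unit_cell c z) \<le> measure lebesgue (cbox l u)"
    using sub(2) lmeasurable_cell by (intro measure_mono_fmeasurable) (auto intro: fmeasurableD)
  ultimately show ?thesis by linarith
qed

lemma measure_Union_cells:
  assumes "finite Z"
  shows "measure lebesgue (\<Union>z\<in>Z. unit_cell c z) = card Z"
proof -
  have "measure lebesgue (\<Union>z\<in>Z. unit_cell c z) = (\<Sum>z\<in>Z. measure lebesgue (unit_cell c z))"
    by (rule measure_UNION_AE[OF assms lmeasurable_cell])
      (auto simp: pairwise_def unit_cell_def vec_eq_iff intro!: always_eventually)
  then show ?thesis by (simp add: measure_cell)
qed

text \<open>Cells are disjoint and of volume one, so those packed into \<open>U\<close> have total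
  volume \<open>card Z\<close>. The companion \<open>measure_le_card\<close> covers \<open>U\<close>
  by cells instead; the volume bounds for numbers of lattice points rest on this pair.\<close>

lemma card_le_measure:
  fixes c :: real
  assumes "finite Z" "U \<in> lmeasurable" "\<And>z. z \<in> Z \<Longrightarrow> unit_cell c z \<subseteq> U"
  shows "card (Z :: (int ^ 'n::finite) set) \<le> measure lebesgue U"
  unfolding measure_Union_cells[OF assms(1), of c, symmetric]
  by (rule measure_mono_fmeasurable) (use assms lmeasurable_cell in \<open>auto intro!: fmeasurableD fmeasurable.finite_UN\<close>)

lemma measure_le_card:
  fixes c :: real
  assumes "finite Z" "U \<in> lmeasurable" "\<And>x. x \<in> U \<Longrightarrow> (\<chi> i. \<lfloor>x $ i + c\<rfloor>) \<in> Z"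
  shows "measure lebesgue U \<le> card Z"
  unfolding measure_Union_cells[OF assms(1), of c, symmetric]
proof (rule measure_mono_fmeasurable)
  show "U \<subseteq> (\<Union>z\<in>Z. unit_cell c z)" using assms(3) by (force simp: unit_cell_def)
qed (use assms lmeasurable_cell in \<open>auto intro!: fmeasurableD fmeasurable.finite_UN\<close>)

lemma lmeasurable_bounded_borel: "bounded S \<Longrightarrow> S \<in> sets borel \<Longrightarrow> S \<in> lmeasurable"
  for S :: "'a::euclidean_space set"
  by (intro bounded_set_imp_lmeasurable) auto

lemma measure_stretch_preimage:
  fixes c :: "real ^ 'n::finite"
  assumes "S \<in> lmeasurable" "\<And>i. 0 < c $ i"
  shows "{x. scaled c x \<in> S} \<in> lmeasurable"
    and "measure lebesgue {x. scaled c x \<in> S} = (\<Prod>i\<in>UNIV. c $ i) * measure lebesgue S"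
proof -
  have "{x. scaled c x \<in> S} = (\<lambda>x. \<chi> k. c $ k * x $ k) ` S" (is "?A = ?f ` S")
  proof (intro subset_antisym subsetI)
    fix x assume x: "x \<in> ?A"
    have "x = ?f (scaled c x)" using assms(2) by (simp add: vec_eq_iff less_imp_neq[THEN not_sym])
    then show "x \<in> ?f ` S" using x by blast
  next
    fix x assume "x \<in> ?f ` S"
    then obtain y where "y \<in> S" "x = ?f y" by blast
    moreover have "scaled c (?f y) = y" using assms(2) by (simp add: vec_eq_iff less_imp_neq[THEN not_sym])
    ultimately show "x \<in> ?A" by simp
  qed
  moreover have "0 \<le> (\<Prod>i\<in>UNIV. c $ i)" using assms(2) by (auto intro: prod_nonneg less_imp_le)
  ultimately show "?A \<in> lmeasurable" "measure lebesgue ?A = (\<Prod>i\<in>UNIV. c $ i) * measure lebesgue S"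
    using measurable_stretch[OF assms(1), of "($) c"] measure_stretch[OF assms(1), of "($) c"] by auto
qed

context positive_cuboid begin

text \<open>An l1 bound for the scaled norm of a displacement whose coordinates are at most one in
  absolute value. Passing between a lattice point and a point of its cell changes the radius t by at
  most this amount.\<close>

definition cell_diam :: real where
  "cell_diam = (\<Sum>i\<in>UNIV. 1 / a $ i)"

lemma cell_diam_pos: "0 < cell_diam"
  unfolding cell_diam_def using side_pos by (intro sum_pos) auto

lemma norm_scaled_le:
  assumes "\<And>i. \<bar>x $ i\<bar> \<le> \<delta>"
  shows "norm (scaled a x) \<le> \<delta> * cell_diam"
proof -
  have "norm (scaled a x) \<le> (\<Sum>i\<in>UNIV. \<bar>scaled a x $ i\<bar>)" by (rule norm_le_l1_cart)
  also have "\<dots> \<le> (\<Sum>i\<in>UNIV. \<delta> * (1 / a $ i))"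
    using assms side_pos by (intro sum_mono) (auto simp: abs_mult abs_of_pos intro!: divide_right_mono intro: less_imp_le)
  finally show ?thesis by (simp add: cell_diam_def sum_distrib_left)
qed

lemma norm_scaled_le_cell_diam: "(\<And>i. \<bar>x $ i\<bar> \<le> 1) \<Longrightarrow> norm (scaled a x) \<le> cell_diam"
  using norm_scaled_le[of x 1] by simp

lemma component_le_norm_scaled: "\<bar>x $ i\<bar> \<le> a $ i * norm (scaled a x)"
proof -
  have "\<bar>x $ i / a $ i\<bar> \<le> norm (scaled a x)" using component_le_norm_cart[of "scaled a x" i] by simp
  then show ?thesis using side_pos[of i] by (simp add: abs_mult field_simps)
qed

lemma finite_full_points: "finite (full_points a t)"
proof -
  define B where "B = \<lceil>(\<Sum>i\<in>UNIV. a $ i) * \<bar>t\<bar>\<rceil>"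
  have "\<bar>z $ i\<bar> \<le> B" if "z \<in> full_points a t" for z i
  proof -
    have "\<bar>real_of_int (z $ i)\<bar> \<le> a $ i * norm (scaled a (real_vec z))"
      using component_le_norm_scaled[of "real_vec z" i] by simp
    also have "\<dots> \<le> (\<Sum>i\<in>UNIV. a $ i) * \<bar>t\<bar>"
      using that side_pos unfolding full_points_def
      by (intro mult_mono member_le_sum sum_nonneg) (auto intro: less_imp_le)
    finally show ?thesis unfolding B_def by linarith
  qed
  then show ?thesis by (intro finite_subset[OF _ finite_bounded_int_vec[of B]]) auto
qed

lemma mode_eigenvalue_eq: "mode_eigenvalue j = (pi * norm (scaled a (real_vec j)))\<^sup>2"
  unfolding power_mult_distrib norm_scaled_power2 mode_eigenvalue_def
  by (simp add: sum_distrib_left power_divide power_mult_distrib)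

lemma dirichlet_count_eq_pos_count:
  assumes "0 \<le> t"
  shows "dirichlet_count (box 0 a) ((pi * t)\<^sup>2) = pos_count a t"
proof -
  have "mode_eigenvalue j \<le> (pi * t)\<^sup>2 \<longleftrightarrow> norm (scaled a (real_vec j)) \<le> t" for j
    unfolding mode_eigenvalue_eq using assms by (simp add: abs_le_square_iff[symmetric])
  then show ?thesis
    unfolding dirichlet_count_eq pos_count_def full_points_def by (auto intro!: arg_cong[of _ _ card])
qed

lemma lmeasurable_ellipsoid: "ellipsoid a t \<in> lmeasurable"
proof -
  have "ellipsoid a t = {x. scaled a x \<in> cball 0 t}" by (simp add: ellipsoid_def)
  then show ?thesis using measure_stretch_preimage(1)[OF lmeasurable_cball side_pos, of 0 t] by simp
qed

lemma measure_ellipsoid: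
  assumes "0 \<le> t"
  shows "measure lebesgue (ellipsoid a t) = measure lborel (ball (0 :: real ^ 'n) 1) * t ^ CARD('n) * (\<Prod>i\<in>UNIV. a $ i)"
proof -
  have "ellipsoid a t = {x. scaled a x \<in> cball 0 t}" by (simp add: ellipsoid_def)
  then have "measure lebesgue (ellipsoid a t) = (\<Prod>i\<in>UNIV. a $ i) * measure lebesgue (cball (0 :: real ^ 'n) t)"
    using measure_stretch_preimage(2)[OF lmeasurable_cball side_pos, of 0 t] by simp
  also have "measure lebesgue (cball (0 :: real ^ 'n) t) = t ^ CARD('n) * measure lborel (ball (0 :: real ^ 'n) 1)"
    using assms by (simp add: content_cball content_ball)
  finally show ?thesis by simp
qed

end

text \<open>Boxes have boxes of the same volume as preimages, and Lebesgue measure is determined by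
  its values on boxes. For a permutation of one index type this is symmetry in the coordinates; for
  two different index types it moves integrals to a copy of the space.\<close>

lemma lborel_reindex:
  fixes \<pi> :: "'m::finite \<Rightarrow> 'n::finite"
  assumes "bij \<pi>"
  shows "distr lborel borel (\<lambda>x :: real ^ 'n. \<chi> j. x $ \<pi> j) = (lborel :: (real ^ 'm) measure)"
proof (rule lborel_eqI[symmetric])
  fix l u :: "real ^ 'm"
  assume le: "\<And>b. b \<in> Basis \<Longrightarrow> l \<bullet> b \<le> u \<bullet> b"
  have le': "l $ j \<le> u $ j" for j
    using le[of "axis j 1"] by (simp add: inner_axis)
  have Basis_prod: "(\<Prod>b\<in>Basis. v \<bullet> b) = (\<Prod>j\<in>UNIV. v $ j)" for v :: "real ^ 'k::finite"
  proof -
    have B: "Basis = range (\<lambda>j. axis j 1 :: real ^ 'k)" by (auto simp: Basis_vec_def)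
    have "inj (\<lambda>j. axis j 1 :: real ^ 'k)" by (auto simp: inj_on_def axis_eq_axis)
    then show ?thesis unfolding B by (simp add: prod.reindex inner_axis)
  qed
  have meas: "(\<lambda>x :: real ^ 'n. \<chi> j. x $ \<pi> j) \<in> lborel \<rightarrow>\<^sub>M borel"
    by (simp add: borel_measurable_continuous_onI continuous_intros)
  let ?l = "\<chi> i. l $ inv \<pi> i" and ?u = "\<chi> i. u $ inv \<pi> i"
  have inv: "inv \<pi> (\<pi> j) = j" "\<pi> (inv \<pi> i) = i" for i j
    using assms by (simp_all add: bij_is_inj bij_is_surj surj_f_inv_f)
  have pre: "(\<lambda>x :: real ^ 'n. \<chi> j. x $ \<pi> j) -` box l u \<inter> space lborel = box ?l ?u"
    by (auto simp: mem_box_cart) (metis inv)+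
  have "emeasure (distr lborel borel (\<lambda>x :: real ^ 'n. \<chi> j. x $ \<pi> j)) (box l u) = emeasure lborel (box ?l ?u)"
    using pre by (subst emeasure_distr[OF meas]) simp_all
  also have "\<dots> = (\<Prod>b\<in>Basis. (?u - ?l) \<bullet> b)"
  proof -
    have "\<forall>b\<in>Basis. ?l \<bullet> b \<le> ?u \<bullet> b"
      using le' by (auto simp: Basis_vec_def inner_axis)
    then show ?thesis by (simp add: emeasure_lborel_box_eq)
  qed
  also have "(\<Prod>b\<in>Basis. (?u - ?l) \<bullet> b) = (\<Prod>b\<in>Basis. (u - l) \<bullet> b)"
    unfolding Basis_prod
    using prod.reindex_bij_betw[of "inv \<pi>" UNIV UNIV "\<lambda>j. (u - l) $ j"] assms
    by (simp add: bij_betw_inv_into)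
  finally show "emeasure (distr lborel borel (\<lambda>x :: real ^ 'n. \<chi> j. x $ \<pi> j)) (box l u) = (\<Prod>b\<in>Basis. (u - l) \<bullet> b)" .
qed simp

text \<open>Zeroing a coordinate instead of removing it keeps the type. A section of dimension n - 1
  can then be measured by the n-dimensional volume of a slab of width one over it.\<close>

definition drop_coordinate :: "'n::finite \<Rightarrow> real ^ 'n \<Rightarrow> real ^ 'n" where
  "drop_coordinate i x = (\<chi> j. if j = i then 0 else x $ j)"

lemma drop_coordinate_nth [simp]: "drop_coordinate i x $ j = (if j = i then 0 else x $ j)"
  by (simp add: drop_coordinate_def)

lemma continuous_drop_coordinate [continuous_intros]:
  "continuous_on S f \<Longrightarrow> continuous_on S (\<lambda>x. drop_coordinate i (f x))"
proof -
  assume f: "continuous_on S f"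
  have "continuous_on S (\<lambda>x. if j = i then 0 else f x $ j)" for j
    by (cases "j = i") (auto intro!: continuous_intros f)
  then show ?thesis unfolding drop_coordinate_def by (rule continuous_on_vec_lambda)
qed

lemma norm_scaled_split:
  "(norm (scaled a x))\<^sup>2 = (x $ i / a $ i)\<^sup>2 + (norm (scaled a (drop_coordinate i x)))\<^sup>2"
proof -
  have rem: "(\<Sum>j\<in>UNIV. f j) = f i + (\<Sum>j\<in>UNIV - {i}. f j)" for f :: "'a \<Rightarrow> real"
    by (rule sum.remove) auto
  show ?thesis
    unfolding norm_scaled_power2 rem[of "\<lambda>j. (x $ j)\<^sup>2 / (a $ j)\<^sup>2"]
      rem[of "\<lambda>j. (drop_coordinate i x $ j)\<^sup>2 / (a $ j)\<^sup>2"]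
    by (auto simp: power_divide intro!: sum.cong)
qed

lemma norm_scaled_drop_le: "norm (scaled a (drop_coordinate i x)) \<le> norm (scaled a x)"
  by (rule power2_le_imp_le) (auto simp: norm_scaled_split[of a x i])

lemma prod_if_coordinate:
  fixes a :: "real ^ 'n::finite"
  shows "(\<Prod>j\<in>UNIV. if j = i then b else a $ j * t) = b * (\<Prod>j\<in>UNIV - {i}. a $ j) * t ^ (CARD('n) - 1)"
proof -
  have "(\<Prod>j\<in>UNIV. if j = i then b else a $ j * t) = b * (\<Prod>j\<in>UNIV - {i}. if j = i then b else a $ j * t)"
    by (subst prod.remove[of UNIV i]) auto
  also have "(\<Prod>j\<in>UNIV - {i}. if j = i then b else a $ j * t) = (\<Prod>j\<in>UNIV - {i}. a $ j * t)"
    by (rule prod.cong) auto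
  also have "\<dots> = (\<Prod>j\<in>UNIV - {i}. a $ j) * t ^ (CARD('n) - 1)"
    by (simp add: prod.distrib card_Diff_singleton)
  finally show ?thesis by simp
qed

section \<open>Slabs over sections of the unit ball\<close>

lemma bounded_by_components:
  fixes S :: "(real ^ 'n::finite) set"
  assumes "\<And>x i. x \<in> S \<Longrightarrow> \<bar>x $ i\<bar> \<le> B i"
  shows "bounded S"
proof (rule bounded_subset[OF bounded_cbox[of "\<chi> i. - B i" "\<chi> i. B i"]])
  show "S \<subseteq> cbox (\<chi> i. - B i) (\<chi> i. B i)"
  proof
    fix x assume "x \<in> S"
    then show "x \<in> cbox (\<chi> i. - B i) (\<chi> i. B i)"
      using assms[of x] by (simp add: mem_box_cart abs_le_iff minus_le_iff)
  qed
qed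

definition orthant_slab :: "'n::finite \<Rightarrow> (real ^ 'n) set" where
  "orthant_slab i = {x. 0 \<le> x $ i \<and> x $ i < 1 \<and> (\<forall>j. j \<noteq> i \<longrightarrow> 0 \<le> x $ j) \<and> norm (drop_coordinate i x) \<le> 1}"

text \<open>Its volume is that of the unit ball in dimension n - 1, the constant of the boundary
  term. The range [-1/2, 1/2) for the free coordinate is the one occupied by centred cells of
  lattice points whose i-th coordinate is zero.\<close>

definition full_slab :: "'n::finite \<Rightarrow> (real ^ 'n) set" where
  "full_slab i = {x. - 1/2 \<le> x $ i \<and> x $ i < 1/2 \<and> norm (drop_coordinate i x) \<le> 1}"

definition orthant_ball :: "(real ^ 'n::finite) set" where
  "orthant_ball = {x. (\<forall>j. 0 \<le> x $ j) \<and> norm x \<le> 1}"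

lemma drop_component_bound:
  assumes "norm (drop_coordinate i x) \<le> 1" "j \<noteq> i"
  shows "\<bar>x $ j\<bar> \<le> 1"
  using component_le_norm_cart[of "drop_coordinate i x" j] assms by auto

lemma borel_norm_drop: "(\<lambda>x. norm (drop_coordinate i x)) \<in> borel_measurable borel"
  by (intro borel_measurable_continuous_onI continuous_intros)

lemma lmeasurable_slabs: "orthant_slab i \<in> lmeasurable" "full_slab i \<in> lmeasurable"
  "orthant_ball \<in> lmeasurable"
proof -
  note [measurable] = borel_component borel_norm_drop
  have "orthant_slab i = {x \<in> space borel. 0 \<le> x $ i \<and> x $ i < 1 \<and> (\<forall>j\<in>UNIV. j \<noteq> i \<longrightarrow> 0 \<le> x $ j) \<and> norm (drop_coordinate i x) \<le> 1}"
    by (auto simp: orthant_slab_def)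
  also have "\<dots> \<in> sets borel" by measurable
  finally show "orthant_slab i \<in> lmeasurable"
  proof (rule lmeasurable_bounded_borel[rotated])
    show "bounded (orthant_slab i)"
      by (rule bounded_by_components[of _ "\<lambda>_. 1"])
        (use drop_component_bound in \<open>force simp: orthant_slab_def\<close>)
  qed
  have "full_slab i = {x \<in> space borel. - 1/2 \<le> x $ i \<and> x $ i < 1/2 \<and> norm (drop_coordinate i x) \<le> 1}"
    by (auto simp: full_slab_def)
  also have "\<dots> \<in> sets borel" by measurable
  finally show "full_slab i \<in> lmeasurable"
  proof (rule lmeasurable_bounded_borel[rotated])
    show "bounded (full_slab i)"
      by (rule bounded_by_components[of _ "\<lambda>_. 1"])
        (use drop_component_bound in \<open>force simp: full_slab_def abs_le_iff\<close>)
  qed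
  have "orthant_ball = {x \<in> space borel. (\<forall>j\<in>UNIV. 0 \<le> x $ j) \<and> norm (x :: real^'b) \<le> 1}"
    by (auto simp: orthant_ball_def)
  also have "\<dots> \<in> sets borel" by measurable
  finally show "orthant_ball \<in> (lmeasurable :: (real^'b) set set)"
    by (rule lmeasurable_bounded_borel[rotated])
      (auto intro: bounded_subset[OF bounded_cball[of 0 1]] simp: orthant_ball_def)
qed

lemma measure_pos_of_cbox:
  fixes S :: "(real ^ 'n::finite) set"
  assumes "S \<in> lmeasurable" "cbox 0 (\<chi> i. e) \<subseteq> S" "0 < e"
  shows "0 < measure lebesgue S"
proof -
  have "cbox 0 (\<chi> i. e) \<noteq> ({} :: (real ^ 'n) set)" using assms(3) by (auto simp: cbox_cart intro!: exI[of _ 0])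
  then have "measure lebesgue (cbox 0 (\<chi> i. e) :: (real ^ 'n) set) = e ^ CARD('n)"
    by (simp add: content_cbox_cart)
  moreover have "measure lebesgue (cbox 0 (\<chi> i. e) :: (real ^ 'n) set) \<le> measure lebesgue S"
    using assms by (intro measure_mono_fmeasurable) (auto intro: fmeasurableD)
  ultimately show ?thesis using assms(3) by (smt (verit) zero_less_power)
qed

lemma norm_le_of_components:
  fixes x :: "real ^ 'n::finite"
  assumes "\<And>i. \<bar>x $ i\<bar> \<le> 1 / (2 * CARD('n))"
  shows "norm x \<le> 1/2"
proof -
  have "norm x \<le> (\<Sum>i\<in>UNIV. \<bar>x $ i\<bar>)" by (rule norm_le_l1_cart)
  also have "\<dots> \<le> (\<Sum>i\<in>(UNIV :: 'n set). 1 / (2 * CARD('n)))" by (intro sum_mono assms)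
  also have "\<dots> = 1/2" by simp
  finally show ?thesis .
qed

lemma measure_slabs_pos:
  fixes i :: "'n::finite"
  shows "0 < measure lebesgue (orthant_slab i)" "0 < measure lebesgue (full_slab i)"
    "0 < measure lebesgue (orthant_ball :: (real ^ 'n) set)"
proof -
  define e :: real where "e = 1 / (4 * CARD('n))"
  have e: "0 < e" by (simp add: e_def)
  have e2: "e < 1/2"
  proof -
    have "1 \<le> real CARD('n)" by (simp add: Suc_le_eq)
    then have "1 < real CARD('n) * 2" by linarith
    then show ?thesis by (simp add: e_def field_simps)
  qed
  have e3: "e \<le> 1 / (2 * CARD('n))" by (simp add: e_def field_simps)
  have A: "norm (drop_coordinate j x) \<le> 1" "norm x \<le> 1" "x $ j < 1/2" "x $ j < 1" "0 \<le> x $ j" "- (1/2) \<le> x $ j"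
    if "x \<in> cbox 0 (\<chi> i. e)" for x :: "real ^ 'n" and j
  proof -
    have x: "0 \<le> x $ i" "x $ i \<le> e" for i using that by (auto simp: mem_box_cart)
    have "\<bar>drop_coordinate j x $ i\<bar> \<le> 1 / (2 * CARD('n))" "\<bar>x $ i\<bar> \<le> 1 / (2 * CARD('n))" for i
      using x[of i] e3 e by auto
    from norm_le_of_components[OF this(1)] norm_le_of_components[OF this(2)]
    show "norm (drop_coordinate j x) \<le> 1" "norm x \<le> 1" by auto
    show "x $ j < 1/2" "x $ j < 1" "0 \<le> x $ j" "- (1/2) \<le> x $ j" using x[of j] e2 by auto
  qed
  show "0 < measure lebesgue (orthant_slab i)"
    by (rule measure_pos_of_cbox[OF lmeasurable_slabs(1) _ e])
      (unfold orthant_slab_def, intro subsetI CollectI conjI allI impI, use A in auto)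
  show "0 < measure lebesgue (full_slab i)"
    by (rule measure_pos_of_cbox[OF lmeasurable_slabs(2) _ e])
      (unfold full_slab_def, intro subsetI CollectI conjI, use A in auto)
  show "0 < measure lebesgue (orthant_ball :: (real ^ 'n) set)"
    by (rule measure_pos_of_cbox[OF lmeasurable_slabs(3) _ e])
      (use A in \<open>auto simp: orthant_ball_def\<close>)
qed

text \<open>Exchanging the coordinates i and k carries one slab to the other. Hence all n pairs of
  opposite faces enter the boundary term with the same constant.\<close>

lemma measure_full_slab_eq: "measure lebesgue (full_slab (i :: 'n)) = measure lebesgue (full_slab (k :: 'n::finite))"
proof -
  define \<pi> where "\<pi> = Transposition.transpose i k"
  have "bij \<pi>" by (simp add: \<pi>_def)
  note d = lborel_reindex[OF this]
  have meas: "(\<lambda>x :: real ^ 'n. \<chi> j. x $ \<pi> j) \<in> lborel \<rightarrow>\<^sub>M borel"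
    by (simp add: borel_measurable_continuous_onI continuous_intros)
  have pp: "\<pi> (\<pi> j) = j" for j by (simp add: \<pi>_def)
  have nrm: "norm (drop_coordinate i (\<chi> j. x $ \<pi> j)) = norm (drop_coordinate k x)" for x :: "real ^ 'n"
  proof -
    have "(\<Sum>j\<in>UNIV. (drop_coordinate i (\<chi> j. x $ \<pi> j) $ j)\<^sup>2) = (\<Sum>j\<in>UNIV. (drop_coordinate k x $ \<pi> j)\<^sup>2)"
      by (intro sum.cong) (auto simp: \<pi>_def transpose_eq_iff)
    also have "\<dots> = (\<Sum>j\<in>UNIV. (drop_coordinate k x $ j)\<^sup>2)"
      using sum.reindex_bij_betw[OF \<open>bij \<pi>\<close>, of "\<lambda>j. (drop_coordinate k x $ j)\<^sup>2"] .
    finally show ?thesis by (simp add: norm_vec_def L2_set_def del: drop_coordinate_nth)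
  qed
  have pi: "\<pi> i = k" by (simp add: \<pi>_def)
  have bor: "full_slab i \<in> sets borel" for i :: 'n
  proof -
    note [measurable] = borel_component borel_norm_drop
    have "full_slab i = {x \<in> space borel. - 1/2 \<le> x $ i \<and> x $ i < 1/2 \<and> norm (drop_coordinate i x) \<le> 1}"
      by (auto simp: full_slab_def)
    also have "\<dots> \<in> sets borel" by measurable
    finally show ?thesis .
  qed
  have "measure lborel (full_slab i) = measure (distr lborel borel (\<lambda>x :: real ^ 'n. \<chi> j. x $ \<pi> j)) (full_slab i)"
    by (simp add: d)
  also have "\<dots> = measure lborel ((\<lambda>x :: real ^ 'n. \<chi> j. x $ \<pi> j) -` full_slab i \<inter> space lborel)"
    by (rule measure_distr[OF meas]) (simp add: bor)
  also have "(\<lambda>x :: real ^ 'n. \<chi> j. x $ \<pi> j) -` full_slab i \<inter> space lborel = full_slab k"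
    by (auto simp: full_slab_def nrm pi)
  finally show ?thesis using bor by simp
qed

section \<open>Bounds for the number of positive lattice points\<close>

text \<open>\<open>s y\<close> is the radius of the section at height y of an ellipsoid with
  semi-axis b t in that direction. With u = s (m - 1/2) and v = s m one has u^2 - v^2 = (m - 1/4) /
  b^2, hence u - v \<ge> m / (4 b^2 t), and u^(n-1) - v^(n-1) \<ge> u^(n-2) (u - v). Stopping near
  half of the height keeps u \<ge> t/2, while the sum of the m is of order (b t)^2. So b cancels,
  and the bound is uniform in the side.\<close>

lemma sum_power_gap:
  fixes b t :: real and n :: nat
  assumes "2 \<le> n" "0 < b" "0 < t" "1 \<le> b * t"
  defines "M \<equiv> nat \<lceil>b * t / 2\<rceil>"
  defines "s \<equiv> \<lambda>y. sqrt (t\<^sup>2 - (y / b)\<^sup>2)"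
  shows "\<And>m. 1 \<le> m \<Longrightarrow> m \<le> M \<Longrightarrow> real m \<le> b * t"
    and "t ^ (n - 1) / (32 * 2 ^ (n - 2)) \<le> (\<Sum>m=1..M. (s (m - 1/2)) ^ (n - 1) - (s m) ^ (n - 1))"
proof -
  have M: "b * t / 2 \<le> M" "M < b * t / 2 + 1" using assms by (simp_all add: M_def) linarith+
  have le: "real m \<le> b * t" "real m - 1/2 \<le> 3/4 * (b * t)" if "1 \<le> m" "m \<le> M" for m
  proof -
    have m: "real m \<le> M" "1 \<le> real m" using that by auto
    have "2 \<le> b * t \<or> M = 1 \<and> b * t < 2"
    proof (cases "2 \<le> b * t")
      case False
      then have "real M < 2" using M by linarith
      then show ?thesis using False that by linarith
    qed simp
    then have "real m \<le> b * t \<and> real m - 1/2 \<le> 3/4 * (b * t)"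
      using M m assms(4) by (elim disjE conjE) linarith+
    then show "real m \<le> b * t" "real m - 1/2 \<le> 3/4 * (b * t)" by auto
  qed
  then show "\<And>m. 1 \<le> m \<Longrightarrow> m \<le> M \<Longrightarrow> real m \<le> b * t" by blast
  have term_ge: "(t / 2) ^ (n - 2) * (m / (4 * b\<^sup>2 * t)) \<le> (s (m - 1/2)) ^ (n - 1) - (s m) ^ (n - 1)"
    if m: "1 \<le> m" "m \<le> M" for m :: nat
  proof -
    define u v where "u = s (m - 1/2)" and "v = s m"
    have m1: "1 \<le> real m" using m by simp
    have q1: "(real m / b)\<^sup>2 \<le> t\<^sup>2"
      using le(1)[OF m] assms by (intro power_mono) (auto simp: field_simps)
    have *: "((real m - 1/2) / b)\<^sup>2 \<le> (3/4 * t)\<^sup>2"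
      using le(2)[OF m] assms m1 by (intro power_mono) (auto simp: field_simps)
    have q2: "(t / 2)\<^sup>2 \<le> t\<^sup>2 - ((real m - 1/2) / b)\<^sup>2"
    proof -
      have "(3/4 * t)\<^sup>2 = 9/16 * t\<^sup>2" "(t / 2)\<^sup>2 = t\<^sup>2 / 4" by (simp_all add: power2_eq_square)
      with * show ?thesis using zero_le_power2[of t] by linarith
    qed
    have u2: "u\<^sup>2 = t\<^sup>2 - ((real m - 1/2) / b)\<^sup>2" and v2: "v\<^sup>2 = t\<^sup>2 - (real m / b)\<^sup>2"
      using q1 order_trans[OF zero_le_power2 q2] by (simp_all add: u_def v_def s_def)
    have nn: "0 \<le> u" "0 \<le> v" using q1 order_trans[OF zero_le_power2 q2] by (simp_all add: u_def v_def s_def)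
    have "(t / 2)\<^sup>2 \<le> u\<^sup>2" using q2 u2 by linarith
    then have ut: "t / 2 \<le> u" using nn(1) by (rule power2_le_imp_le)
    have "u\<^sup>2 \<le> t\<^sup>2" "v\<^sup>2 \<le> t\<^sup>2" using u2 v2 by (metis diff_le_eq le_add_same_cancel1 zero_le_power2)+
    then have ut': "u \<le> t" "v \<le> t" using assms(3) by (meson less_imp_le power2_le_imp_le)+
    have "real m / (2 * b\<^sup>2) \<le> (real m - 1/4) / b\<^sup>2" using m1 assms(2) by (simp add: field_simps)
    also have "\<dots> = u\<^sup>2 - v\<^sup>2"
    proof -
      have "real m - 1/4 = (real m)\<^sup>2 - (real m - 1/2)\<^sup>2" by (simp add: power2_eq_square algebra_simps)
      then show ?thesis unfolding u2 v2 power_divide by (simp add: diff_divide_distrib)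
    qed
    also have "u\<^sup>2 - v\<^sup>2 = (u - v) * (u + v)" by (simp add: power2_eq_square algebra_simps)
    finally have d: "real m / (2 * b\<^sup>2) \<le> (u - v) * (u + v)" .
    moreover have "0 < real m / (2 * b\<^sup>2)" using m1 assms(2) by simp
    ultimately have "0 < (u - v) * (u + v)" by linarith
    then have uv: "v \<le> u" using nn by (simp add: zero_less_mult_iff)
    have "(u - v) * (u + v) \<le> (u - v) * (2 * t)" using uv ut' by (intro mult_left_mono) auto
    from order_trans[OF d this] have "real m / (2 * b\<^sup>2) / (2 * t) \<le> u - v"
      using assms(3) by (subst pos_divide_le_eq) auto
    then have d': "real m / (4 * b\<^sup>2 * t) \<le> u - v" by (simp add: mult_ac)
    have n: "n - 1 = Suc (n - 2)" using assms(1) by simp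
    have "v ^ (n - 2) * v \<le> u ^ (n - 2) * v"
      using uv nn by (intro mult_right_mono power_mono)
    then have "u ^ (n - 1) - v ^ (n - 1) \<ge> u ^ (n - 2) * (u - v)"
      unfolding n power_Suc2 right_diff_distrib by linarith
    moreover have "(t / 2) ^ (n - 2) * (real m / (4 * b\<^sup>2 * t)) \<le> u ^ (n - 2) * (u - v)"
      using ut d' nn assms(2,3) m1 by (intro mult_mono power_mono) auto
    ultimately show ?thesis unfolding u_def v_def by linarith
  qed
  have sumM: "(\<Sum>m=1..M. real m) = real M * (real M + 1) / 2"
    by (induction M) (simp_all add: algebra_simps)
  \<comment> \<open>The constant 32: the sum of the m is at least (b t / 2)^2 / 2 = b^2 t^2 / 8, and
    each m carries the weight 1 / (4 b^2 t).\<close>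
  have "t ^ (n - 1) / (32 * 2 ^ (n - 2)) = (t / 2) ^ (n - 2) * (((b * t / 2) * (b * t / 2) / 2) / (4 * b\<^sup>2 * t))"
  proof -
    have n: "n - 1 = Suc (n - 2)" using assms(1) by simp
    show ?thesis unfolding n using assms(2,3) by (simp add: power_divide power2_eq_square field_simps)
  qed
  also have "\<dots> \<le> (t / 2) ^ (n - 2) * ((real M * (real M + 1) / 2) / (4 * b\<^sup>2 * t))"
    using M assms(2,3) by (intro mult_left_mono divide_right_mono mult_mono) auto
  also have "\<dots> = (\<Sum>m=1..M. (t / 2) ^ (n - 2) * (m / (4 * b\<^sup>2 * t)))"
    unfolding sumM[symmetric] by (simp add: sum_distrib_left sum_divide_distrib)
  also have "\<dots> \<le> (\<Sum>m=1..M. (s (m - 1/2)) ^ (n - 1) - (s m) ^ (n - 1))"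
    by (rule sum_mono) (use term_ge in auto)
  finally show "t ^ (n - 1) / (32 * 2 ^ (n - 2)) \<le> (\<Sum>m=1..M. (s (m - 1/2)) ^ (n - 1) - (s m) ^ (n - 1))" .
qed

context positive_cuboid begin

definition orthant_ellipsoid :: "real \<Rightarrow> (real ^ 'n) set" where
  "orthant_ellipsoid t = {x. (\<forall>j. 0 \<le> x $ j) \<and> norm (scaled a x) \<le> t}"

lemma measure_orthant_ellipsoid:
  assumes "0 < t"
  shows "orthant_ellipsoid t \<in> lmeasurable"
    and "measure lebesgue (orthant_ellipsoid t) =
      measure lebesgue (orthant_ball :: (real ^ 'n) set) * t ^ CARD('n) * (\<Prod>i\<in>UNIV. a $ i)"
proof -
  define c where "c = t *\<^sub>R a"
  have c: "0 < c $ i" for i using side_pos assms by (simp add: c_def)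
  have "scaled c x = (1 / t) *\<^sub>R scaled a x" for x by (simp add: vec_eq_iff c_def)
  then have nrm: "norm (scaled c x) = norm (scaled a x) / t" for x using assms by simp
  have comp: "0 \<le> x $ j / c $ j \<longleftrightarrow> 0 \<le> x $ j" for x :: "real ^ 'n" and j
    using c[of j] by (simp add: zero_le_divide_iff)
  have eq: "orthant_ellipsoid t = {x. scaled c x \<in> orthant_ball}"
    using assms by (auto simp: orthant_ellipsoid_def orthant_ball_def nrm comp)
  show "orthant_ellipsoid t \<in> lmeasurable"
    unfolding eq by (rule measure_stretch_preimage[OF lmeasurable_slabs(3) c])
  show "measure lebesgue (orthant_ellipsoid t) =
      measure lebesgue (orthant_ball :: (real ^ 'n) set) * t ^ CARD('n) * (\<Prod>i\<in>UNIV. a $ i)"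
    unfolding eq measure_stretch_preimage(2)[OF lmeasurable_slabs(3) c]
    by (simp add: c_def prod.distrib)
qed

text \<open>The height 1/2 is the distance between the levels m - 1 and m - 1/2; with these
  cylinders the volume lost per level is a difference of two volumes over sections of different
  radius.\<close>

definition orthant_cylinder :: "'n \<Rightarrow> real \<Rightarrow> real \<Rightarrow> (real ^ 'n) set" where
  "orthant_cylinder i l t = {x. l \<le> x $ i \<and> x $ i < l + 1/2 \<and> (\<forall>j. j \<noteq> i \<longrightarrow> 0 \<le> x $ j) \<and>
     norm (scaled a (drop_coordinate i x)) \<le> t}"

lemma measure_orthant_cylinder:
  assumes "0 \<le> t" "2 \<le> CARD('n)"
  shows "orthant_cylinder i l t \<in> lmeasurable"
    and "measure lebesgue (orthant_cylinder i l t) =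
      measure lebesgue (orthant_slab i) / 2 * (\<Prod>j\<in>UNIV - {i}. a $ j) * t ^ (CARD('n) - 1)"
proof -
  have "orthant_cylinder i l t \<in> lmeasurable \<and> measure lebesgue (orthant_cylinder i l t) =
      measure lebesgue (orthant_slab i) / 2 * (\<Prod>j\<in>UNIV - {i}. a $ j) * t ^ (CARD('n) - 1)"
  \<comment> \<open>Radius zero does occur, for a section taken exactly at the tip of an ellipsoid,
    and there the scaling argument degenerates. The cylinder then lies in a hyperplane x_j = 0 with
    j \<noteq> i.\<close>
  proof (cases "t = 0")
    case True
    obtain j where j: "j \<noteq> i"
    proof -
      have "card (UNIV - {i}) \<noteq> 0" using assms(2) by (simp add: card_Diff_singleton)
      then have "UNIV - {i} \<noteq> {}" by (metis card.empty)
      then show ?thesis using that by blast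
    qed
    have "x $ j = 0" if "x \<in> orthant_cylinder i l t" for x
      using that component_le_norm_scaled[of "drop_coordinate i x" j] j True
      by (auto simp: orthant_cylinder_def)
    then have "negligible (orthant_cylinder i l t)"
      by (intro negligible_subset[OF negligible_standard_hyperplane_cart[of j]]) auto
    then show ?thesis using True assms(2) by (simp add: negligible_iff_measure)
  next
    case False
    then have t: "0 < t" using assms(1) by simp
    define c where "c = (\<chi> j. if j = i then 1/2 else a $ j * t)"
    have c: "0 < c $ j" for j using side_pos t by (simp add: c_def)
    let ?S = "{x. scaled c x \<in> orthant_slab i}"
    have nrm: "norm (drop_coordinate i (scaled c x)) = norm (scaled a (drop_coordinate i x)) / t" for x
    proof -
      have "drop_coordinate i (scaled c x) = (1 / t) *\<^sub>R scaled a (drop_coordinate i x)"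
        by (simp add: vec_eq_iff c_def)
      then show ?thesis using t by simp
    qed
    have comp: "0 \<le> x $ j / c $ j \<longleftrightarrow> 0 \<le> x $ j" for x :: "real ^ 'n" and j
      using c[of j] by (simp add: zero_le_divide_iff)
    have ci: "c $ i = 1/2" by (simp add: c_def)
    have S: "?S = {x. 0 \<le> x $ i \<and> x $ i < 1/2 \<and> (\<forall>j. j \<noteq> i \<longrightarrow> 0 \<le> x $ j) \<and> norm (scaled a (drop_coordinate i x)) \<le> t}"
      unfolding orthant_slab_def using t by (auto simp: nrm comp ci)
    define d where "d = l *\<^sub>R (axis i 1 :: real ^ 'n)"
    have dd: "drop_coordinate i (x - d) = drop_coordinate i x" for x
      by (simp add: vec_eq_iff d_def axis_def)
    have di: "(x - d) $ j = (if j = i then x $ i - l else x $ j)" for x j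
      by (simp add: d_def axis_def)
    have mem: "x \<in> orthant_cylinder i l t \<longleftrightarrow> x - d \<in> ?S" for x
      unfolding S orthant_cylinder_def mem_Collect_eq dd di by auto
    have "orthant_cylinder i l t = (+) d ` ?S"
    proof (intro subset_antisym subsetI)
      fix x assume "x \<in> orthant_cylinder i l t"
      then have "x - d \<in> ?S" using mem by blast
      then show "x \<in> (+) d ` ?S" by (rule rev_image_eqI) simp
    next
      fix x assume "x \<in> (+) d ` ?S"
      then have "x - d \<in> ?S" by auto
      then show "x \<in> orthant_cylinder i l t" using mem by blast
    qed
    moreover have "(\<Prod>j\<in>UNIV. c $ j) = 1/2 * (\<Prod>j\<in>UNIV - {i}. a $ j) * t ^ (CARD('n) - 1)"
      unfolding c_def using prod_if_coordinate[of i "1/2" a t] by simp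
    ultimately show ?thesis
      using measure_stretch_preimage[OF lmeasurable_slabs(1) c, of i]
      by (simp add: measurable_translation measure_translation)
  qed
  then show "orthant_cylinder i l t \<in> lmeasurable"
    "measure lebesgue (orthant_cylinder i l t) =
      measure lebesgue (orthant_slab i) / 2 * (\<Prod>j\<in>UNIV - {i}. a $ j) * t ^ (CARD('n) - 1)" by auto
qed

text \<open>The cubes with upper corner at a counted point fill the positive part of the ellipsoid, except
  at least for the regions between the hyperplanes \<open>x\<^sub>i = m - 1\<close> and \<open>x\<^sub>i = m - 1/2\<close> where the
  cross-section of the ellipsoid at \<open>m\<close> has already shrunk. Their total volume is of order
  \<open>t\<^sup>n\<^sup>-\<^sup>1 / a\<^sub>i\<close>, uniformly in the side-lengths.\<close>

lemma pos_count_upper_bound: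
  assumes "2 \<le> CARD('n)" "0 \<le> t" "pos_count a t \<noteq> 0"
  shows "pos_count a t \<le> measure lebesgue (orthant_ball :: (real ^ 'n) set) * t ^ CARD('n) * (\<Prod>j\<in>UNIV. a $ j)
    - measure lebesgue (orthant_slab i) * (\<Prod>j\<in>UNIV - {i}. a $ j) * t ^ (CARD('n) - 1) / (64 * 2 ^ (CARD('n) - 2))"
proof -
  let ?n = "CARD('n)"
  have "full_points a t \<inter> positive_points \<noteq> {}" using assms(3) by (auto simp: pos_count_def)
  then obtain z0 where z0: "z0 \<in> full_points a t" "z0 \<in> positive_points" by blast
  have "0 < z0 $ i" using z0 by (simp add: positive_points_def)
  \<comment> \<open>A single counted point already forces a_i t \<ge> 1, which is the range of the
    gap estimate.\<close>
  then have "1 \<le> real_of_int (z0 $ i)" by linarith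
  also have "\<dots> \<le> a $ i * norm (scaled a (real_vec z0))"
    using component_le_norm_scaled[of "real_vec z0" i] by simp
  also have "\<dots> \<le> a $ i * t"
    using z0 side_pos[of i] by (simp add: full_points_def)
  finally have r: "1 \<le> a $ i * t" .
  then have t: "0 < t" using assms(2) by (cases "t = 0") auto
  define M where "M = nat \<lceil>a $ i * t / 2\<rceil>"
  define s where "s y = sqrt (t\<^sup>2 - (y / a $ i)\<^sup>2)" for y
  have gap1: "real m \<le> a $ i * t" if "1 \<le> m" "m \<le> M" for m
    using sum_power_gap(1)[OF assms(1) side_pos t r] that by (simp add: M_def)
  have gap2: "t ^ (?n - 1) / (32 * 2 ^ (?n - 2)) \<le> (\<Sum>m=1..M. (s (m - 1/2)) ^ (?n - 1) - (s m) ^ (?n - 1))"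
    using sum_power_gap(2)[OF assms(1) side_pos t r] by (simp add: M_def s_def[abs_def])
  have s2: "(s y)\<^sup>2 = t\<^sup>2 - (y / a $ i)\<^sup>2" "0 \<le> s y" if "0 \<le> y" "y \<le> a $ i * t" for y
  proof -
    have "(y / a $ i)\<^sup>2 \<le> t\<^sup>2"
      using that side_pos[of i] by (intro power_mono) (auto simp: field_simps)
    then show "(s y)\<^sup>2 = t\<^sup>2 - (y / a $ i)\<^sup>2" "0 \<le> s y" by (auto simp: s_def)
  qed
  define A where "A m = orthant_cylinder i (real m - 1) (s (real m - 1/2)) - orthant_cylinder i (real m - 1) (s (real m))" for m
  have m12: "1 \<le> real m" "real m \<le> a $ i * t" "0 \<le> s (real m)" "0 \<le> s (real m - 1/2)" if "m \<in> {1..M}" for m :: nat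
    using that gap1[of m] s2(2)[of "real m"] s2(2)[of "real m - 1/2"] by auto
  have mA: "A m \<in> lmeasurable" if "m \<in> {1..M}" for m
    unfolding A_def using m12[OF that]
    by (intro fmeasurable.Diff measure_orthant_cylinder(1) assms) auto
  have meas_A: "measure lebesgue (orthant_slab i) / 2 * (\<Prod>j\<in>UNIV - {i}. a $ j) * (s (real m - 1/2) ^ (?n - 1) - s m ^ (?n - 1)) \<le> measure lebesgue (A m)"
    if "m \<in> {1..M}" for m
  proof -
    note m = m12[OF that]
    have "measure lebesgue (orthant_cylinder i (real m - 1) (s (real m - 1/2))) - measure lebesgue (orthant_cylinder i (real m - 1) (s (real m))) \<le> measure lebesgue (A m)"
      unfolding A_def using m
      by (intro measure_diff_le_measure_setdiff measure_orthant_cylinder(1) assms) auto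
    then show ?thesis
      using m by (simp add: measure_orthant_cylinder(2)[OF _ assms(1)] algebra_simps)
  qed
  have mem_cyl: "x \<in> A m \<longleftrightarrow> real m - 1 \<le> x $ i \<and> x $ i < real m - 1/2 \<and> (\<forall>j. j \<noteq> i \<longrightarrow> 0 \<le> x $ j) \<and>
     s m < norm (scaled a (drop_coordinate i x)) \<and> norm (scaled a (drop_coordinate i x)) \<le> s (real m - 1/2)" for x m
    by (auto simp: A_def orthant_cylinder_def)
  let ?U = "\<Union>m\<in>{1..M}. A m"
  have mU: "?U \<in> lmeasurable" by (intro fmeasurable.finite_UN mA) auto
  have disj: "pairwise (\<lambda>m m'. AE x in lebesgue. x \<notin> A m \<or> x \<notin> A m') {1..M}"
  proof (intro pairwiseI AE_I2)
    fix m m' :: nat and x assume "m \<noteq> m'"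
    then have "real m + 1 \<le> real m' \<or> real m' + 1 \<le> real m" by linarith
    then show "x \<notin> A m \<or> x \<notin> A m'" unfolding mem_cyl by linarith
  qed
  define K where "K = measure lebesgue (orthant_slab i) / 2 * (\<Prod>j\<in>UNIV - {i}. a $ j)"
  have K: "0 \<le> K" unfolding K_def using side_pos by (intro mult_nonneg_nonneg prod_nonneg) (auto intro: less_imp_le)
  have "K * (t ^ (?n - 1) / (32 * 2 ^ (?n - 2))) \<le> K * (\<Sum>m=1..M. s (real m - 1/2) ^ (?n - 1) - s m ^ (?n - 1))"
    using gap2 K by (rule mult_left_mono)
  also have "\<dots> = (\<Sum>m=1..M. K * (s (real m - 1/2) ^ (?n - 1) - s m ^ (?n - 1)))"
    by (rule sum_distrib_left)
  also have "\<dots> \<le> (\<Sum>m=1..M. measure lebesgue (A m))"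
    unfolding K_def by (rule sum_mono) (rule meas_A)
  also have "\<dots> = measure lebesgue ?U"
    by (rule measure_UNION_AE[symmetric]) (use mA disj in auto)
  finally have U: "K * (t ^ (?n - 1) / (32 * 2 ^ (?n - 2))) \<le> measure lebesgue ?U" .
  have sub: "?U \<subseteq> orthant_ellipsoid t"
  proof
    fix x assume "x \<in> ?U"
    then obtain m where m: "m \<in> {1..M}" "x \<in> A m" by blast
    note m' = m12[OF m(1)]
    have x: "real m - 1 \<le> x $ i" "x $ i < real m - 1/2" "\<forall>j. j \<noteq> i \<longrightarrow> 0 \<le> x $ j"
      "norm (scaled a (drop_coordinate i x)) \<le> s (real m - 1/2)" using m(2) by (auto simp: mem_cyl)
    have "(x $ i / a $ i)\<^sup>2 \<le> ((real m - 1/2) / a $ i)\<^sup>2"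
      using x m' side_pos[of i] by (intro power_mono divide_right_mono) auto
    moreover have "(norm (scaled a (drop_coordinate i x)))\<^sup>2 \<le> (s (real m - 1/2))\<^sup>2"
      using x by (intro power_mono) auto
    ultimately have "(norm (scaled a x))\<^sup>2 \<le> t\<^sup>2"
      unfolding norm_scaled_split[of a x i] using s2(1)[of "real m - 1/2"] m' by linarith
    then have "norm (scaled a x) \<le> t" using assms(2) by (rule power2_le_imp_le)
    moreover have "0 \<le> x $ j" for j using x m' by (cases "j = i") auto
    ultimately show "x \<in> orthant_ellipsoid t" by (simp add: orthant_ellipsoid_def)
  qed
  have "card (full_points a t \<inter> positive_points) \<le> measure lebesgue (orthant_ellipsoid t - ?U)"
  proof (rule card_le_measure[where c = 1])
    show "finite (full_points a t \<inter> positive_points)" using finite_full_points by simp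
    show "orthant_ellipsoid t - ?U \<in> lmeasurable"
      using measure_orthant_ellipsoid(1)[OF t] mU by (intro fmeasurable.Diff)
    fix z assume z: "z \<in> full_points a t \<inter> positive_points"
    have zp: "1 \<le> real_of_int (z $ j)" for j
    proof -
      have "0 < z $ j" using z by (simp add: positive_points_def)
      then show ?thesis by linarith
    qed
    show "unit_cell 1 z \<subseteq> orthant_ellipsoid t - ?U"
    proof
      fix x assume "x \<in> unit_cell 1 z"
      then have x: "z $ j - 1 \<le> x $ j" "x $ j < z $ j" for j by (auto simp: unit_cell_iff)
      have x0: "0 \<le> x $ j" for j using x(1)[of j] zp[of j] by linarith
      have mono: "(x $ j)\<^sup>2 / (a $ j)\<^sup>2 \<le> (real_vec z $ j)\<^sup>2 / (a $ j)\<^sup>2" for j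
        using x[of j] x0[of j] by (intro divide_right_mono power_mono) auto
      have "(norm (scaled a x))\<^sup>2 \<le> (norm (scaled a (real_vec z)))\<^sup>2"
        unfolding norm_scaled_power2 by (intro sum_mono mono)
      then have "norm (scaled a x) \<le> norm (scaled a (real_vec z))" by (rule power2_le_imp_le) simp
      also have "\<dots> \<le> t" using z by (simp add: full_points_def)
      finally have "x \<in> orthant_ellipsoid t" using x0 by (simp add: orthant_ellipsoid_def)
      moreover have "x \<notin> A m" if "m \<in> {1..M}" for m
      proof
        assume "x \<in> A m"
        then have xm: "real m - 1 \<le> x $ i" "x $ i < real m - 1/2" "norm (scaled a (drop_coordinate i x)) > s m"
          by (auto simp: mem_cyl)
        note m' = m12[OF that]
        \<comment> \<open>Since z is the upper corner of its cell, a height of x in [m - 1, m - 1/2)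
          fixes z_i = m. The other coordinates of z dominate those of x, so z would lie beyond the
          section at height m and hence outside the ellipsoid.\<close>
        have "real_of_int (z $ i) < real_of_int (int m) + 1" "real_of_int (int m) < real_of_int (z $ i) + 1"
          using x[of i] xm by auto
        then have zi: "z $ i = int m" by linarith
        have "(norm (scaled a (drop_coordinate i x)))\<^sup>2 \<le> (norm (scaled a (drop_coordinate i (real_vec z))))\<^sup>2"
          unfolding norm_scaled_power2 using mono by (intro sum_mono) auto
        moreover have "(s m)\<^sup>2 < (norm (scaled a (drop_coordinate i x)))\<^sup>2"
          using xm m' by (intro power_strict_mono) auto
        ultimately have "t\<^sup>2 < (norm (scaled a (real_vec z)))\<^sup>2"
          using norm_scaled_split[of a "real_vec z" i] s2(1)[of "real m"] m' zi by (simp only: real_vec_nth of_int_of_nat_eq)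
        then have "t < norm (scaled a (real_vec z))" by (rule power2_less_imp_less[OF _ norm_ge_zero])
        then show False using z by (simp add: full_points_def)
      qed
      ultimately show "x \<in> orthant_ellipsoid t - ?U" by blast
    qed
  qed
  also have "\<dots> = measure lebesgue (orthant_ellipsoid t) - measure lebesgue ?U"
    by (rule measurable_measure_Diff) (use measure_orthant_ellipsoid(1)[OF t] mU sub in \<open>auto intro: fmeasurableD\<close>)
  also have "\<dots> \<le> measure lebesgue (orthant_ball :: (real ^ 'n) set) * t ^ ?n * (\<Prod>j\<in>UNIV. a $ j) - K * (t ^ (?n - 1) / (32 * 2 ^ (?n - 2)))"
    using U measure_orthant_ellipsoid(2)[OF t] by simp
  finally show ?thesis by (simp add: pos_count_def K_def)
qed

text \<open>The point with coordinates \<open>\<lfloor>x $ i + 1\<rfloor>\<close> lies strictly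
  above x, so it is positive even where x_i = 0, and its scaled norm exceeds that of x by at most
  \<open>cell_diam\<close>. Cells with their upper corner at a counted point thus cover the positive
  part of the smaller ellipsoid.\<close>

lemma pos_count_lower_bound:
  assumes "cell_diam < t"
  shows "measure lebesgue (orthant_ball :: (real ^ 'n) set) * (t - cell_diam) ^ CARD('n) * (\<Prod>j\<in>UNIV. a $ j) \<le> pos_count a t"
proof -
  have t: "0 < t - cell_diam" using assms by simp
  have "measure lebesgue (orthant_ellipsoid (t - cell_diam)) \<le> card (full_points a t \<inter> positive_points)"
  proof (rule measure_le_card[where c = 1])
    show "finite (full_points a t \<inter> positive_points)" using finite_full_points by simp
    show "orthant_ellipsoid (t - cell_diam) \<in> lmeasurable" by (rule measure_orthant_ellipsoid(1)[OF t])
    fix x :: "real ^ 'n" assume x: "x \<in> orthant_ellipsoid (t - cell_diam)"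
    define z where "z = (\<chi> i. \<lfloor>x $ i + 1\<rfloor>)"
    have "scaled a (real_vec z) = scaled a x + scaled a (real_vec z - x)" by (simp add: scaled_diff)
    then have "norm (scaled a (real_vec z)) \<le> norm (scaled a x) + norm (scaled a (real_vec z - x))"
      using norm_triangle_ineq by metis
    also have "norm (scaled a (real_vec z - x)) \<le> cell_diam"
    proof (rule norm_scaled_le_cell_diam)
      show "\<bar>(real_vec z - x) $ i\<bar> \<le> 1" for i
        using floor_correct[of "x $ i + 1"] by (simp add: z_def abs_le_iff)
    qed
    finally have "norm (scaled a (real_vec z)) \<le> t" using x by (simp add: orthant_ellipsoid_def)
    moreover have "z \<in> positive_points" using x by (simp add: positive_points_def z_def orthant_ellipsoid_def add_nonneg_pos)
    ultimately show "(\<chi> i. \<lfloor>x $ i + 1\<rfloor>) \<in> full_points a t \<inter> positive_points"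
      by (simp add: full_points_def z_def)
  qed
  then show ?thesis using measure_orthant_ellipsoid(2)[OF t] by (simp add: pos_count_def)
qed

end

lemma power_minus_linear:
  fixes t x :: real
  assumes "0 < t" "x \<le> t"
  shows "t ^ n - n * x * t ^ (n - 1) \<le> (t - x) ^ n"
proof -
  have "1 + n * (- (x / t)) \<le> (1 + (- (x / t))) ^ n"
    using assms by (intro Bernoulli_inequality) (simp add: field_simps)
  then have "t ^ n * (1 + n * (- (x / t))) \<le> t ^ n * (1 + (- (x / t))) ^ n"
    using assms by (intro mult_left_mono) auto
  also have "t ^ n * (1 + (- (x / t))) ^ n = (t - x) ^ n"
    unfolding power_mult_distrib[symmetric] using assms by (simp add: right_diff_distrib)
  also have "t ^ n * (1 + n * (- (x / t))) = t ^ n - n * x * t ^ (n - 1)"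
    using assms by (cases n) (auto simp: field_simps)
  finally show ?thesis .
qed

text \<open>The factor (1 + \<kappa>)^m is crude but depends on \<kappa> and m alone. With \<kappa>
  a multiple of \<open>cell_diam\<close> this keeps the constants uniform in t and over sides in a
  compact range.\<close>

lemma power_perturb:
  fixes t \<kappa> :: real
  assumes "1 \<le> t" "0 \<le> \<kappa>"
  shows "(t + \<kappa>) ^ m \<le> t ^ m + (1 + \<kappa>) ^ m * t ^ (m - 1)"
    and "\<kappa> \<le> t \<Longrightarrow> t ^ m - (1 + \<kappa>) ^ m * t ^ (m - 1) \<le> (t - \<kappa>) ^ m"
proof -
  have "(t + \<kappa>) ^ m \<le> t ^ m + ((1 + \<kappa>) ^ m - 1) * t ^ (m - 1)"
  proof (induction m)
    case (Suc m)
    define A where "A = (1 + \<kappa>) ^ m - 1"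
    have A: "0 \<le> A" using assms one_le_power[of "1 + \<kappa>" m] by (simp add: A_def)
    have At: "A * t ^ (m - 1) * t = A * t ^ m" "A * t ^ (m - 1) \<le> A * t ^ m"
    proof -
      show "A * t ^ (m - 1) * t = A * t ^ m" by (cases m) (auto simp: A_def)
      show "A * t ^ (m - 1) \<le> A * t ^ m" using A assms by (intro mult_left_mono power_increasing) auto
    qed
    have "(t + \<kappa>) ^ Suc m \<le> (t ^ m + A * t ^ (m - 1)) * (t + \<kappa>)"
      unfolding power_Suc2 using Suc.IH assms by (intro mult_right_mono) (auto simp: A_def)
    also have "\<dots> = t ^ Suc m + \<kappa> * t ^ m + A * t ^ (m - 1) * t + \<kappa> * (A * t ^ (m - 1))"
      by (simp add: algebra_simps)
    also have "\<dots> \<le> t ^ Suc m + \<kappa> * t ^ m + A * t ^ m + \<kappa> * (A * t ^ m)"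
      unfolding At(1) using assms by (intro add_left_mono mult_left_mono[OF At(2)])
    also have "\<dots> = t ^ Suc m + ((1 + \<kappa>) ^ Suc m - 1) * t ^ (Suc m - 1)"
      by (simp add: A_def algebra_simps)
    finally show ?case .
  qed simp
  also have "\<dots> \<le> t ^ m + (1 + \<kappa>) ^ m * t ^ (m - 1)"
    using assms by (simp add: algebra_simps)
  finally show "(t + \<kappa>) ^ m \<le> t ^ m + (1 + \<kappa>) ^ m * t ^ (m - 1)" .
  assume "\<kappa> \<le> t"
  have b: "m * \<kappa> \<le> (1 + \<kappa>) ^ m" using Bernoulli_inequality[of \<kappa> m] assms by simp
  have "t ^ m - m * \<kappa> * t ^ (m - 1) \<le> (t - \<kappa>) ^ m"
    using assms \<open>\<kappa> \<le> t\<close> by (intro power_minus_linear) auto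
  moreover have "m * \<kappa> * t ^ (m - 1) \<le> (1 + \<kappa>) ^ m * t ^ (m - 1)"
    using b assms by (intro mult_right_mono) auto
  ultimately show "t ^ m - (1 + \<kappa>) ^ m * t ^ (m - 1) \<le> (t - \<kappa>) ^ m" by linarith
qed

section \<open>Lattice points on coordinate hyperplanes\<close>

context positive_cuboid begin

definition full_cylinder :: "'n \<Rightarrow> real \<Rightarrow> (real ^ 'n) set" where
  "full_cylinder i t = {x. - (1/2) \<le> x $ i \<and> x $ i < 1/2 \<and> norm (scaled a (drop_coordinate i x)) \<le> t}"

lemma measure_full_cylinder:
  assumes t: "0 < t"
  shows "full_cylinder i t \<in> lmeasurable"
    and "measure lebesgue (full_cylinder i t) =
      measure lebesgue (full_slab i) * (\<Prod>j\<in>UNIV - {i}. a $ j) * t ^ (CARD('n) - 1)"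
proof -
  define c where "c = (\<chi> j. if j = i then 1 else a $ j * t)"
  have c: "0 < c $ j" for j using side_pos t by (simp add: c_def)
  have nrm: "norm (drop_coordinate i (scaled c x)) = norm (scaled a (drop_coordinate i x)) / t" for x
  proof -
    have "drop_coordinate i (scaled c x) = (1 / t) *\<^sub>R scaled a (drop_coordinate i x)"
      by (simp add: vec_eq_iff c_def)
    then show ?thesis using t by simp
  qed
  have ci: "c $ i = 1" by (simp add: c_def)
  have eq: "full_cylinder i t = {x. scaled c x \<in> full_slab i}"
    unfolding full_slab_def full_cylinder_def using t by (auto simp: nrm ci)
  show "full_cylinder i t \<in> lmeasurable"
    unfolding eq by (rule measure_stretch_preimage[OF lmeasurable_slabs(2) c])
  have "(\<Prod>j\<in>UNIV. c $ j) = (\<Prod>j\<in>UNIV - {i}. a $ j) * t ^ (CARD('n) - 1)"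
    unfolding c_def using prod_if_coordinate[of i 1 a t] by simp
  then show "measure lebesgue (full_cylinder i t) =
      measure lebesgue (full_slab i) * (\<Prod>j\<in>UNIV - {i}. a $ j) * t ^ (CARD('n) - 1)"
    unfolding eq measure_stretch_preimage(2)[OF lmeasurable_slabs(2) c] by simp
qed

lemma cell_shift:
  assumes "x \<in> unit_cell (1/2) z"
  shows "norm (scaled a x) \<le> norm (scaled a (real_vec z)) + cell_diam"
    "norm (scaled a (real_vec z)) \<le> norm (scaled a x) + cell_diam"
    "norm (scaled a (drop_coordinate i x)) \<le> norm (scaled a (drop_coordinate i (real_vec z))) + cell_diam"
    "norm (scaled a (drop_coordinate i (real_vec z))) \<le> norm (scaled a (drop_coordinate i x)) + cell_diam"
proof -
  have d: "\<bar>(x - real_vec z) $ j\<bar> \<le> 1" for j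
  proof -
    have "z $ j - 1/2 \<le> x $ j \<and> x $ j < z $ j - 1/2 + 1" using assms by (simp add: unit_cell_iff)
    then show ?thesis by simp linarith
  qed
  have "norm (scaled a (x - real_vec z)) \<le> cell_diam" by (rule norm_scaled_le_cell_diam[OF d])
  then show "norm (scaled a x) \<le> norm (scaled a (real_vec z)) + cell_diam"
    "norm (scaled a (real_vec z)) \<le> norm (scaled a x) + cell_diam"
    unfolding scaled_diff
    using norm_triangle_ineq2[of "scaled a x" "scaled a (real_vec z)"] norm_triangle_ineq2[of "scaled a (real_vec z)" "scaled a x"]
    by (simp_all add: norm_minus_commute)
  have "drop_coordinate i x - drop_coordinate i (real_vec z) = drop_coordinate i (x - real_vec z)"
    by (simp add: vec_eq_iff)
  moreover have "norm (scaled a (drop_coordinate i (x - real_vec z))) \<le> cell_diam"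
    using norm_scaled_drop_le[of a i "x - real_vec z"] \<open>norm (scaled a (x - real_vec z)) \<le> cell_diam\<close> by linarith
  ultimately have "norm (scaled a (drop_coordinate i x) - scaled a (drop_coordinate i (real_vec z))) \<le> cell_diam"
    unfolding scaled_diff[symmetric] by simp
  then show "norm (scaled a (drop_coordinate i x)) \<le> norm (scaled a (drop_coordinate i (real_vec z))) + cell_diam"
    "norm (scaled a (drop_coordinate i (real_vec z))) \<le> norm (scaled a (drop_coordinate i x)) + cell_diam"
    using norm_triangle_ineq2[of "scaled a (drop_coordinate i x)" "scaled a (drop_coordinate i (real_vec z))"]
      norm_triangle_ineq2[of "scaled a (drop_coordinate i (real_vec z))" "scaled a (drop_coordinate i x)"]
    by (simp_all add: norm_minus_commute)
qed

lemma drop_zero_coordinate: "z $ i = 0 \<Longrightarrow> drop_coordinate i (real_vec z) = real_vec z"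
  by (simp add: vec_eq_iff)

text \<open>The lattice inside the hyperplane is counted by n-dimensional cells: those centred at
  its points fill a slab of width one over the section of the ellipsoid, up to a change of the
  radius by \<open>cell_diam\<close>.\<close>

lemma card_zero_slice:
  assumes t: "1 \<le> t" and n: "2 \<le> CARD('n)"
  shows "\<bar>card {z \<in> full_points a t. z $ i = 0} -
      measure lebesgue (full_slab i) * (\<Prod>j\<in>UNIV - {i}. a $ j) * t ^ (CARD('n) - 1)\<bar>
    \<le> measure lebesgue (full_slab i) * (\<Prod>j\<in>UNIV - {i}. a $ j) * ((1 + cell_diam) ^ (CARD('n) - 1) * t ^ (CARD('n) - 2))"
proof -
  let ?m = "CARD('n) - 1" and ?Z = "{z \<in> full_points a t. z $ i = 0}"
  define K where "K = measure lebesgue (full_slab i) * (\<Prod>j\<in>UNIV - {i}. a $ j)"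
  have K: "0 \<le> K" unfolding K_def using side_pos by (intro mult_nonneg_nonneg prod_nonneg) (auto intro: less_imp_le)
  have fin: "finite ?Z" using finite_full_points by simp
  have m1: "?m - 1 = CARD('n) - 2" by simp
  have k0: "0 \<le> cell_diam" using cell_diam_pos by simp
  have "card ?Z \<le> measure lebesgue (full_cylinder i (t + cell_diam))"
  proof (rule card_le_measure[where c = "1/2", OF fin])
    show "full_cylinder i (t + cell_diam) \<in> lmeasurable" using t cell_diam_pos by (intro measure_full_cylinder) auto
    fix z assume z: "z \<in> ?Z"
    show "unit_cell (1/2) z \<subseteq> full_cylinder i (t + cell_diam)"
    proof
      fix x assume x: "x \<in> unit_cell (1/2) z"
      have "- (1/2) \<le> x $ i" "x $ i < 1/2" using x z unfolding unit_cell_iff by (auto dest!: spec[of _ i])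
      then show "x \<in> full_cylinder i (t + cell_diam)"
        using cell_shift(3)[OF x, of i] z unfolding full_cylinder_def full_points_def
        by (auto simp: drop_zero_coordinate)
    qed
  qed
  also have "\<dots> = K * (t + cell_diam) ^ ?m"
    unfolding K_def using t cell_diam_pos by (intro measure_full_cylinder) auto
  also have "\<dots> \<le> K * (t ^ ?m + (1 + cell_diam) ^ ?m * t ^ (CARD('n) - 2))"
    using power_perturb(1)[OF t k0, of ?m] K unfolding m1 by (rule mult_left_mono)
  finally have up: "card ?Z \<le> K * t ^ ?m + K * ((1 + cell_diam) ^ ?m * t ^ (CARD('n) - 2))"
    by (simp add: distrib_left)
  have lo: "K * t ^ ?m - K * ((1 + cell_diam) ^ ?m * t ^ (CARD('n) - 2)) \<le> card ?Z"
  proof (cases "cell_diam < t")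
    case True
    have "K * (t ^ ?m - (1 + cell_diam) ^ ?m * t ^ (CARD('n) - 2)) \<le> K * (t - cell_diam) ^ ?m"
      using power_perturb(2)[OF t k0, of ?m] True K unfolding m1 by (intro mult_left_mono) auto
    also have "\<dots> = measure lebesgue (full_cylinder i (t - cell_diam))"
      unfolding K_def using True by (intro measure_full_cylinder(2)[symmetric]) auto
    also have "\<dots> \<le> card ?Z"
    proof (rule measure_le_card[where c = "1/2", OF fin])
      show "full_cylinder i (t - cell_diam) \<in> lmeasurable" using True by (intro measure_full_cylinder) auto
      fix x :: "real ^ 'n" assume x: "x \<in> full_cylinder i (t - cell_diam)"
      define z where "z = (\<chi> i. \<lfloor>x $ i + 1/2\<rfloor>)"
      have "x \<in> unit_cell (1/2) z" by (simp add: z_def unit_cell_def)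
      moreover have zi: "z $ i = 0" using x unfolding z_def full_cylinder_def by (simp add: floor_eq_iff)
      ultimately have "norm (scaled a (real_vec z)) \<le> t"
        using cell_shift(4)[of x z i] x unfolding full_cylinder_def drop_zero_coordinate[OF zi] by simp
      then show "(\<chi> i. \<lfloor>x $ i + 1/2\<rfloor>) \<in> ?Z"
        using zi by (simp add: full_points_def z_def)
    qed
    finally show ?thesis by (simp add: right_diff_distrib)
  next
    \<comment> \<open>For t \<le> \<open>cell_diam\<close> the error term is at least as large as
      the main term, so the lower bound is nonpositive. This gives the estimate for every t \<ge> 1,
      with no threshold depending on the sides.\<close>
    case False
    have p: "?m = Suc (CARD('n) - 2)" using n by simp
    have "t \<le> (1 + cell_diam) ^ ?m"
    proof -
      have "t \<le> (1 + cell_diam) ^ 1" using False by simp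
      also have "\<dots> \<le> (1 + cell_diam) ^ ?m" using k0 n by (intro power_increasing) auto
      finally show ?thesis .
    qed
    then have "t * t ^ (CARD('n) - 2) \<le> (1 + cell_diam) ^ ?m * t ^ (CARD('n) - 2)"
      using t by (intro mult_right_mono) auto
    then have "t ^ ?m \<le> (1 + cell_diam) ^ ?m * t ^ (CARD('n) - 2)"
      using power_Suc[of t "CARD('n) - 2"] p by simp
    then have "K * t ^ ?m \<le> K * ((1 + cell_diam) ^ ?m * t ^ (CARD('n) - 2))" using K by (rule mult_left_mono)
    then show ?thesis by (smt (verit) of_nat_0_le_iff)
  qed
  show ?thesis using up lo unfolding K_def by linarith
qed

text \<open>Only the order t^(n-2) matters here, so a bounding box replaces the ellipsoid: the two
  directions with a zero coordinate contribute the width one of a cell, each other direction a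
  multiple of t.\<close>

lemma card_double_zero_slice:
  assumes t: "1 \<le> t" and "i \<noteq> k"
  shows "card {z \<in> full_points a t. z $ i = 0 \<and> z $ k = 0} \<le> (\<Prod>l\<in>UNIV. 2 * a $ l + 1) * t ^ (CARD('n) - 2)"
proof -
  let ?Z = "{z \<in> full_points a t. z $ i = 0 \<and> z $ k = 0}"
  define B where "B = (\<chi> l. if l \<in> {i, k} then 1/2 else a $ l * t + 1/2)"
  have B0: "0 \<le> B $ l" for l using side_pos[of l] t by (simp add: B_def)
  have "card ?Z \<le> measure lebesgue (cbox (- B) B)"
  proof (rule card_le_measure[where c = "1/2"])
    show "finite ?Z" using finite_full_points by simp
    fix z assume z: "z \<in> ?Z"
    show "unit_cell (1/2) z \<subseteq> cbox (- B) B"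
    proof
      fix x assume x: "x \<in> unit_cell (1/2) z"
      have "\<bar>x $ l\<bar> \<le> B $ l" for l
      proof -
        have d: "\<bar>x $ l - z $ l\<bar> \<le> 1/2" using x unfolding unit_cell_iff by (smt (verit) field_sum_of_halves)
        have "\<bar>real_of_int (z $ l)\<bar> \<le> a $ l * norm (scaled a (real_vec z))"
          using component_le_norm_scaled[of "real_vec z" l] by simp
        also have "\<dots> \<le> a $ l * t" using z side_pos[of l] by (simp add: full_points_def)
        finally have "\<bar>real_of_int (z $ l)\<bar> \<le> a $ l * t" .
        moreover have "\<bar>x $ l\<bar> \<le> \<bar>real_of_int (z $ l)\<bar> + 1/2" using d by linarith
        moreover have "l \<in> {i, k} \<Longrightarrow> z $ l = 0" using z by auto
        ultimately show ?thesis by (cases "l \<in> {i, k}") (simp_all add: B_def)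
      qed
      then show "x \<in> cbox (- B) B" by (simp add: mem_box_cart abs_le_iff minus_le_iff)
    qed
  qed simp
  also have "\<dots> = (\<Prod>l\<in>UNIV. 2 * B $ l)"
  proof -
    have "0 \<in> cbox (- B) B" using B0 by (simp add: mem_box_cart)
    then have "cbox (- B) B \<noteq> {}" by blast
    then show ?thesis by (simp add: content_cbox_cart)
  qed
  also have "\<dots> \<le> (\<Prod>l\<in>UNIV. (2 * a $ l + 1) * (if l \<in> {i, k} then 1 else t))"
  proof (rule prod_mono)
    fix l
    have "1 \<le> 2 * a $ l + 1" "2 * (a $ l * t) + 1 \<le> (2 * a $ l + 1) * t"
      using side_pos[of l] t by (simp_all add: distrib_right)
    then show "0 \<le> 2 * B $ l \<and> 2 * B $ l \<le> (2 * a $ l + 1) * (if l \<in> {i, k} then 1 else t)"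
      using B0[of l] by (simp add: B_def)
  qed
  also have "\<dots> = (\<Prod>l\<in>UNIV. 2 * a $ l + 1) * t ^ (CARD('n) - 2)"
  proof -
    have "(\<Prod>l\<in>UNIV. if l \<in> {i, k} then 1 else t) = (\<Prod>l\<in>UNIV - {i, k}. t)"
      by (rule prod.mono_neutral_cong_right) auto
    also have "\<dots> = t ^ (CARD('n) - 2)" using assms(2) by (simp add: card_Diff_subset numeral_2_eq_2)
    finally show ?thesis by (simp add: prod.distrib)
  qed
  finally show ?thesis .
qed

text \<open>The sign changes act freely on the points off the coordinate hyperplanes and preserve
  the ellipsoid; the positive points are a fundamental domain. In a pair (z, S) the set S records
  which signs are flipped.\<close>

lemma card_nonzero_points: "card {z \<in> full_points a t. \<forall>i. z $ i \<noteq> 0} = 2 ^ CARD('n) * pos_count a t"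
proof -
  define f where "f = (\<lambda>(z :: int ^ 'n, S). \<chi> i. if i \<in> S then - (z $ i) else z $ i)"
  have nrm: "norm (scaled a (real_vec z)) = norm (scaled a (real_vec w))" if "\<And>i. \<bar>z $ i\<bar> = \<bar>w $ i\<bar>" for z w
  proof -
    have "(real_vec z $ i)\<^sup>2 = (real_vec w $ i)\<^sup>2" for i
    proof -
      have "(real_of_int \<bar>z $ i\<bar>)\<^sup>2 = (real_of_int \<bar>w $ i\<bar>)\<^sup>2" using that by simp
      then show ?thesis by simp
    qed
    then have "(norm (scaled a (real_vec z)))\<^sup>2 = (norm (scaled a (real_vec w)))\<^sup>2"
      unfolding norm_scaled_power2 by simp
    then show ?thesis by simp
  qed
  have "bij_betw f ((full_points a t \<inter> positive_points) \<times> UNIV) {z \<in> full_points a t. \<forall>i. z $ i \<noteq> 0}"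
  proof (rule bij_betw_byWitness[where f' = "\<lambda>w. (\<chi> i. \<bar>w $ i\<bar>, {i. w $ i < 0})"])
    show "\<forall>p\<in>(full_points a t \<inter> positive_points) \<times> UNIV. (\<chi> i. \<bar>f p $ i\<bar>, {i. f p $ i < 0}) = p"
    proof
      fix p :: "(int ^ 'n) \<times> 'n set" assume p: "p \<in> (full_points a t \<inter> positive_points) \<times> UNIV"
      obtain z S where zS: "p = (z, S)" by force
      have z0: "0 < z $ i" for i using p zS by (auto simp: positive_points_def)
      have "\<not> z $ i < 0" for i using z0[of i] by linarith
      with z0 show "(\<chi> i. \<bar>f p $ i\<bar>, {i. f p $ i < 0}) = p"
        by (auto simp: zS f_def vec_eq_iff abs_of_pos)
    qed
    show "\<forall>w\<in>{z \<in> full_points a t. \<forall>i. z $ i \<noteq> 0}. f (\<chi> i. \<bar>w $ i\<bar>, {i. w $ i < 0}) = w"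
      by (auto simp: f_def vec_eq_iff)
    show "f ` ((full_points a t \<inter> positive_points) \<times> UNIV) \<subseteq> {z \<in> full_points a t. \<forall>i. z $ i \<noteq> 0}"
    proof
      fix w assume "w \<in> f ` ((full_points a t \<inter> positive_points) \<times> UNIV)"
      then obtain z S where z: "z \<in> full_points a t" "z \<in> positive_points" "w = f (z, S)" by auto
      have "\<bar>w $ i\<bar> = \<bar>z $ i\<bar>" for i by (simp add: z f_def)
      moreover have "0 < z $ i" for i using z by (simp add: positive_points_def)
      ultimately show "w \<in> {z \<in> full_points a t. \<forall>i. z $ i \<noteq> 0}"
        using nrm[of w z] z(1) by (simp add: full_points_def) (metis abs_eq_0_iff less_irrefl abs_zero)
    qed
    show "(\<lambda>w. (\<chi> i. \<bar>w $ i\<bar>, {i. w $ i < 0})) ` {z \<in> full_points a t. \<forall>i. z $ i \<noteq> 0}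
        \<subseteq> (full_points a t \<inter> positive_points) \<times> UNIV"
    proof
      fix p assume "p \<in> (\<lambda>w. (\<chi> i. \<bar>w $ i\<bar>, {i. w $ i < 0})) ` {z \<in> full_points a t. \<forall>i. z $ i \<noteq> 0}"
      then obtain w where w: "w \<in> full_points a t" "\<forall>i. w $ i \<noteq> 0" "p = (\<chi> i. \<bar>w $ i\<bar>, {i. w $ i < 0})" by blast
      have "norm (scaled a (real_vec (\<chi> i. \<bar>w $ i\<bar>))) = norm (scaled a (real_vec w))" by (rule nrm) simp
      then show "p \<in> (full_points a t \<inter> positive_points) \<times> UNIV"
        using w by (simp add: full_points_def positive_points_def)
    qed
  qed
  then have "card {z \<in> full_points a t. \<forall>i. z $ i \<noteq> 0} = card ((full_points a t \<inter> positive_points) \<times> (UNIV :: 'n set set))"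
    by (rule bij_betw_same_card[symmetric])
  also have "\<dots> = 2 ^ CARD('n) * pos_count a t"
    by (simp add: card_cartesian_product pos_count_def card_UNIV_set[where 'a='n] mult.commute)
  finally show ?thesis .
qed

text \<open>Inclusion and exclusion, stopped after the first step. A point with m zero coordinates
  contributes [m = 0] - 1 + m to the left side, which vanishes for m \<le> 1 and is otherwise at
  most m (m - 1), the number of ordered pairs of distinct zero coordinates.\<close>

lemma pos_count_via_slices:
  "\<bar>2 ^ CARD('n) * real (pos_count a t) - card (full_points a t) + (\<Sum>i\<in>UNIV. real (card {z \<in> full_points a t. z $ i = 0}))\<bar>
    \<le> (\<Sum>i\<in>UNIV. \<Sum>k\<in>UNIV - {i}. real (card {z \<in> full_points a t. z $ i = 0 \<and> z $ k = 0}))"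
proof -
  let ?F = "full_points a t"
  have fin: "finite ?F" by (rule finite_full_points)
  have c: "real (card {z \<in> ?F. P z}) = (\<Sum>z\<in>?F. of_bool (P z))" for P
    using fin by (subst sum_of_bool_eq) (simp_all add: Int_def)
  define m where "m z = card {i. z $ i = 0}" for z :: "int ^ 'n"
  have bm: "(\<Sum>i\<in>UNIV. of_bool (z $ i = 0)) = real (m z)" for z
    unfolding m_def by (subst sum_of_bool_eq) simp_all
  have s1: "(\<Sum>i\<in>UNIV. real (card {z \<in> ?F. z $ i = 0})) = (\<Sum>z\<in>?F. real (m z))"
    unfolding c bm[symmetric] by (rule sum.swap)
  have s2: "(\<Sum>i\<in>UNIV. \<Sum>k\<in>UNIV - {i}. real (card {z \<in> ?F. z $ i = 0 \<and> z $ k = 0})) = (\<Sum>z\<in>?F. real (m z) * (real (m z) - 1))"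
  proof -
    have "(\<Sum>i\<in>UNIV. \<Sum>k\<in>UNIV - {i}. (of_bool (z $ i = 0 \<and> z $ k = 0) :: real)) = real (m z) * (real (m z) - 1)" for z :: "int ^ 'n"
    proof -
      have "(\<Sum>k\<in>UNIV - {i}. (of_bool (z $ i = 0 \<and> z $ k = 0) :: real)) = of_bool (z $ i = 0) * (real (m z) - 1)" for i
      proof (cases "z $ i = 0")
        case True
        have "(\<Sum>k\<in>UNIV - {i}. (of_bool (z $ k = 0) :: real)) = (\<Sum>k\<in>UNIV. of_bool (z $ k = 0)) - 1"
          using sum.remove[of UNIV i "\<lambda>k. of_bool (z $ k = 0) :: real"] True by simp
        also have "\<dots> = real (m z) - 1" by (simp only: bm)
        finally show ?thesis using True by simp
      qed simp
      then have "(\<Sum>i\<in>UNIV. \<Sum>k\<in>UNIV - {i}. (of_bool (z $ i = 0 \<and> z $ k = 0) :: real)) = (\<Sum>i\<in>UNIV. of_bool (z $ i = 0) * (real (m z) - 1))"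
        by (intro sum.cong refl)
      also have "\<dots> = real (m z) * (real (m z) - 1)" by (simp only: sum_distrib_right[symmetric] bm)
      finally show ?thesis .
    qed
    then have "(\<Sum>z\<in>?F. real (m z) * (real (m z) - 1)) = (\<Sum>z\<in>?F. \<Sum>i\<in>UNIV. \<Sum>k\<in>UNIV - {i}. of_bool (z $ i = 0 \<and> z $ k = 0))"
      by simp
    also have "\<dots> = (\<Sum>i\<in>UNIV. \<Sum>z\<in>?F. \<Sum>k\<in>UNIV - {i}. of_bool (z $ i = 0 \<and> z $ k = 0))"
      by (rule sum.swap)
    also have "\<dots> = (\<Sum>i\<in>UNIV. \<Sum>k\<in>UNIV - {i}. \<Sum>z\<in>?F. of_bool (z $ i = 0 \<and> z $ k = 0))"
      by (intro sum.cong refl sum.swap)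
    finally show ?thesis unfolding c by simp
  qed
  have s0: "2 ^ CARD('n) * real (pos_count a t) = (\<Sum>z\<in>?F. of_bool (m z = 0))"
  proof -
    have "2 ^ CARD('n) * real (pos_count a t) = real (card {z \<in> ?F. \<forall>i. z $ i \<noteq> 0})"
      by (simp add: card_nonzero_points)
    also have "\<dots> = (\<Sum>z\<in>?F. of_bool (m z = 0))" unfolding c by (simp add: m_def)
    finally show ?thesis .
  qed
  have "2 ^ CARD('n) * real (pos_count a t) - card ?F + (\<Sum>i\<in>UNIV. real (card {z \<in> ?F. z $ i = 0}))
     = (\<Sum>z\<in>?F. of_bool (m z = 0) - 1 + real (m z))"
    unfolding s0 s1 by (simp add: sum.distrib sum_subtractf)
  also have "\<bar>\<dots>\<bar> \<le> (\<Sum>z\<in>?F. \<bar>of_bool (m z = 0) - 1 + real (m z)\<bar>)" by (rule sum_abs)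
  also have "\<dots> \<le> (\<Sum>z\<in>?F. real (m z) * (real (m z) - 1))"
  proof (rule sum_mono)
    fix z
    show "\<bar>of_bool (m z = 0) - 1 + real (m z)\<bar> \<le> real (m z) * (real (m z) - 1)"
    proof (cases "m z \<le> 1")
      case True
      then show ?thesis by (cases "m z") auto
    next
      case False
      then have "1 * (real (m z) - 1) \<le> real (m z) * (real (m z) - 1)" by (intro mult_right_mono) auto
      then show ?thesis using False by simp
    qed
  qed
  finally show ?thesis unfolding s2 .
qed

end

lemma pos_count_uniform:
  fixes \<alpha> \<beta> :: real
  assumes "0 < \<alpha>" and n: "2 \<le> CARD('n::finite)"
  shows "\<exists>C. \<forall>a :: real ^ 'n. (\<forall>i. \<alpha> \<le> a $ i \<and> a $ i \<le> \<beta>) \<longrightarrow> (\<forall>t\<ge>1.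
    \<bar>2 ^ CARD('n) * real (pos_count a t) - card (full_points a t)
      + measure lebesgue (full_slab (k :: 'n)) * (\<Sum>i\<in>UNIV. \<Prod>j\<in>UNIV - {i}. a $ j) * t ^ (CARD('n) - 1)\<bar>
    \<le> C * t ^ (CARD('n) - 2))"
proof -
  let ?n = "CARD('n)" and ?c = "measure lebesgue (full_slab k)"
  define b where "b = max 1 \<beta>"
  define C where "C = ?n * (?c * b ^ (?n - 1) * (1 + ?n / \<alpha>) ^ (?n - 1)) + ?n * ?n * (2 * b + 1) ^ ?n"
  have "\<bar>2 ^ CARD('n) * real (pos_count a t) - card (full_points a t)
      + ?c * (\<Sum>i\<in>UNIV. \<Prod>j\<in>UNIV - {i}. a $ j) * t ^ (?n - 1)\<bar> \<le> C * t ^ (?n - 2)"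
    if a: "\<forall>i. \<alpha> \<le> a $ i \<and> a $ i \<le> \<beta>" and t: "1 \<le> t" for a :: "real ^ 'n" and t
  proof -
    have pos: "0 < a $ i" and ab: "a $ i \<le> b" for i using a assms(1) by (auto simp: b_def intro: less_le_trans max.coboundedI2)
    interpret positive_cuboid a by unfold_locales (rule pos)
    have tp: "0 \<le> t ^ (?n - 2)" "0 \<le> b" using t by (auto simp: b_def)
    have kd: "cell_diam \<le> ?n / \<alpha>"
    proof -
      have "cell_diam \<le> (\<Sum>i\<in>(UNIV :: 'n set). 1 / \<alpha>)"
        unfolding cell_diam_def using a assms(1) by (intro sum_mono divide_left_mono mult_pos_pos pos) auto
      then show ?thesis by simp
    qed
    have P: "(\<Prod>j\<in>UNIV - {i}. a $ j) \<le> b ^ (?n - 1)" for i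
    proof -
      have "(\<Prod>j\<in>UNIV - {i}. a $ j) \<le> (\<Prod>j\<in>UNIV - {i}. b)"
        using ab pos by (intro prod_mono) (auto intro: less_imp_le)
      then show ?thesis by (simp add: card_Diff_singleton)
    qed
    define Z where "Z i = real (card {z \<in> full_points a t. z $ i = 0})" for i
    have z1: "\<bar>Z i - ?c * (\<Prod>j\<in>UNIV - {i}. a $ j) * t ^ (?n - 1)\<bar>
        \<le> ?c * b ^ (?n - 1) * (1 + ?n / \<alpha>) ^ (?n - 1) * t ^ (?n - 2)" for i
    proof -
      have "\<bar>Z i - ?c * (\<Prod>j\<in>UNIV - {i}. a $ j) * t ^ (?n - 1)\<bar> \<le> ?c * (\<Prod>j\<in>UNIV - {i}. a $ j) * ((1 + cell_diam) ^ (?n - 1) * t ^ (?n - 2))"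
        using card_zero_slice[OF t n, of i] measure_full_slab_eq[of i k] by (simp add: Z_def)
      also have "\<dots> \<le> ?c * b ^ (?n - 1) * ((1 + ?n / \<alpha>) ^ (?n - 1) * t ^ (?n - 2))"
        using P kd tp t cell_diam_pos assms(1) pos
        by (intro mult_mono mult_left_mono power_mono mult_right_mono mult_nonneg_nonneg prod_nonneg) (auto intro: less_imp_le)
      finally show ?thesis by (simp add: mult.assoc)
    qed
    have "(\<Sum>i\<in>UNIV. \<Sum>k\<in>UNIV - {i}. real (card {z \<in> full_points a t. z $ i = 0 \<and> z $ k = 0}))
       \<le> (\<Sum>i\<in>(UNIV :: 'n set). \<Sum>k\<in>UNIV - {i}. (2 * b + 1) ^ ?n * t ^ (?n - 2))"
    proof (intro sum_mono)
      fix i k :: 'n assume "k \<in> UNIV - {i}"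
      then have "real (card {z \<in> full_points a t. z $ i = 0 \<and> z $ k = 0}) \<le> (\<Prod>l\<in>UNIV. 2 * a $ l + 1) * t ^ (?n - 2)"
        by (intro card_double_zero_slice[OF t]) auto
      also have "(\<Prod>l\<in>UNIV. 2 * a $ l + 1) \<le> (\<Prod>l\<in>(UNIV :: 'n set). 2 * b + 1)"
        using ab pos by (intro prod_mono) (auto intro!: add_nonneg_nonneg less_imp_le[OF pos])
      finally show "real (card {z \<in> full_points a t. z $ i = 0 \<and> z $ k = 0}) \<le> (2 * b + 1) ^ ?n * t ^ (?n - 2)"
        using tp by (simp add: mult_right_mono)
    qed
    also have "\<dots> = ?n * real (?n - 1) * (2 * b + 1) ^ ?n * t ^ (?n - 2)"
      by (simp add: card_Diff_singleton)
    also have "\<dots> \<le> ?n * ?n * (2 * b + 1) ^ ?n * t ^ (?n - 2)"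
      using tp by (intro mult_right_mono mult_left_mono) auto
    finally have z2: "\<bar>2 ^ ?n * real (pos_count a t) - card (full_points a t) + (\<Sum>i\<in>UNIV. Z i)\<bar>
        \<le> ?n * ?n * (2 * b + 1) ^ ?n * t ^ (?n - 2)"
      using pos_count_via_slices[of t] unfolding Z_def by linarith
    have "\<bar>(\<Sum>i\<in>UNIV. Z i) - ?c * (\<Sum>i\<in>UNIV. \<Prod>j\<in>UNIV - {i}. a $ j) * t ^ (?n - 1)\<bar>
      = \<bar>\<Sum>i\<in>UNIV. Z i - ?c * (\<Prod>j\<in>UNIV - {i}. a $ j) * t ^ (?n - 1)\<bar>"
      by (simp add: sum_subtractf sum_distrib_left sum_distrib_right)
    also have "\<dots> \<le> (\<Sum>i\<in>UNIV. \<bar>Z i - ?c * (\<Prod>j\<in>UNIV - {i}. a $ j) * t ^ (?n - 1)\<bar>)" by (rule sum_abs)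
    also have "\<dots> \<le> (\<Sum>i\<in>(UNIV :: 'n set). ?c * b ^ (?n - 1) * (1 + ?n / \<alpha>) ^ (?n - 1) * t ^ (?n - 2))"
      by (rule sum_mono) (rule z1)
    also have "\<dots> = ?n * (?c * b ^ (?n - 1) * (1 + ?n / \<alpha>) ^ (?n - 1)) * t ^ (?n - 2)" by simp
    finally show ?thesis using z2 unfolding C_def distrib_right by linarith
  qed
  then show ?thesis by blast
qed

section \<open>The Fourier transform of the ball\<close>

text \<open>The library proves invariance of Lebesgue measure under orthogonal maps of \<open>real ^ 'n\<close> only for
  well-ordered index types, hence a well-ordered copy of a finite type.\<close>

typedef 'a well_ordered_copy = "UNIV :: 'a set" ..

instance well_ordered_copy :: (finite) finite
proof
  have "(UNIV :: 'a well_ordered_copy set) = range Abs_well_ordered_copy"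
    by (metis Rep_well_ordered_copy_inverse UNIV_eq_I rangeI)
  moreover have "finite (range Abs_well_ordered_copy :: 'a well_ordered_copy set)" by (intro finite_imageI finite)
  ultimately show "finite (UNIV :: 'a well_ordered_copy set)" by metis
qed

definition copy_index :: "'a::finite well_ordered_copy \<Rightarrow> nat" where
  "copy_index = (SOME f. inj f)"

lemma inj_copy_index: "inj copy_index"
proof -
  obtain f :: "'a well_ordered_copy \<Rightarrow> nat" where "inj f"
    using finite_imp_inj_to_nat_seg[of "UNIV :: 'a well_ordered_copy set"] by auto
  then show ?thesis unfolding copy_index_def using someI[of inj f] by blast
qed

instantiation well_ordered_copy :: (finite) wellorder
begin

definition less_eq_well_ordered_copy :: "'a well_ordered_copy \<Rightarrow> 'a well_ordered_copy \<Rightarrow> bool" where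
  "less_eq_well_ordered_copy x y \<longleftrightarrow> copy_index x \<le> copy_index y"

definition less_well_ordered_copy :: "'a well_ordered_copy \<Rightarrow> 'a well_ordered_copy \<Rightarrow> bool" where
  "less_well_ordered_copy x y \<longleftrightarrow> copy_index x < copy_index y"

instance
proof
  fix x y z :: "'a well_ordered_copy"
  show "x < y \<longleftrightarrow> x \<le> y \<and> \<not> y \<le> x" "x \<le> x" "x \<le> y \<or> y \<le> x"
    by (auto simp: less_eq_well_ordered_copy_def less_well_ordered_copy_def)
  show "x \<le> y \<Longrightarrow> y \<le> z \<Longrightarrow> x \<le> z" by (simp add: less_eq_well_ordered_copy_def)
  show "x \<le> y \<Longrightarrow> y \<le> x \<Longrightarrow> x = y"
    using inj_copy_index by (auto simp: less_eq_well_ordered_copy_def inj_def)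
next
  fix P :: "'a well_ordered_copy \<Rightarrow> bool" and x :: "'a well_ordered_copy"
  assume step: "\<And>x. (\<And>y. y < x \<Longrightarrow> P y) \<Longrightarrow> P x"
  show "P x"
  proof (induction "copy_index x" arbitrary: x rule: less_induct)
    case less
    then show ?case using step[of x] by (simp add: less_well_ordered_copy_def)
  qed
qed

end

lemma lborel_integral_orthogonal_wellorder:
  fixes f :: "real ^ 'm::{finite,wellorder} \<Rightarrow> real ^ 'm::_" and g :: "real ^ 'm::_ \<Rightarrow> real"
  assumes f: "orthogonal_transformation f" and g: "g \<in> borel_measurable borel"
  shows "(LINT x|lborel. g (f x)) = (LINT x|lborel. g x)"
proof -
  have lin: "linear f" using f by (rule orthogonal_transformation_linear)
  have inv: "orthogonal_transformation (inv f)" "surj f" "inj f"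
    using f by (auto simp: orthogonal_transformation_inv orthogonal_transformation_surj orthogonal_transformation_inj)
  have meas: "f \<in> lborel \<rightarrow>\<^sub>M borel"
    using linear_continuous_on[OF lin[unfolded linear_conv_bounded_linear], of UNIV]
    by (simp add: borel_measurable_continuous_onI)
  have "lborel = distr lborel borel f"
  proof (rule lborel_eqI)
    fix l u :: "real ^ 'm::{finite,wellorder}" assume le: "\<And>b. b \<in> Basis \<Longrightarrow> l \<bullet> b \<le> u \<bullet> b"
    have pre: "f -` box l u \<inter> space lborel = inv f ` box l u"
      using inv by (simp add: bij_vimage_eq_inv_image bij_def)
    have lm: "inv f ` box l u \<in> lmeasurable" "measure lebesgue (inv f ` box l u) = measure lebesgue (box l u)"
      using measurable_orthogonal_image[OF inv(1), of "box l u"] measure_orthogonal_image[OF inv(1), of "box l u"] by simp_all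
    have bor: "inv f ` box l u \<in> sets borel"
      unfolding pre[symmetric] using measurable_sets[OF meas, of "box l u"] by simp
    have "emeasure (distr lborel borel f) (box l u) = emeasure lborel (inv f ` box l u)"
      by (subst emeasure_distr[OF meas]) (simp_all only: pre borel_open[OF open_box])
    also have "\<dots> = emeasure lebesgue (inv f ` box l u)" using bor by simp
    also have "\<dots> = ennreal (measure lebesgue (box l u))"
      using emeasure_eq_measure2[OF lm(1)] lm(2) by simp
    also have "\<dots> = (\<Prod>b\<in>Basis. (u - l) \<bullet> b)"
      using le by (simp add: measure_lborel_box_eq)
    finally show "emeasure (distr lborel borel f) (box l u) = (\<Prod>b\<in>Basis. (u - l) \<bullet> b)" .
  qed simp
  then have "(LINT x|lborel. g x) = (LINT x|distr lborel borel f. g x)" by simp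
  also have "\<dots> = (LINT x|lborel. g (f x))" by (rule integral_distr[OF meas g])
  finally show ?thesis by simp
qed

text \<open>By the symmetry of the ball its Fourier transform is real, so the cosine integral is all
  of it. Frequencies are normalised without the factor 2 pi.\<close>

definition ball_fourier :: "real ^ 'n::finite \<Rightarrow> real" where
  "ball_fourier v = (LINT y|lborel. indicator (cball 0 1) y * cos (v \<bullet> y))"

lemma ball_fourier_borel:
  "(\<lambda>y :: real ^ 'n::finite. indicator (cball 0 1) y * cos (v \<bullet> y)) \<in> borel_measurable borel"
proof -
  have "(\<lambda>y :: real ^ 'n. cos (v \<bullet> y)) \<in> borel_measurable borel"
    by (intro borel_measurable_continuous_onI continuous_intros)
  moreover have "(indicator (cball 0 1) :: _ \<Rightarrow> real) \<in> borel_measurable (borel :: (real ^ 'n) measure)"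
    by (intro borel_measurable_indicator borel_closed closed_cball)
  ultimately show ?thesis by (intro borel_measurable_times)
qed

lemma ball_fourier_rotate_wellorder:
  fixes v w :: "real ^ 'm::{finite,wellorder}"
  assumes "norm v = norm w"
  shows "ball_fourier v = ball_fourier w"
proof -
  obtain f where f: "orthogonal_transformation f" "f v = w"
    using orthogonal_transformation_exists[OF assms] by blast
  have "w \<bullet> f y = v \<bullet> y" for y
    using f by (auto simp: orthogonal_transformation_def)
  moreover have "indicator (cball 0 1) (f y) = (indicator (cball 0 1) y :: real)" for y
    using orthogonal_transformation_norm[OF f(1), of y] by (auto simp: indicator_def)
  ultimately have "ball_fourier v = (LINT y|lborel. (indicator (cball 0 1) (f y) * cos (w \<bullet> f y)))"
    by (simp add: ball_fourier_def)
  also have "\<dots> = ball_fourier w"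
    unfolding ball_fourier_def by (rule lborel_integral_orthogonal_wellorder[OF f(1) ball_fourier_borel])
  finally show ?thesis .
qed

lemma inner_reindex:
  assumes "bij (\<pi> :: 'm::finite \<Rightarrow> 'n::finite)"
  shows "(\<chi> j. x $ \<pi> j) \<bullet> (\<chi> j. y $ \<pi> j) = (x :: real ^ 'n) \<bullet> y"
  using sum.reindex_bij_betw[OF assms, of "\<lambda>i. x $ i * y $ i"] by (simp add: inner_vec_def)

lemma ball_fourier_reindex:
  assumes "bij (\<pi> :: 'm::finite \<Rightarrow> 'n::finite)"
  shows "ball_fourier (\<chi> j. v $ \<pi> j) = ball_fourier (v :: real ^ 'n)"
proof -
  let ?\<phi> = "\<lambda>x :: real ^ 'n. \<chi> j. x $ \<pi> j"
  have meas: "?\<phi> \<in> lborel \<rightarrow>\<^sub>M borel"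
    by (simp add: borel_measurable_continuous_onI continuous_intros)
  have "norm (?\<phi> y) = norm y" for y using inner_reindex[OF assms, of y y] by (simp add: norm_eq_sqrt_inner)
  then have ind: "indicator (cball 0 1) (?\<phi> y) = (indicator (cball 0 1) y :: real)" for y
    by (auto simp: indicator_def)
  have "ball_fourier (?\<phi> v) = (LINT y|distr lborel borel ?\<phi>. indicator (cball 0 1) y * cos (?\<phi> v \<bullet> y))"
    unfolding ball_fourier_def lborel_reindex[OF assms] ..
  also have "\<dots> = (LINT y|lborel. indicator (cball 0 1) (?\<phi> y) * cos (?\<phi> v \<bullet> ?\<phi> y))"
    by (rule integral_distr[OF meas ball_fourier_borel])
  finally show ?thesis by (simp add: ind inner_reindex[OF assms] ball_fourier_def)
qed

lemma ball_fourier_rotate: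
  fixes v w :: "real ^ 'n::finite"
  assumes "norm v = norm w"
  shows "ball_fourier v = ball_fourier w"
proof -
  have bij: "bij (Rep_well_ordered_copy :: 'n well_ordered_copy \<Rightarrow> 'n)"
    by (metis Abs_well_ordered_copy_inverse Rep_well_ordered_copy_inverse UNIV_I bijI')
  have "norm (\<chi> j. x $ Rep_well_ordered_copy j) = norm x" for x :: "real ^ 'n"
    using inner_reindex[OF bij, of x x] by (simp add: norm_eq_sqrt_inner)
  then have "ball_fourier (\<chi> j. v $ Rep_well_ordered_copy j) = ball_fourier (\<chi> j. w $ Rep_well_ordered_copy j)"
    using assms by (intro ball_fourier_rotate_wellorder) simp
  then show ?thesis by (simp only: ball_fourier_reindex[OF bij])
qed

text \<open>For a polynomial, integration by parts gives decay of order 1 / s. A continuous f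
  differs from a polynomial by a uniformly small amount, which changes the integral by at most e / 2
  for every s.\<close>

lemma riemann_lebesgue_continuous:
  fixes f :: "real \<Rightarrow> real"
  assumes f: "continuous_on {a..b} f" and "a \<le> b" and "0 < e"
  shows "\<exists>S>0. \<forall>s\<ge>S. \<bar>integral {a..b} (\<lambda>u. f u * sin (s * u))\<bar> \<le> e"
proof -
  define d where "d = e / (2 * (b - a + 1))"
  have d: "0 < d" using assms by (simp add: d_def)
  obtain p where p: "real_polynomial_function p" "\<And>x. x \<in> {a..b} \<Longrightarrow> \<bar>f x - p x\<bar> < d"
    using Stone_Weierstrass_real_polynomial_function[OF compact_Icc f d] by blast
  obtain p' where p': "real_polynomial_function p'" "\<And>x. (p has_real_derivative p' x) (at x)"
    using has_real_derivative_polynomial_function[OF p(1)] by blast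
  have cont: "continuous_on S p" "continuous_on S p'" for S
    using p(1) p'(1) by (simp_all add: continuous_on_polymonial_function real_polynomial_function_eq)
  obtain B1 where B1: "\<forall>x\<in>{a..b}. \<bar>p x\<bar> \<le> B1"
    using compact_imp_bounded[OF compact_continuous_image[OF cont(1)[of "{a..b}"] compact_Icc]]
    unfolding bounded_iff by auto
  obtain B2 where B2: "\<forall>x\<in>{a..b}. \<bar>p' x\<bar> \<le> B2"
    using compact_imp_bounded[OF compact_continuous_image[OF cont(2)[of "{a..b}"] compact_Icc]]
    unfolding bounded_iff by auto
  define B where "B = 2 * \<bar>B1\<bar> + \<bar>B2\<bar> * (b - a)"
  have B: "0 \<le> B" using assms(2) by (simp add: B_def)
  define S where "S = 2 * B / e + 1"
  have S: "0 < S" using B assms(3) by (simp add: S_def add_nonneg_pos)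
  have "\<bar>integral {a..b} (\<lambda>u. f u * sin (s * u))\<bar> \<le> e" if s: "S \<le> s" for s
  proof -
    have s0: "0 < s" using S s by simp
    have i: "(\<lambda>u. (f u - p u) * sin (s * u)) integrable_on {a..b}" "(\<lambda>u. p u * sin (s * u)) integrable_on {a..b}"
      "(\<lambda>u. p' u * cos (s * u)) integrable_on {a..b}"
      by (intro integrable_continuous_real continuous_intros f cont)+
    have "\<bar>integral {a..b} (\<lambda>u. (f u - p u) * sin (s * u))\<bar> \<le> d * (b - a)"
    proof -
      have bb: "norm ((f u - p u) * sin (s * u)) \<le> d" if "u \<in> {a..b}" for u
      proof -
        have "\<bar>f u - p u\<bar> * \<bar>sin (s * u)\<bar> \<le> d * 1"
          using p(2)[OF that] d by (intro mult_mono) auto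
        then show ?thesis by (simp add: abs_mult)
      qed
      have "continuous_on {a..b} (\<lambda>u. (f u - p u) * sin (s * u))"
        by (intro continuous_intros f cont)
      from integral_bound[OF assms(2) this bb] show ?thesis by simp
    qed
    also have "\<dots> \<le> e / 2" using assms by (simp add: d_def field_simps)
    finally have 1: "\<bar>integral {a..b} (\<lambda>u. (f u - p u) * sin (s * u))\<bar> \<le> e / 2" .
    define G where "G u = - (p u * cos (s * u)) / s" for u
    have "((\<lambda>u. p u * sin (s * u) - p' u * cos (s * u) / s) has_integral G b - G a) {a..b}"
    proof (rule fundamental_theorem_of_calculus[OF assms(2)])
      fix u assume "u \<in> {a..b}"
      have "(G has_real_derivative p u * sin (s * u) - p' u * cos (s * u) / s) (at u)"
        unfolding G_def using s0 by (auto intro!: derivative_eq_intros p'(2) simp: field_simps)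
      then show "(G has_vector_derivative p u * sin (s * u) - p' u * cos (s * u) / s) (at u within {a..b})"
        by (simp add: has_real_derivative_iff_has_vector_derivative[symmetric] has_field_derivative_at_within)
    qed
    then have "integral {a..b} (\<lambda>u. p u * sin (s * u) - (1/s) * (p' u * cos (s * u))) = G b - G a"
      by (simp add: integral_unique)
    moreover have "integral {a..b} (\<lambda>u. p u * sin (s * u) - (1/s) * (p' u * cos (s * u)))
       = integral {a..b} (\<lambda>u. p u * sin (s * u)) - (1/s) * integral {a..b} (\<lambda>u. p' u * cos (s * u))"
      by (subst integral_diff) (auto intro!: i integrable_on_mult_right simp: integral_mult_right simp del: times_divide_eq_left)
    ultimately have "integral {a..b} (\<lambda>u. p u * sin (s * u)) - (1/s) * integral {a..b} (\<lambda>u. p' u * cos (s * u)) = G b - G a"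
      by argo
    then have eq: "integral {a..b} (\<lambda>u. p u * sin (s * u)) = (p a * cos (s * a) - p b * cos (s * b) + integral {a..b} (\<lambda>u. p' u * cos (s * u))) / s"
      by (simp add: G_def add_divide_distrib diff_divide_distrib)
    have "\<bar>integral {a..b} (\<lambda>u. p' u * cos (s * u))\<bar> \<le> \<bar>B2\<bar> * (b - a)"
    proof -
      have bb: "norm (p' u * cos (s * u)) \<le> \<bar>B2\<bar>" if "u \<in> {a..b}" for u
      proof -
        have "\<bar>p' u\<bar> * \<bar>cos (s * u)\<bar> \<le> \<bar>B2\<bar> * 1"
          using bspec[OF B2 that] by (intro mult_mono) auto
        then show ?thesis by (simp add: abs_mult)
      qed
      have "continuous_on {a..b} (\<lambda>u. p' u * cos (s * u))"
        by (intro continuous_intros cont)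
      from integral_bound[OF assms(2) this bb] show ?thesis by simp
    qed
    moreover have "\<bar>p x * cos (s * x)\<bar> \<le> \<bar>B1\<bar>" if "x \<in> {a..b}" for x
    proof -
      have "\<bar>p x\<bar> * \<bar>cos (s * x)\<bar> \<le> \<bar>B1\<bar> * 1"
        using bspec[OF B1 that] by (intro mult_mono) auto
      then show ?thesis by (simp add: abs_mult)
    qed
    from this[of a] this[of b] have "\<bar>p a * cos (s * a)\<bar> \<le> \<bar>B1\<bar>" "\<bar>p b * cos (s * b)\<bar> \<le> \<bar>B1\<bar>"
      using assms(2) by auto
    ultimately have "\<bar>p a * cos (s * a) - p b * cos (s * b) + integral {a..b} (\<lambda>u. p' u * cos (s * u))\<bar> \<le> B"
      unfolding B_def by linarith
    then have "\<bar>integral {a..b} (\<lambda>u. p u * sin (s * u))\<bar> \<le> B / s"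
      unfolding eq using s0 by (simp add: divide_right_mono)
    also have "\<dots> \<le> e / 2"
    proof -
      have "2 * B / e \<le> s" using s by (simp add: S_def)
      then show ?thesis using s0 assms(3) by (simp add: field_simps)
    qed
    finally have 2: "\<bar>integral {a..b} (\<lambda>u. p u * sin (s * u))\<bar> \<le> e / 2" .
    have "integral {a..b} (\<lambda>u. f u * sin (s * u)) = integral {a..b} (\<lambda>u. (f u - p u) * sin (s * u) + p u * sin (s * u))"
      by (simp add: algebra_simps)
    also have "\<dots> = integral {a..b} (\<lambda>u. (f u - p u) * sin (s * u)) + integral {a..b} (\<lambda>u. p u * sin (s * u))"
      by (rule integral_add) (rule i)+
    finally show ?thesis using 1 2 by linarith
  qed
  then show ?thesis using S by blast
qed

text \<open>Integration by parts gains a factor 1 / s and leaves the integral of the derivative of A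
  against a sine, to be shown small. For m = 1 that derivative is unbounded at 1, so the interval is
  cut at a point b with A b small: Riemann-Lebesgue works on [0, b], monotonicity of A on
  [b, 1].\<close>

lemma oscillatory_semicircle_decay:
  assumes "0 < m" "0 < e"
  shows "\<exists>S>0. \<forall>s\<ge>S. \<bar>s * integral {0..1} (\<lambda>u. sqrt (1 - u\<^sup>2) ^ m * cos (s * u))\<bar> \<le> e"
proof -
  define A where "A u = sqrt (1 - u\<^sup>2) ^ m" for u
  have contA: "continuous_on S A" for S
    unfolding A_def by (intro continuous_intros)
  have A1: "A 1 = 0" using assms(1) by (simp add: A_def)
  have A0: "0 \<le> A u" if "0 \<le> u" "u \<le> 1" for u
    using that by (simp add: A_def power_le_one)
  have decA: "A v \<le> A u" if "0 \<le> u" "u \<le> v" "v \<le> 1" for u v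
    using that unfolding A_def by (intro power_mono real_sqrt_le_mono) (auto simp: power_mono power_le_one)
  obtain b where b: "0 < b" "b < 1" "A b \<le> e / 6"
  proof -
    have "isCont A 1" using contA[of UNIV] by (simp add: continuous_on_eq_continuous_at)
    then have "\<forall>\<^sub>F u in at_left 1. A u < e / 6"
      using A1 assms(2) by (intro order_tendstoD(2)[of _ 0]) (auto simp: isCont_def A1 intro: tendsto_within_subset)
    moreover have "\<forall>\<^sub>F u in at_left (1::real). u \<in> {0<..<1}"
      by (rule eventually_at_left_real) simp
    ultimately have "\<forall>\<^sub>F u in at_left (1::real). u \<in> {0<..<1} \<and> A u < e / 6"
      by eventually_elim auto
    then obtain u where "u \<in> {0<..<1}" "A u < e / 6"
      using eventually_happens[of _ "at_left (1::real)"] by (auto simp: trivial_limit_at_left_real)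
    then show ?thesis using that[of u] by auto
  qed
  define A' where "A' u = m * sqrt (1 - u\<^sup>2) ^ (m - 1) * (- u / sqrt (1 - u\<^sup>2))" for u
  have sq: "0 < 1 - u\<^sup>2" if "0 \<le> u" "u \<le> b" for u
  proof -
    have "u\<^sup>2 \<le> b\<^sup>2" using that by (intro power_mono) auto
    also have "b\<^sup>2 < 1\<^sup>2" using b by (intro power_strict_mono) auto
    finally show ?thesis by simp
  qed
  have contA': "continuous_on {0..b} A'"
    unfolding A'_def using sq by (intro continuous_intros) (auto dest!: sq)
  obtain S where S: "0 < S" "\<And>s. S \<le> s \<Longrightarrow> \<bar>integral {0..b} (\<lambda>u. A' u * sin (s * u))\<bar> \<le> e / 2"
    using riemann_lebesgue_continuous[OF contA', of "e / 2"] b assms(2) by auto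
  have "\<bar>s * integral {0..1} (\<lambda>u. A u * cos (s * u))\<bar> \<le> e" if s: "S \<le> s" for s
  proof -
    have s0: "0 < s" using S s by simp
    have i: "(\<lambda>u. A u * cos (s * u)) integrable_on {0..1}" "(\<lambda>u. A u * cos (s * u)) integrable_on {0..b}"
       "(\<lambda>u. A' u * sin (s * u)) integrable_on {0..b}"
      by (intro integrable_continuous_real continuous_intros contA contA')+
    have "((\<lambda>u. A' u * sin (s * u) + s * (A u * cos (s * u))) has_integral A b * sin (s * b) - A 0 * sin (s * 0)) {0..b}"
    proof (rule fundamental_theorem_of_calculus)
      fix u assume u: "u \<in> {0..b}"
      have "(A has_real_derivative A' u) (at u)"
        unfolding A_def A'_def using sq[of u] u by (auto intro!: derivative_eq_intros simp: field_simps)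
      then have "((\<lambda>u. A u * sin (s * u)) has_real_derivative A' u * sin (s * u) + s * (A u * cos (s * u))) (at u)"
        by (auto intro!: derivative_eq_intros simp: field_simps)
      then show "((\<lambda>u. A u * sin (s * u)) has_vector_derivative A' u * sin (s * u) + s * (A u * cos (s * u))) (at u within {0..b})"
        by (simp add: has_real_derivative_iff_has_vector_derivative[symmetric] has_field_derivative_at_within)
    qed (use b in simp)
    then have "integral {0..b} (\<lambda>u. A' u * sin (s * u) + s * (A u * cos (s * u))) = A b * sin (s * b)"
      by (simp add: integral_unique)
    moreover have "integral {0..b} (\<lambda>u. A' u * sin (s * u) + s * (A u * cos (s * u)))
      = integral {0..b} (\<lambda>u. A' u * sin (s * u)) + s * integral {0..b} (\<lambda>u. A u * cos (s * u))"
      by (subst integral_add) (auto intro!: i integrable_on_mult_right simp: integral_mult_right)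
    ultimately have 1: "s * integral {0..b} (\<lambda>u. A u * cos (s * u)) = A b * sin (s * b) - integral {0..b} (\<lambda>u. A' u * sin (s * u))"
      by linarith
    have icos: "integral {x..y} (\<lambda>u. cos (s * u)) = (sin (s * y) - sin (s * x)) / s" if "x \<le> y" for x y
    proof -
      have "((\<lambda>u. cos (s * u)) has_integral sin (s * y) / s - sin (s * x) / s) {x..y}"
      proof (rule fundamental_theorem_of_calculus[OF that])
        fix u assume "u \<in> {x..y}"
        have "((\<lambda>u. sin (s * u) / s) has_real_derivative cos (s * u)) (at u within {x..y})"
          using s0 by (auto intro!: derivative_eq_intros)
        then show "((\<lambda>u. sin (s * u) / s) has_vector_derivative cos (s * u)) (at u within {x..y})"
          by (simp add: has_real_derivative_iff_has_vector_derivative)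
      qed
      then show ?thesis by (simp add: integral_unique diff_divide_distrib)
    qed
    \<comment> \<open>The second mean value theorem for the increasing function -A leaves only the
      value at b, because A 1 = 0. No derivative of A is involved near the endpoint.\<close>
    have "(\<lambda>u. cos (s * u)) integrable_on {b..1}"
      by (intro integrable_continuous_real continuous_intros)
    then obtain c where c: "c \<in> {b..1}"
      "integral {b..1} (\<lambda>u. - A u * cos (s * u)) = - A b * integral {b..c} (\<lambda>u. cos (s * u)) + - A 1 * integral {c..1} (\<lambda>u. cos (s * u))"
      by (rule second_mean_value_theorem[where g = "\<lambda>u. - A u" and a = b and b = 1]) (use b decA in auto)
    then have "integral {b..1} (\<lambda>u. A u * cos (s * u)) = A b * ((sin (s * c) - sin (s * b)) / s)"
      by (simp add: A1 icos)
    then have 2: "s * integral {b..1} (\<lambda>u. A u * cos (s * u)) = A b * (sin (s * c) - sin (s * b))"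
      using s0 by simp
    have "integral {0..1} (\<lambda>u. A u * cos (s * u)) = integral {0..b} (\<lambda>u. A u * cos (s * u)) + integral {b..1} (\<lambda>u. A u * cos (s * u))"
      using Henstock_Kurzweil_Integration.integral_combine[OF _ _ i(1), of b] b by simp
    \<comment> \<open>The boundary terms A b sin (s b) of the two pieces cancel, and what remains at
      the cut is bounded by A b.\<close>
    then have "s * integral {0..1} (\<lambda>u. A u * cos (s * u)) = A b * sin (s * c) - integral {0..b} (\<lambda>u. A' u * sin (s * u))"
      using 1 2 by (simp add: algebra_simps)
    moreover have "\<bar>A b * sin (s * c)\<bar> \<le> e / 6"
    proof -
      have "\<bar>A b\<bar> * \<bar>sin (s * c)\<bar> \<le> e / 6 * 1"
        using b A0[of b] assms(2) by (intro mult_mono) auto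
      then show ?thesis by (simp add: abs_mult)
    qed
    ultimately show ?thesis using S(2)[OF s] assms(2) by linarith
  qed
  then show ?thesis using S(1) unfolding A_def by blast
qed

section \<open>Slicing integrals along one coordinate\<close>

lemma integrable_bounded_support:
  fixes f :: "'a::euclidean_space \<Rightarrow> real"
  assumes "f \<in> borel_measurable borel" "\<And>x. \<bar>f x\<bar> \<le> B" "\<And>x. R < norm x \<Longrightarrow> f x = 0"
  shows "integrable lborel f"
proof (rule Bochner_Integration.integrable_bound)
  show "integrable lborel (\<lambda>x :: 'a. indicator (cball 0 R) x *\<^sub>R B)"
    using emeasure_lborel_cball_finite[of "0 :: 'a" R]
    by (intro integrable_scaleR_left integrable_real_indicator) auto
  show "f \<in> borel_measurable lborel" using assms(1) by simp
  show "AE x in lborel. norm (f x) \<le> norm (indicator (cball 0 R) x *\<^sub>R B)"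
  proof (rule AE_I2)
    fix x
    show "norm (f x) \<le> norm (indicator (cball 0 R) x *\<^sub>R B)"
      using assms(2)[of x] assms(3)[of x] by (cases "norm x \<le> R") (auto simp: not_le)
  qed
qed

lemma lborel_integral_translate:
  fixes f :: "'a::euclidean_space \<Rightarrow> real"
  assumes "f \<in> borel_measurable borel"
  shows "(LINT x|lborel. f (c + x)) = (LINT x|lborel. f x)"
proof -
  have "(LINT x|lborel. f x) = (LINT x|distr lborel borel ((+) c). f x)" by (simp add: lborel_distr_plus)
  also have "\<dots> = (LINT x|lborel. f (c + x))"
    by (rule integral_distr[OF _ assms]) simp
  finally show ?thesis by simp
qed

text \<open>Fubini for one coordinate, stated without splitting \<open>real ^ 'n\<close> into a product: averaging the
  line integrals in direction \<open>k\<close> over the base points in a slab of width one.\<close>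

lemma lborel_integral_slices:
  fixes F :: "real ^ 'n::finite \<Rightarrow> real" and k :: 'n
  assumes F: "F \<in> borel_measurable borel" and bound: "\<And>x. \<bar>F x\<bar> \<le> B" and supp: "\<And>x. R < norm x \<Longrightarrow> F x = 0"
  defines "slab \<equiv> {y :: real ^ 'n. - (1/2) \<le> y $ k \<and> y $ k < 1/2}"
  shows "(LINT y|lborel. F y) = (LINT u|lborel. (LINT y|lborel. indicator slab y * F (y + (u - y $ k) *\<^sub>R axis k 1)))"
proof -
  define e :: "real ^ 'n" where "e = axis k 1"
  have ne: "norm e = 1" by (simp add: e_def)
  have ek: "e $ k = 1" by (simp add: e_def)
  have slab: "slab \<in> sets borel"
  proof -
    note [measurable] = borel_component
    have "slab = {y \<in> space borel. - (1/2) \<le> y $ k \<and> y $ k < 1/2}" by (auto simp: slab_def)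
    also have "\<dots> \<in> sets borel" by measurable
    finally show ?thesis .
  qed
  have ind: "(\<lambda>y. indicator slab y :: real) \<in> borel_measurable borel" using slab by simp
  have prod: "(\<lambda>p. indicator slab (g p) * F (h p)) \<in> borel_measurable borel"
    if "continuous_on UNIV g" "continuous_on UNIV h" for g h :: "real \<times> (real ^ 'n) \<Rightarrow> real ^ 'n"
    using that by (intro borel_measurable_times measurable_compose[OF borel_measurable_continuous_onI ind]
        measurable_compose[OF borel_measurable_continuous_onI F]) auto
  have B0: "0 \<le> B" using bound[of 0] by linarith
  have bnd: "\<bar>indicator S x * F y\<bar> \<le> B" for S x y
    using bound[of y] B0 by (cases "x \<in> S") auto
  \<comment> \<open>The identity follows by alternating three interchanges of the integrals with two
    translations, first of u by y_k, then of y along the axis. Each interchange has its own pair of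
    continuous maps g, h; the condition \<open>s\<close> confines the support of the integrand to a
    bounded set, which gives integrability on the product.\<close>
  have fub: "(LINT u|lborel. (LINT y|lborel. indicator slab (g (u, y)) * F (h (u, y)))) =
      (LINT y|lborel. (LINT u|lborel. indicator slab (g (u, y)) * F (h (u, y))))"
    if "continuous_on UNIV g" "continuous_on UNIV h"
      and s: "\<And>u y. g (u, y) \<in> slab \<Longrightarrow> norm (h (u, y)) \<le> R \<Longrightarrow> \<bar>u\<bar> + norm y \<le> Q"
    for g h :: "real \<times> (real ^ 'n) \<Rightarrow> real ^ 'n" and Q
  proof -
    have "integrable lborel (\<lambda>p. indicator slab (g p) * F (h p))"
    proof (rule integrable_bounded_support[where R = Q])
      fix p :: "real \<times> (real ^ 'n)" assume p: "Q < norm p"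
      obtain u y where py: "p = (u, y)" by force
      have "norm p \<le> \<bar>u\<bar> + norm y" unfolding py using norm_Pair_le[of u y] by simp
      then have "\<not> (g (u, y) \<in> slab \<and> norm (h (u, y)) \<le> R)" using s[of u y] p by auto
      then show "indicator slab (g p) * F (h p) = 0"
        using supp[of "h p"] py by (auto simp: indicator_def not_le)
    qed (use prod[OF that(1,2)] bnd in auto)
    then have "integrable (lborel \<Otimes>\<^sub>M lborel) (case_prod (\<lambda>u y. indicator slab (g (u, y)) * F (h (u, y))))"
      by (simp add: lborel_prod case_prod_beta')
    from lborel_pair.Fubini_integral[OF this] show ?thesis by simp
  qed
  have sk: "\<bar>y $ k\<bar> \<le> 1/2" if "y \<in> slab" for y using that by (auto simp: slab_def)
  have "(LINT u|lborel. (LINT y|lborel. indicator slab y * F (y + (u - y $ k) *\<^sub>R e)))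
     = (LINT y|lborel. (LINT u|lborel. indicator slab y * F (y + (u - y $ k) *\<^sub>R e)))"
  proof -
    have s: "\<bar>u\<bar> + norm y \<le> R + (R + (R + 1/2))"
      if "y \<in> slab" "norm (y + (u - y $ k) *\<^sub>R e) \<le> R" for u y
    proof -
      have "\<bar>(y + (u - y $ k) *\<^sub>R e) $ k\<bar> \<le> norm (y + (u - y $ k) *\<^sub>R e)" by (rule component_le_norm_cart)
      then have u: "\<bar>u\<bar> \<le> R" using that(2) ek by simp
      have "norm y \<le> norm (y + (u - y $ k) *\<^sub>R e) + norm ((u - y $ k) *\<^sub>R e)"
        by (metis norm_triangle_ineq4 add_diff_cancel_right')
      also have "norm ((u - y $ k) *\<^sub>R e) \<le> R + 1/2" using u sk[OF that(1)] by (simp add: ne)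
      finally show ?thesis using u that(2) by linarith
    qed
    show ?thesis
      using fub[of snd "\<lambda>p. snd p + (fst p - snd p $ k) *\<^sub>R e" "R + (R + (R + 1/2))"] s
      by (simp add: continuous_intros)
  qed
  also have "\<dots> = (LINT y|lborel. (LINT u|lborel. indicator slab y * F (y + u *\<^sub>R e)))"
  proof (rule Bochner_Integration.integral_cong[OF refl])
    fix y :: "real ^ 'n"
    have m: "(\<lambda>u. indicator slab y * F (y + (u - y $ k) *\<^sub>R e)) \<in> borel_measurable borel"
      by (intro borel_measurable_times borel_measurable_const measurable_compose[OF borel_measurable_continuous_onI F] continuous_intros)
    show "(LINT u|lborel. indicator slab y * F (y + (u - y $ k) *\<^sub>R e)) = (LINT u|lborel. indicator slab y * F (y + u *\<^sub>R e))"
      using lborel_integral_translate[OF m, of "y $ k", symmetric] by simp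
  qed
  also have "\<dots> = (LINT u|lborel. (LINT y|lborel. indicator slab y * F (y + u *\<^sub>R e)))"
  proof -
    have s: "\<bar>u\<bar> + norm y \<le> (R + 1/2) + (R + (R + 1/2))"
      if "y \<in> slab" "norm (y + u *\<^sub>R e) \<le> R" for u y
    proof -
      have "\<bar>(y + u *\<^sub>R e) $ k\<bar> \<le> norm (y + u *\<^sub>R e)" by (rule component_le_norm_cart)
      then have u: "\<bar>u\<bar> \<le> R + 1/2" using that(2) ek sk[OF that(1)] by simp
      have "norm y \<le> norm (y + u *\<^sub>R e) + norm (u *\<^sub>R e)"
        by (metis norm_triangle_ineq4 add_diff_cancel_right')
      also have "norm (u *\<^sub>R e) \<le> R + 1/2" using u by (simp add: ne)
      finally show ?thesis using u that(2) by linarith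
    qed
    show ?thesis
      using fub[of snd "\<lambda>p. snd p + fst p *\<^sub>R e" "(R + 1/2) + (R + (R + 1/2))"] s
      by (simp add: continuous_intros)
  qed
  also have "\<dots> = (LINT u|lborel. (LINT y|lborel. indicator slab (y - u *\<^sub>R e) * F y))"
  proof (rule Bochner_Integration.integral_cong[OF refl])
    fix u :: real
    have m: "(\<lambda>y. indicator slab (y - u *\<^sub>R e) * F y) \<in> borel_measurable borel"
      by (intro borel_measurable_times measurable_compose[OF borel_measurable_continuous_onI ind] F continuous_intros)
    show "(LINT y|lborel. indicator slab y * F (y + u *\<^sub>R e)) = (LINT y|lborel. indicator slab (y - u *\<^sub>R e) * F y)"
      using lborel_integral_translate[OF m, of "u *\<^sub>R e"] by (simp add: add.commute)
  qed
  also have "\<dots> = (LINT y|lborel. (LINT u|lborel. indicator slab (y - u *\<^sub>R e) * F y))"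
  proof -
    have s: "\<bar>u\<bar> + norm y \<le> (R + 1/2) + R"
      if "y - u *\<^sub>R e \<in> slab" "norm y \<le> R" for u y
    proof -
      have "\<bar>y $ k - u\<bar> \<le> 1/2" using sk[OF that(1)] ek by simp
      then show ?thesis using that(2) component_le_norm_cart[of y k] by linarith
    qed
    show ?thesis
      using fub[of "\<lambda>p. snd p - fst p *\<^sub>R e" snd "(R + 1/2) + R"] s
      by (simp add: continuous_intros)
  qed
  also have "\<dots> = (LINT y|lborel. F y)"
  proof (rule Bochner_Integration.integral_cong[OF refl])
    fix y :: "real ^ 'n"
    \<comment> \<open>For fixed y the admissible u form an interval of length one; this is where the
      width of the slab matters.\<close>
    have "indicator slab (y - u *\<^sub>R e) = (indicator {y $ k - 1/2<..y $ k + 1/2} u :: real)" for u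
      by (auto simp: indicator_def slab_def ek)
    then have "(LINT u|lborel. indicator slab (y - u *\<^sub>R e) * F y) = (LINT u|lborel. indicator {y $ k - 1/2<..y $ k + 1/2} u * F y)"
      by simp
    also have "\<dots> = F y" by simp
    finally show "(LINT u|lborel. indicator slab (y - u *\<^sub>R e) * F y) = F y" .
  qed
  finally show ?thesis by (simp add: e_def)
qed

interpretation unit_cube: positive_cuboid "(\<chi> i. 1) :: real ^ 'n::finite"
  by unfold_locales simp

lemma scaled_ones [simp]: "scaled (\<chi> i. 1) x = x"
  by (simp add: vec_eq_iff)

text \<open>The section of the unit ball at height u is a ball of dimension n - 1 with radius sqrt
  (1 - u^2), on which the cosine is constant. Its volume enters as that of a cylinder of width one,
  and symmetry in u gives the factor 2.\<close>

lemma ball_fourier_axis: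
  fixes k :: "'n::finite"
  shows "ball_fourier (s *\<^sub>R axis k 1 :: real ^ 'n) =
    2 * measure lebesgue (full_slab k) * integral {0..1} (\<lambda>u. sqrt (1 - u\<^sup>2) ^ (CARD('n) - 1) * cos (s * u))"
proof -
  let ?n = "CARD('n)"
  define c where "c = measure lebesgue (full_slab k)"
  define F where "F y = indicator (cball 0 1) y * cos (s * y $ k)" for y :: "real ^ 'n"
  define slab where "slab = {y :: real ^ 'n. - (1/2) \<le> y $ k \<and> y $ k < 1/2}"
  have Feq: "F = (\<lambda>y. indicator (cball 0 1) y * cos ((s *\<^sub>R axis k 1) \<bullet> y))"
    by (simp add: F_def[abs_def] inner_axis')
  have Fb: "F \<in> borel_measurable borel" unfolding Feq by (rule ball_fourier_borel)
  \<comment> \<open>At u = -1 and u = 1 the section has radius zero, outside the range of the volume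
    formula for cylinders. These heights form a null set and are left out.\<close>
  have inner: "(LINT y|lborel. indicator slab y * F (y + (u - y $ k) *\<^sub>R axis k 1)) =
      indicator {-1..1} u * (c * (sqrt (1 - u\<^sup>2) ^ (?n - 1) * cos (s * u)))" if u: "u \<notin> {-1, 1}" for u
  proof -
    have pt: "indicator slab y * F (y + (u - y $ k) *\<^sub>R axis k 1) =
        (if \<bar>u\<bar> < 1 then cos (s * u) * indicator (unit_cube.full_cylinder k (sqrt (1 - u\<^sup>2))) y else 0)" for y :: "real ^ 'n"
    proof -
      define w where "w = y + (u - y $ k) *\<^sub>R axis k 1"
      have wk: "w $ k = u" by (simp add: w_def)
      have wd: "drop_coordinate k w = drop_coordinate k y" by (simp add: vec_eq_iff w_def axis_def)
      have nw: "(norm w)\<^sup>2 = u\<^sup>2 + (norm (drop_coordinate k y))\<^sup>2"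
        using norm_scaled_split[of "\<chi> i. 1" w k] by (simp add: wk wd)
      have "norm w \<le> 1 \<longleftrightarrow> u\<^sup>2 + (norm (drop_coordinate k y))\<^sup>2 \<le> 1"
        unfolding nw[symmetric] by (simp add: abs_square_le_1)
      also have "\<dots> \<longleftrightarrow> \<bar>u\<bar> < 1 \<and> norm (drop_coordinate k y) \<le> sqrt (1 - u\<^sup>2)"
      proof
        assume le: "u\<^sup>2 + (norm (drop_coordinate k y))\<^sup>2 \<le> 1"
        then have "u\<^sup>2 \<le> 1" by (smt (verit) zero_le_power2)
        then have "\<bar>u\<bar> \<le> 1" by (simp add: abs_square_le_1)
        moreover have "\<bar>u\<bar> \<noteq> 1" using u by auto
        ultimately show "\<bar>u\<bar> < 1 \<and> norm (drop_coordinate k y) \<le> sqrt (1 - u\<^sup>2)"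
          using le by (auto intro: real_le_rsqrt)
      next
        assume a: "\<bar>u\<bar> < 1 \<and> norm (drop_coordinate k y) \<le> sqrt (1 - u\<^sup>2)"
        then have "u\<^sup>2 \<le> 1" by (simp add: abs_square_le_1)
        moreover have "(norm (drop_coordinate k y))\<^sup>2 \<le> (sqrt (1 - u\<^sup>2))\<^sup>2" using a by (intro power_mono) auto
        ultimately show "u\<^sup>2 + (norm (drop_coordinate k y))\<^sup>2 \<le> 1" by simp
      qed
      finally have "norm w \<le> 1 \<longleftrightarrow> \<bar>u\<bar> < 1 \<and> norm (drop_coordinate k y) \<le> sqrt (1 - u\<^sup>2)" .
      then show ?thesis
        unfolding w_def[symmetric] F_def
        by (auto simp: wk slab_def unit_cube.full_cylinder_def indicator_def)
    qed
    show ?thesis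
    proof (cases "\<bar>u\<bar> < 1")
      case True
      then have "u\<^sup>2 < 1" by (simp add: abs_square_less_1)
      then have r: "0 < sqrt (1 - u\<^sup>2)" by simp
      let ?C = "unit_cube.full_cylinder k (sqrt (1 - u\<^sup>2))"
      have bor: "?C \<in> sets borel"
      proof -
        note [measurable] = borel_component borel_norm_drop
        have "?C = {x \<in> space borel. - (1/2) \<le> x $ k \<and> x $ k < 1/2 \<and> norm (drop_coordinate k x) \<le> sqrt (1 - u\<^sup>2)}"
          by (auto simp: unit_cube.full_cylinder_def)
        also have "\<dots> \<in> sets borel" by measurable
        finally show ?thesis .
      qed
      have "(LINT y|lborel. indicator slab y * F (y + (u - y $ k) *\<^sub>R axis k 1)) = cos (s * u) * measure lborel ?C"
        unfolding pt using True by simp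
      also have "measure lborel ?C = measure lebesgue ?C" using bor by simp
      also have "\<dots> = c * sqrt (1 - u\<^sup>2) ^ (?n - 1)"
        using unit_cube.measure_full_cylinder(2)[OF r, of k] by (simp add: c_def)
      finally show ?thesis using True by (auto simp: indicator_def abs_less_iff)
    next
      case False
      then have "u \<notin> {-1..1}" using u by auto
      then show ?thesis unfolding pt using False by simp
    qed
  qed
  have "ball_fourier (s *\<^sub>R axis k 1 :: real ^ 'n) = (LINT y|lborel. F y)"
    by (simp add: ball_fourier_def Feq)
  also have "\<dots> = (LINT u|lborel. (LINT y|lborel. indicator slab y * F (y + (u - y $ k) *\<^sub>R axis k 1)))"
    unfolding slab_def by (rule lborel_integral_slices[OF Fb, of 1 1]) (auto simp: F_def indicator_def)
  also have "\<dots> = (LINT u|lborel. indicator {-1..1} u * (c * (sqrt (1 - u\<^sup>2) ^ (?n - 1) * cos (s * u))))"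
  proof (rule integral_cong_AE)
    have "AE u in lborel. u \<notin> {-1, 1 :: real}"
      by (intro AE_not_in finite_imp_null_set_lborel) simp
    then show "AE u in lborel. (LINT y|lborel. indicator slab y * F (y + (u - y $ k) *\<^sub>R axis k 1)) =
      indicator {-1..1} u * (c * (sqrt (1 - u\<^sup>2) ^ (?n - 1) * cos (s * u)))"
      by eventually_elim (rule inner)
    show "(\<lambda>u. indicator {-1..1} u * (c * (sqrt (1 - u\<^sup>2) ^ (?n - 1) * cos (s * u)))) \<in> borel_measurable lborel"
      by measurable
    have "(\<lambda>p. indicator slab (snd p) * F (snd p + (fst p - snd p $ k) *\<^sub>R axis k 1)) \<in> borel_measurable (borel :: (real \<times> (real ^ 'n)) measure)"
    proof -
      have ind: "(\<lambda>y. indicator slab y :: real) \<in> borel_measurable borel"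
      proof -
        note [measurable] = borel_component
        have "slab = {y \<in> space borel. - (1/2) \<le> y $ k \<and> y $ k < 1/2}" by (auto simp: slab_def)
        also have "\<dots> \<in> sets borel" by measurable
        finally show ?thesis by simp
      qed
      show ?thesis
        by (intro borel_measurable_times measurable_compose[OF borel_measurable_continuous_onI ind]
          measurable_compose[OF borel_measurable_continuous_onI Fb] continuous_intros)
    qed
    then have "(\<lambda>(u, y). indicator slab y * F (y + (u - y $ k) *\<^sub>R axis k 1)) \<in> borel_measurable (lborel \<Otimes>\<^sub>M (lborel :: (real ^ 'n) measure))"
      by (simp add: lborel_prod case_prod_beta')
    then show "(\<lambda>u. LINT y|lborel. indicator slab y * F (y + (u - y $ k) *\<^sub>R axis k 1)) \<in> borel_measurable lborel"
      by (rule lborel.borel_measurable_lebesgue_integral)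
  qed
  also have "\<dots> = integral {-1..1} (\<lambda>u. c * (sqrt (1 - u\<^sup>2) ^ (?n - 1) * cos (s * u)))"
  proof -
    have "set_integrable lborel {-1..1} (\<lambda>u. c * (sqrt (1 - u\<^sup>2) ^ (?n - 1) * cos (s * u)))"
      by (rule borel_integrable_atLeastAtMost') (intro continuous_intros)
    from set_borel_integral_eq_integral(2)[OF this] show ?thesis
      unfolding set_lebesgue_integral_def real_scaleR_def .
  qed
  also have "\<dots> = 2 * c * integral {0..1} (\<lambda>u. sqrt (1 - u\<^sup>2) ^ (?n - 1) * cos (s * u))"
  proof -
    define G where "G u = sqrt (1 - u\<^sup>2) ^ (?n - 1) * cos (s * u)" for u
    have i: "G integrable_on {-1..1}"
      unfolding G_def by (intro integrable_continuous_real continuous_intros)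
    have "G (- u) = G u" for u by (simp add: G_def)
    then have "integral {-1..0} G = integral {0..1} G"
      using Henstock_Kurzweil_Integration.integral_reflect_real[of 1 0 G] by simp
    moreover have "integral {-1..0} G + integral {0..1} G = integral {-1..1} G"
      by (rule Henstock_Kurzweil_Integration.integral_combine) (use i in auto)
    ultimately have "integral {-1..1} G = 2 * integral {0..1} G" by simp
    then show ?thesis by (simp add: G_def[abs_def])
  qed
  finally show ?thesis by (simp add: c_def)
qed

text \<open>By rotation invariance the frequency may be taken along an axis. The power n - 1 of the
  square root is positive in dimension at least two, so the one-dimensional decay estimate
  applies.\<close>

lemma ball_fourier_decay:
  assumes "2 \<le> CARD('n::finite)" "0 < e"
  shows "\<exists>S>0. \<forall>v :: real ^ 'n. S \<le> norm v \<longrightarrow> norm v * \<bar>ball_fourier v\<bar> \<le> e"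
proof -
  obtain k :: 'n where True by simp
  define c where "c = measure lebesgue (full_slab k)"
  have c: "0 < c" unfolding c_def by (rule measure_slabs_pos)
  obtain S where S: "0 < S" "\<And>s. S \<le> s \<Longrightarrow> \<bar>s * integral {0..1} (\<lambda>u. sqrt (1 - u\<^sup>2) ^ (CARD('n) - 1) * cos (s * u))\<bar> \<le> e / (2 * c)"
    using oscillatory_semicircle_decay[of "CARD('n) - 1" "e / (2 * c)"] assms c by auto
  have "norm v * \<bar>ball_fourier v\<bar> \<le> e" if "S \<le> norm v" for v :: "real ^ 'n"
  proof -
    let ?J = "integral {0..1} (\<lambda>u. sqrt (1 - u\<^sup>2) ^ (CARD('n) - 1) * cos (norm v * u))"
    have "ball_fourier v = ball_fourier (norm v *\<^sub>R axis k 1 :: real ^ 'n)"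
      by (rule ball_fourier_rotate) simp
    also have "\<dots> = 2 * c * ?J" by (simp add: ball_fourier_axis c_def)
    finally have "norm v * \<bar>ball_fourier v\<bar> = 2 * c * \<bar>norm v * ?J\<bar>"
      using c by (simp add: abs_mult)
    also have "\<dots> \<le> 2 * c * (e / (2 * c))" using S(2)[OF that] c by (intro mult_left_mono) auto
    finally show ?thesis using c by simp
  qed
  then show ?thesis using S(1) by blast
qed

section \<open>The lattice point remainder\<close>

definition wave :: "int ^ 'n::finite \<Rightarrow> real ^ 'n \<Rightarrow> real" where
  "wave \<xi> x = cos (2 * pi * (real_vec \<xi> \<bullet> x))"

text \<open>Even trigonometric polynomials with integer frequencies. The inductive form carries no
  explicit coefficients: closure properties and the mean over ellipsoids are both obtained by
  induction over the three rules.\<close>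

inductive trig_poly :: "(real ^ 'n::finite \<Rightarrow> real) \<Rightarrow> bool" where
  wave: "trig_poly (wave \<xi>)"
| add: "trig_poly f \<Longrightarrow> trig_poly g \<Longrightarrow> trig_poly (\<lambda>x. f x + g x)"
| scale: "trig_poly f \<Longrightarrow> trig_poly (\<lambda>x. c * f x)"

lemma trig_poly_times_cos:
  assumes "trig_poly f"
  shows "trig_poly (\<lambda>x. f x * cos (2 * pi * x $ i))"
  using assms
proof induction
  case (wave \<xi>)
  define e where "e = (axis i 1 :: int ^ 'a)"
  have e: "real_vec e \<bullet> x = x $ i" for x
  proof -
    have "real_vec e = axis i 1" by (simp add: vec_eq_iff e_def axis_def)
    then show ?thesis by (simp add: inner_axis')
  qed
  have "real_vec (\<xi> + e) = real_vec \<xi> + real_vec e" "real_vec (\<xi> - e) = real_vec \<xi> - real_vec e"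
    by (simp_all add: vec_eq_iff)
  then have "wave \<xi> x * cos (2 * pi * x $ i) = (1/2) * wave (\<xi> + e) x + (1/2) * wave (\<xi> - e) x" for x
    by (simp add: wave_def inner_add_left inner_diff_left e distrib_left right_diff_distrib cos_add cos_diff)
  then show ?case by (simp only:) (intro trig_poly.intros)
next
  case (add f g)
  then show ?case by (simp only: distrib_right) (rule trig_poly.add)
next
  case (scale f c)
  then show ?case by (simp only: mult.assoc) (rule trig_poly.scale)
qed

text \<open>Each factor equals cos (pi x_i)^(2 M): it has period one, takes values in [0, 1] and
  reaches 1 exactly at the integers. For large M the mass sits near the lattice points. The kernel
  is not normalised; its mass on a unit cell is carried along as \<open>I\<close>.\<close>

definition bump_kernel :: "nat \<Rightarrow> real ^ 'n::finite \<Rightarrow> real" where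
  "bump_kernel M x = (\<Prod>i\<in>UNIV. ((1 + cos (2 * pi * x $ i)) / 2) ^ M)"

lemma trig_poly_bump_kernel: "trig_poly (bump_kernel M :: real ^ 'n::finite \<Rightarrow> real)"
proof -
  have step: "trig_poly (\<lambda>x. f x * ((1 + cos (2 * pi * x $ i)) / 2) ^ M)" if "trig_poly f"
    for f :: "real ^ 'n \<Rightarrow> real" and i
  proof (induction M)
    case 0
    then show ?case using that by simp
  next
    case (Suc M)
    define g where "g x = f x * ((1 + cos (2 * pi * x $ i)) / 2) ^ M" for x
    have "f x * ((1 + cos (2 * pi * x $ i)) / 2) ^ Suc M = (1/2) * g x + (1/2) * (g x * cos (2 * pi * x $ i))" for x
      by (simp add: g_def field_simps)
    moreover have "trig_poly (\<lambda>x. (1/2) * g x + (1/2) * (g x * cos (2 * pi * x $ i)))"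
      using Suc trig_poly_times_cos[OF Suc, of i] unfolding g_def by (intro trig_poly.add trig_poly.scale)
    ultimately show ?case by (simp only:)
  qed
  have "trig_poly (\<lambda>x. \<Prod>i\<in>I. ((1 + cos (2 * pi * x $ i)) / 2) ^ M)" if "finite I" for I :: "'n set"
    using that
  proof induction
    case empty
    have "wave (0 :: int ^ 'n) = (\<lambda>x. 1)" by (auto simp: wave_def real_vec_def inner_vec_def)
    then show ?case using trig_poly.wave[of "0 :: int ^ 'n"] by simp
  next
    case (insert i I)
    have "trig_poly (\<lambda>x. (\<Prod>i\<in>I. ((1 + cos (2 * pi * x $ i)) / 2) ^ M) * ((1 + cos (2 * pi * x $ i)) / 2) ^ M)"
      by (rule step[OF insert.IH])
    then show ?case using insert.hyps by (simp add: mult.commute)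
  qed
  then show ?thesis unfolding bump_kernel_def[abs_def] by simp
qed

lemma continuous_trig_poly: "trig_poly f \<Longrightarrow> continuous_on S f"
proof (induction rule: trig_poly.induct)
  case (wave \<xi>)
  show ?case unfolding wave_def[abs_def] by (intro continuous_intros)
qed (intro continuous_intros; simp)+

section \<open>Means of trigonometric polynomials over large ellipsoids\<close>

lemma ellipsoid_borel: "ellipsoid a t \<in> sets borel"
proof -
  have "(\<lambda>x. norm (scaled a x)) \<in> borel_measurable borel"
    by (intro borel_measurable_continuous_onI continuous_intros)
  then have "{x \<in> space borel. norm (scaled a x) \<le> t} \<in> sets borel"
    by (intro borel_measurable_le) auto
  then show ?thesis by (simp add: ellipsoid_def)
qed

definition ellipsoid_integral :: "(real ^ 'n::finite \<Rightarrow> real) \<Rightarrow> real ^ 'n \<Rightarrow> real \<Rightarrow> real" where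
  "ellipsoid_integral g a t = (LINT x|lborel. indicator (ellipsoid a t) x * g x)"

context positive_cuboid begin

lemma bounded_ellipsoid: "bounded (ellipsoid a t)"
proof (rule bounded_by_components)
  fix x i assume x: "x \<in> ellipsoid a t"
  have "\<bar>x $ i\<bar> \<le> a $ i * norm (scaled a x)" by (rule component_le_norm_scaled)
  also have "\<dots> \<le> a $ i * t" using x side_pos[of i] by (simp add: ellipsoid_def)
  finally show "\<bar>x $ i\<bar> \<le> a $ i * t" .
qed

lemma compact_ellipsoid: "compact (ellipsoid a t)"
proof -
  have "closed (ellipsoid a t)"
    unfolding ellipsoid_def by (intro closed_Collect_le continuous_intros)
  then show ?thesis using bounded_ellipsoid by (simp add: compact_eq_bounded_closed)
qed

lemma ellipsoid_integrable:
  fixes g :: "real ^ 'n \<Rightarrow> real"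
  assumes "continuous_on UNIV g"
  shows "integrable lborel (\<lambda>x. indicator (ellipsoid a t) x * g x)"
  using borel_integrable_compact[OF compact_ellipsoid continuous_on_subset[OF assms subset_UNIV]] by simp

lemma ellipsoid_integral_cos:
  assumes t: "0 < t"
  shows "ellipsoid_integral (\<lambda>x. cos (v \<bullet> x)) a t = t ^ CARD('n) * (\<Prod>i\<in>UNIV. a $ i) * ball_fourier (\<chi> i. t * a $ i * v $ i)"
proof -
  define c where "c b = t * (a \<bullet> b)" for b :: "real ^ 'n"
  define T where "T x = 0 + (\<Sum>b\<in>Basis. (c b * (x \<bullet> b)) *\<^sub>R b)" for x :: "real ^ 'n"
  have B: "Basis = range (\<lambda>j. axis j 1 :: real ^ 'n)" by (auto simp: Basis_vec_def)
  have inj: "inj (\<lambda>j. axis j 1 :: real ^ 'n)" by (auto simp: inj_on_def axis_eq_axis)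
  have ct: "c (axis j 1) * (x \<bullet> axis j 1) = t * a $ j * x $ j" for x j
    by (simp add: c_def inner_axis)
  have Ti: "T x $ i = t * a $ i * x $ i" for x i
    unfolding T_def B sum.reindex[OF inj] o_def ct by (simp add: axis_def if_distrib cong: if_cong)
  have c: "c b \<noteq> 0" if "b \<in> Basis" for b
    using that t side_pos by (auto simp: B c_def inner_axis less_imp_neq[THEN not_sym])
  have prodc: "(\<Prod>b\<in>Basis. \<bar>c b\<bar>) = t ^ CARD('n) * (\<Prod>i\<in>UNIV. a $ i)"
    unfolding B prod.reindex[OF inj] using t side_pos
    by (simp add: c_def inner_axis abs_mult prod.distrib abs_of_pos)
  have measT: "T \<in> lborel \<rightarrow>\<^sub>M borel" by (simp add: T_def[abs_def])
  let ?f = "\<lambda>x. indicator (ellipsoid a t) x * cos (v \<bullet> x)"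
  have f: "?f \<in> borel_measurable borel"
  proof -
    have "(\<lambda>x. cos (v \<bullet> x)) \<in> borel_measurable borel" by (intro borel_measurable_continuous_onI continuous_intros)
    moreover have "(indicator (ellipsoid a t) :: _ \<Rightarrow> real) \<in> borel_measurable borel"
      by (intro borel_measurable_indicator ellipsoid_borel)
    ultimately show ?thesis by (intro borel_measurable_times)
  qed
  have "scaled a (T x) = t *\<^sub>R x" for x using side_pos by (simp add: vec_eq_iff Ti less_imp_neq[THEN not_sym])
  then have ind: "indicator (ellipsoid a t) (T x) = (indicator (cball 0 1) x :: real)" for x
    using t by (auto simp: indicator_def ellipsoid_def)
  have vT: "v \<bullet> T x = (\<chi> i. t * a $ i * v $ i) \<bullet> x" for x by (simp add: inner_vec_def Ti mult_ac)
  have "ellipsoid_integral (\<lambda>x. cos (v \<bullet> x)) a t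
     = (LINT x|density (distr lborel borel T) (\<lambda>_. (\<Prod>j\<in>Basis. \<bar>c j\<bar>)). ?f x)"
    unfolding ellipsoid_integral_def T_def[abs_def] using lborel_affine_euclidean[of c 0, OF c] by simp
  also have "\<dots> = (LINT x|distr lborel borel T. (\<Prod>j\<in>Basis. \<bar>c j\<bar>) *\<^sub>R ?f x)"
    by (rule integral_density) (use f in \<open>auto intro!: AE_I2 prod_nonneg\<close>)
  also have "\<dots> = (LINT x|lborel. (\<Prod>j\<in>Basis. \<bar>c j\<bar>) *\<^sub>R ?f (T x))"
    by (rule integral_distr[OF measT]) (use f in simp)
  also have "\<dots> = (\<Prod>j\<in>Basis. \<bar>c j\<bar>) * (LINT x|lborel. ?f (T x))" by simp
  finally show ?thesis by (simp add: prodc ind vT ball_fourier_def)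
qed

lemma ellipsoid_integral_one: "ellipsoid_integral (\<lambda>x. 1) a t = measure lebesgue (ellipsoid a t)"
  using ellipsoid_borel[of a t] by (simp add: ellipsoid_integral_def)

end

text \<open>The constant wave gives the volume. A nonconstant one integrates to t^n times the
  product of the sides times the transform of the ball at a frequency of length at least \<alpha> t,
  which is o(t^(n-1)). The mean m is chosen before \<alpha>, \<beta> and e, so it can be identified
  with the help of the unit cube alone.\<close>

lemma trig_poly_ellipsoid_mean:
  fixes g :: "real ^ 'n::finite \<Rightarrow> real"
  assumes n: "2 \<le> CARD('n)" and "trig_poly g"
  shows "\<exists>m. \<forall>\<alpha> \<beta> e. 0 < \<alpha> \<longrightarrow> 0 < e \<longrightarrow> (\<exists>t0. \<forall>t\<ge>t0. \<forall>a. (\<forall>i. \<alpha> \<le> a $ i \<and> a $ i \<le> \<beta>) \<longrightarrow>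
     \<bar>ellipsoid_integral g a t - m * measure lebesgue (ellipsoid a t)\<bar> \<le> e * t ^ (CARD('n) - 1))"
  using assms(2)
proof induction
  case (wave \<xi>)
  let ?n = "CARD('n)"
  show ?case
  proof (cases "\<xi> = 0")
    case True
    then have w: "wave \<xi> = (\<lambda>x. 1)" by (auto simp: wave_def real_vec_def inner_vec_def)
    show ?thesis
    proof (rule exI[of _ 1], intro allI impI)
      fix \<alpha> \<beta> e :: real assume "0 < \<alpha>" "0 < e"
      show "\<exists>t0. \<forall>t\<ge>t0. \<forall>a. (\<forall>i. \<alpha> \<le> a $ i \<and> a $ i \<le> \<beta>) \<longrightarrow>
          \<bar>ellipsoid_integral (wave \<xi>) a t - 1 * measure lebesgue (ellipsoid a t)\<bar> \<le> e * t ^ (?n - 1)"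
      proof (rule exI[of _ 0], intro allI impI)
        fix t :: real and a :: "real ^ 'n" assume "0 \<le> t" "\<forall>i. \<alpha> \<le> a $ i \<and> a $ i \<le> \<beta>"
        then interpret positive_cuboid a using \<open>0 < \<alpha>\<close> by unfold_locales (auto intro: less_le_trans)
        show "\<bar>ellipsoid_integral (wave \<xi>) a t - 1 * measure lebesgue (ellipsoid a t)\<bar> \<le> e * t ^ (?n - 1)"
          using \<open>0 \<le> t\<close> \<open>0 < e\<close> unfolding w ellipsoid_integral_one by simp
      qed
    qed
  next
    case False
    then obtain i where i: "\<xi> $ i \<noteq> 0" by (auto simp: vec_eq_iff)
    define v where "v = (2 * pi) *\<^sub>R real_vec \<xi>"
    have w: "wave \<xi> = (\<lambda>x. cos (v \<bullet> x))" by (auto simp: wave_def v_def)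
    have vi: "1 \<le> \<bar>v $ i\<bar>"
    proof -
      have "1 \<le> \<bar>real_of_int (\<xi> $ i)\<bar>" using i by linarith
      then have "1 * 1 \<le> (2 * pi) * \<bar>real_of_int (\<xi> $ i)\<bar>" using pi_ge_two by (intro mult_mono) auto
      then show ?thesis by (simp add: v_def abs_mult)
    qed
    show ?thesis
    proof (rule exI[of _ 0], intro allI impI)
      fix \<alpha> \<beta> e :: real assume \<alpha>: "0 < \<alpha>" and e: "0 < e"
      define b where "b = max 1 \<beta>"
      have b: "1 \<le> b" "0 < b" by (auto simp: b_def)
      \<comment> \<open>Balances the bound b^n for the product of the sides against the length at
        least \<alpha> t of the scaled frequency.\<close>
      define e' where "e' = e * \<alpha> / b ^ ?n"
      have e': "0 < e'" using e \<alpha> b by (simp add: e'_def)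
      obtain S where S: "0 < S" "\<And>w :: real ^ 'n. S \<le> norm w \<Longrightarrow> norm w * \<bar>ball_fourier w\<bar> \<le> e'"
        using ball_fourier_decay[OF n e'] by blast
      show "\<exists>t0. \<forall>t\<ge>t0. \<forall>a. (\<forall>i. \<alpha> \<le> a $ i \<and> a $ i \<le> \<beta>) \<longrightarrow>
          \<bar>ellipsoid_integral (wave \<xi>) a t - 0 * measure lebesgue (ellipsoid a t)\<bar> \<le> e * t ^ (?n - 1)"
      proof (rule exI[of _ "S / \<alpha>"], intro allI impI)
        fix t :: real and a :: "real ^ 'n" assume t: "S / \<alpha> \<le> t" and a: "\<forall>i. \<alpha> \<le> a $ i \<and> a $ i \<le> \<beta>"
        then interpret positive_cuboid a using \<open>0 < \<alpha>\<close> by unfold_locales (auto intro: less_le_trans)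
        have t0: "0 < t" using t S(1) \<alpha> by (meson divide_pos_pos less_le_trans)
        define w where "w = (\<chi> i. t * a $ i * v $ i)"
        have "t * \<alpha> * 1 \<le> t * a $ i * \<bar>v $ i\<bar>"
          using t0 \<alpha> a vi less_imp_le[OF side_pos[of i]] by (intro mult_mono) auto
        also have "\<dots> = \<bar>w $ i\<bar>" using t0 side_pos[of i] by (simp add: w_def abs_mult)
        also have "\<dots> \<le> norm w" by (rule component_le_norm_cart)
        finally have w1: "t * \<alpha> \<le> norm w" by simp
        have "S \<le> t * \<alpha>" using t \<alpha> by (simp add: field_simps)
        then have "norm w * \<bar>ball_fourier w\<bar> \<le> e'" using w1 by (intro S(2)) simp
        then have "t * \<alpha> * \<bar>ball_fourier w\<bar> \<le> e'" using w1 by (smt (verit) mult_right_mono abs_ge_zero)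
        then have bf: "\<bar>ball_fourier w\<bar> \<le> e' / (t * \<alpha>)" using t0 \<alpha> by (simp add: field_simps)
        have P: "(\<Prod>i\<in>UNIV. a $ i) \<le> b ^ ?n"
        proof -
          have "(\<Prod>i\<in>UNIV. a $ i) \<le> (\<Prod>i\<in>(UNIV :: 'n set). b)"
            using a side_pos by (intro prod_mono) (auto simp: b_def intro: less_imp_le max.coboundedI2)
          then show ?thesis by simp
        qed
        have P0: "0 \<le> (\<Prod>i\<in>UNIV. a $ i)" using side_pos by (intro prod_nonneg) (auto intro: less_imp_le)
        have "\<bar>ellipsoid_integral (wave \<xi>) a t - 0 * measure lebesgue (ellipsoid a t)\<bar> = t ^ ?n * (\<Prod>i\<in>UNIV. a $ i) * \<bar>ball_fourier w\<bar>"
          unfolding \<open>wave \<xi> = (\<lambda>x. cos (v \<bullet> x))\<close> ellipsoid_integral_cos[OF t0] w_def[symmetric] using t0 P0 by (simp add: abs_mult)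
        also have "\<dots> \<le> t ^ ?n * b ^ ?n * (e' / (t * \<alpha>))"
          using P bf t0 P0 by (intro mult_mono mult_left_mono mult_nonneg_nonneg) auto
        also have "\<dots> = e * t ^ (?n - 1)"
        proof -
          have "t ^ ?n = t * t ^ (?n - 1)" using n by (cases ?n) auto
          then show ?thesis using t0 \<alpha> b by (simp add: e'_def)
        qed
        finally show "\<bar>ellipsoid_integral (wave \<xi>) a t - 0 * measure lebesgue (ellipsoid a t)\<bar> \<le> e * t ^ (?n - 1)" .
      qed
    qed
  qed
next
  case (add f g)
  let ?n = "CARD('n)"
  from add.IH obtain m1 m2 where
    m1: "\<And>\<alpha> \<beta> e. 0 < \<alpha> \<Longrightarrow> 0 < e \<Longrightarrow> \<exists>t0. \<forall>t\<ge>t0. \<forall>a. (\<forall>i. \<alpha> \<le> a $ i \<and> a $ i \<le> \<beta>) \<longrightarrow>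
     \<bar>ellipsoid_integral f a t - m1 * measure lebesgue (ellipsoid a t)\<bar> \<le> e * t ^ (?n - 1)" and
    m2: "\<And>\<alpha> \<beta> e. 0 < \<alpha> \<Longrightarrow> 0 < e \<Longrightarrow> \<exists>t0. \<forall>t\<ge>t0. \<forall>a. (\<forall>i. \<alpha> \<le> a $ i \<and> a $ i \<le> \<beta>) \<longrightarrow>
     \<bar>ellipsoid_integral g a t - m2 * measure lebesgue (ellipsoid a t)\<bar> \<le> e * t ^ (?n - 1)" by blast
  show ?case
  proof (rule exI[of _ "m1 + m2"], intro allI impI)
    fix \<alpha> \<beta> e :: real assume \<alpha>: "0 < \<alpha>" and e: "0 < e"
    obtain t1 where t1: "\<forall>t\<ge>t1. \<forall>a. (\<forall>i. \<alpha> \<le> a $ i \<and> a $ i \<le> \<beta>) \<longrightarrow>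
     \<bar>ellipsoid_integral f a t - m1 * measure lebesgue (ellipsoid a t)\<bar> \<le> e / 2 * t ^ (?n - 1)"
      using m1[OF \<alpha>, of "e / 2" \<beta>] e by auto
    obtain t2 where t2: "\<forall>t\<ge>t2. \<forall>a. (\<forall>i. \<alpha> \<le> a $ i \<and> a $ i \<le> \<beta>) \<longrightarrow>
     \<bar>ellipsoid_integral g a t - m2 * measure lebesgue (ellipsoid a t)\<bar> \<le> e / 2 * t ^ (?n - 1)"
      using m2[OF \<alpha>, of "e / 2" \<beta>] e by auto
    show "\<exists>t0. \<forall>t\<ge>t0. \<forall>a. (\<forall>i. \<alpha> \<le> a $ i \<and> a $ i \<le> \<beta>) \<longrightarrow>
       \<bar>ellipsoid_integral (\<lambda>x. f x + g x) a t - (m1 + m2) * measure lebesgue (ellipsoid a t)\<bar> \<le> e * t ^ (?n - 1)"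
    proof (rule exI[of _ "max t1 t2"], intro allI impI)
      fix t :: real and a :: "real ^ 'n" assume t: "max t1 t2 \<le> t" and a: "\<forall>i. \<alpha> \<le> a $ i \<and> a $ i \<le> \<beta>"
      then interpret positive_cuboid a using \<open>0 < \<alpha>\<close> by unfold_locales (auto intro: less_le_trans)
      have "ellipsoid_integral (\<lambda>x. f x + g x) a t = ellipsoid_integral f a t + ellipsoid_integral g a t"
        unfolding ellipsoid_integral_def distrib_left
        by (rule Bochner_Integration.integral_add) (intro ellipsoid_integrable continuous_trig_poly add.hyps)+
      moreover have "\<bar>ellipsoid_integral f a t - m1 * measure lebesgue (ellipsoid a t)\<bar> \<le> e / 2 * t ^ (?n - 1)"
        "\<bar>ellipsoid_integral g a t - m2 * measure lebesgue (ellipsoid a t)\<bar> \<le> e / 2 * t ^ (?n - 1)"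
        using t1 t2 t a by auto
      ultimately show "\<bar>ellipsoid_integral (\<lambda>x. f x + g x) a t - (m1 + m2) * measure lebesgue (ellipsoid a t)\<bar> \<le> e * t ^ (?n - 1)"
        unfolding distrib_right by linarith
    qed
  qed
next
  case (scale f c)
  let ?n = "CARD('n)"
  from scale.IH obtain m where
    m: "\<And>\<alpha> \<beta> e. 0 < \<alpha> \<Longrightarrow> 0 < e \<Longrightarrow> \<exists>t0. \<forall>t\<ge>t0. \<forall>a. (\<forall>i. \<alpha> \<le> a $ i \<and> a $ i \<le> \<beta>) \<longrightarrow>
     \<bar>ellipsoid_integral f a t - m * measure lebesgue (ellipsoid a t)\<bar> \<le> e * t ^ (?n - 1)" by blast
  show ?case
  proof (rule exI[of _ "c * m"], intro allI impI)
    fix \<alpha> \<beta> e :: real assume \<alpha>: "0 < \<alpha>" and e: "0 < e"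
    obtain t0 where t0: "\<forall>t\<ge>t0. \<forall>a. (\<forall>i. \<alpha> \<le> a $ i \<and> a $ i \<le> \<beta>) \<longrightarrow>
     \<bar>ellipsoid_integral f a t - m * measure lebesgue (ellipsoid a t)\<bar> \<le> e / (1 + \<bar>c\<bar>) * t ^ (?n - 1)"
      using m[OF \<alpha>, of "e / (1 + \<bar>c\<bar>)" \<beta>] e by auto
    show "\<exists>t0. \<forall>t\<ge>t0. \<forall>a. (\<forall>i. \<alpha> \<le> a $ i \<and> a $ i \<le> \<beta>) \<longrightarrow>
       \<bar>ellipsoid_integral (\<lambda>x. c * f x) a t - (c * m) * measure lebesgue (ellipsoid a t)\<bar> \<le> e * t ^ (?n - 1)"
    proof (rule exI[of _ "max 0 t0"], intro allI impI)
      fix t :: real and a :: "real ^ 'n" assume t: "max 0 t0 \<le> t" and a: "\<forall>i. \<alpha> \<le> a $ i \<and> a $ i \<le> \<beta>"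
      have "ellipsoid_integral (\<lambda>x. c * f x) a t = c * ellipsoid_integral f a t"
        unfolding ellipsoid_integral_def by (simp add: mult.left_commute)
      then have "\<bar>ellipsoid_integral (\<lambda>x. c * f x) a t - (c * m) * measure lebesgue (ellipsoid a t)\<bar>
        = \<bar>c\<bar> * \<bar>ellipsoid_integral f a t - m * measure lebesgue (ellipsoid a t)\<bar>"
        by (simp add: abs_mult[symmetric] right_diff_distrib mult.assoc)
      also have "\<dots> \<le> (1 + \<bar>c\<bar>) * (e / (1 + \<bar>c\<bar>) * t ^ (?n - 1))"
        using t0 t a e by (intro mult_mono) auto
      also have "\<dots> = e * t ^ (?n - 1)" by (simp add: add_nonneg_eq_0_iff)
      finally show "\<bar>ellipsoid_integral (\<lambda>x. c * f x) a t - (c * m) * measure lebesgue (ellipsoid a t)\<bar> \<le> e * t ^ (?n - 1)" .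
    qed
  qed
qed

section \<open>Concentration of the kernel at the lattice points\<close>

lemma half_one_plus_cos: "0 \<le> (1 + cos y) / 2" "(1 + cos y) / 2 \<le> 1" for y :: real
proof -
  obtain c where c: "c = cos y" by simp
  have "- 1 \<le> c" "c \<le> 1" unfolding c by simp_all
  then show "0 \<le> (1 + cos y) / 2" "(1 + cos y) / 2 \<le> 1" unfolding c[symmetric] by simp_all
qed

lemma bump_kernel_bounds: "0 \<le> bump_kernel M x" "bump_kernel M x \<le> 1"
proof -
  have f: "0 \<le> ((1 + cos (2 * pi * x $ i)) / 2) ^ M" "((1 + cos (2 * pi * x $ i)) / 2) ^ M \<le> 1" for i
  proof -
    have "0 \<le> (1 + cos (2 * pi * x $ i)) / 2" "(1 + cos (2 * pi * x $ i)) / 2 \<le> 1"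
      by (rule half_one_plus_cos)+
    then show "0 \<le> ((1 + cos (2 * pi * x $ i)) / 2) ^ M" "((1 + cos (2 * pi * x $ i)) / 2) ^ M \<le> 1"
      by (auto intro: power_le_one)
  qed
  show "0 \<le> bump_kernel M x" unfolding bump_kernel_def using f by (intro prod_nonneg) auto
  show "bump_kernel M x \<le> 1" unfolding bump_kernel_def using f by (intro prod_le_1) auto
qed

lemma continuous_bump_kernel: "continuous_on S (bump_kernel M)"
  by (rule continuous_trig_poly[OF trig_poly_bump_kernel])

lemma bump_kernel_borel: "bump_kernel M \<in> borel_measurable borel"
  by (intro borel_measurable_continuous_onI continuous_bump_kernel)

lemma bump_kernel_periodic: "bump_kernel M (real_vec z + x) = bump_kernel M x"
proof -
  have "cos (2 * pi * (real_vec z + x) $ i) = cos (2 * pi * x $ i)" for i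
  proof -
    have "cos (2 * pi * x $ i + 2 * pi * of_int (z $ i)) = cos (2 * pi * x $ i)"
      using cos.plus_of_int[of "2 * pi * x $ i" "z $ i"] by (simp add: mult.commute)
    then show ?thesis by (simp add: distrib_left add.commute)
  qed
  then show ?thesis by (simp add: bump_kernel_def)
qed

text \<open>Reading the kernel as a density makes additivity over cells available. The measure is
  invariant under integer translations, so each centred unit cell has the same mass.\<close>

definition kernel_measure :: "nat \<Rightarrow> (real ^ 'n::finite) measure" where
  "kernel_measure M = density lborel (\<lambda>x. ennreal (bump_kernel M x))"

lemma sets_kernel_measure [simp]: "sets (kernel_measure M) = sets borel"
  by (simp add: kernel_measure_def)

lemma kernel_measure_integrable:
  assumes "bounded S" "S \<in> sets borel"
  shows "integrable lborel (\<lambda>x. indicator S x * bump_kernel M x)"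
proof -
  obtain R where R: "\<And>x. x \<in> S \<Longrightarrow> norm x \<le> R" using assms(1) by (auto simp: bounded_iff)
  show ?thesis
  proof (rule integrable_bounded_support[where B = 1 and R = R])
    show "(\<lambda>x. indicator S x * bump_kernel M x) \<in> borel_measurable borel"
      using assms(2) bump_kernel_borel by (intro borel_measurable_times borel_measurable_indicator)
    show "\<bar>indicator S x * bump_kernel M x\<bar> \<le> 1" for x
      using bump_kernel_bounds[of M x] by (auto simp: indicator_def)
    show "indicator S x * bump_kernel M x = 0" if "R < norm x" for x
      using R[of x] that by (auto simp: indicator_def)
  qed
qed

lemma kernel_measure_bounded:
  assumes "bounded S" "S \<in> sets borel"
  shows "S \<in> fmeasurable (kernel_measure M)"
    and "measure (kernel_measure M) S = (LINT x|lborel. indicator S x * bump_kernel M x)"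
proof -
  have m: "(\<lambda>x. ennreal (bump_kernel M x)) \<in> borel_measurable lborel"
    using bump_kernel_borel[of M] by measurable
  have "emeasure (kernel_measure M) S = (\<integral>\<^sup>+x. ennreal (bump_kernel M x) * indicator S x \<partial>lborel)"
    unfolding kernel_measure_def using assms(2) by (intro emeasure_density m) simp
  also have "\<dots> = (\<integral>\<^sup>+x. ennreal (indicator S x * bump_kernel M x) \<partial>lborel)"
    by (intro nn_integral_cong) (auto simp: indicator_def)
  also have "\<dots> = ennreal (LINT x|lborel. indicator S x * bump_kernel M x)"
    by (rule nn_integral_eq_integral[OF kernel_measure_integrable[OF assms]])
      (auto intro!: AE_I2 simp: bump_kernel_bounds)
  finally have e: "emeasure (kernel_measure M) S = ennreal (LINT x|lborel. indicator S x * bump_kernel M x)" .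
  then show "S \<in> fmeasurable (kernel_measure M)" using assms(2) by (intro fmeasurableI) auto
  have "0 \<le> (LINT x|lborel. indicator S x * bump_kernel M x)"
    by (rule Bochner_Integration.integral_nonneg) (simp add: bump_kernel_bounds)
  then show "measure (kernel_measure M) S = (LINT x|lborel. indicator S x * bump_kernel M x)"
    using e by (simp add: measure_def)
qed

definition core_cell :: "real \<Rightarrow> int ^ 'n::finite \<Rightarrow> (real ^ 'n) set" where
  "core_cell \<delta> z = {x. \<forall>i. \<bar>x $ i - z $ i\<bar> \<le> \<delta>}"

lemma core_cell_borel: "core_cell \<delta> z \<in> sets borel"
proof -
  note [measurable] = borel_component
  have "core_cell \<delta> z = {x \<in> space borel. \<forall>i\<in>UNIV. \<bar>x $ i - z $ i\<bar> \<le> \<delta>}" by (auto simp: core_cell_def)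
  also have "\<dots> \<in> sets borel" by measurable
  finally show ?thesis .
qed

lemma kernel_measure_translate:
  assumes "bounded S" "S \<in> sets borel" "bounded S'" "S' \<in> sets borel" "\<And>x. real_vec z + x \<in> S \<longleftrightarrow> x \<in> S'"
  shows "measure (kernel_measure M) S = measure (kernel_measure M) S'"
proof -
  have "(\<lambda>x. indicator S x * bump_kernel M x) \<in> borel_measurable borel"
    using assms(2) bump_kernel_borel by (intro borel_measurable_times borel_measurable_indicator)
  from lborel_integral_translate[OF this, of "real_vec z"]
  have "(LINT x|lborel. indicator S (real_vec z + x) * bump_kernel M x) = (LINT x|lborel. indicator S x * bump_kernel M x)"
    by (simp add: bump_kernel_periodic)
  moreover have "indicator S (real_vec z + x) = (indicator S' x :: real)" for x
    using assms(5) by (simp add: indicator_def)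
  ultimately show ?thesis using kernel_measure_bounded(2)[OF assms(1,2)] kernel_measure_bounded(2)[OF assms(3,4)] by simp
qed

lemma kernel_measure_cell:
  "measure (kernel_measure M) (unit_cell (1/2) z) = measure (kernel_measure M) (unit_cell (1/2) (0 :: int ^ 'n))" for z :: "int ^ 'n::finite"
  by (rule kernel_measure_translate[where z = z]) (auto simp: bounded_cell unit_cell_borel unit_cell_iff)

lemma kernel_measure_off_core:
  "measure (kernel_measure M) (unit_cell (1/2) z - core_cell \<delta> z) = measure (kernel_measure M) (unit_cell (1/2) (0 :: int ^ 'n) - core_cell \<delta> 0)" for z :: "int ^ 'n::finite"
  by (rule kernel_measure_translate[where z = z])
    (auto simp: bounded_cell unit_cell_borel core_cell_borel bounded_diff unit_cell_iff core_cell_def)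

text \<open>Off the core some factor is at most q^M with q = h \<delta> < 1. On a small cube of
  half-width \<rho> the kernel is at least r^M with r = (h \<rho>)^n, and continuity of h at 0
  allows r > q. So (q / r)^M tends to zero and eventually beats the fixed volume (2 \<rho>)^n of the
  small cube.\<close>

lemma kernel_concentration:
  assumes "0 < \<delta>" "\<delta> < 1/2" "0 < \<epsilon>"
  shows "\<exists>M. 0 < measure (kernel_measure M) (unit_cell (1/2) (0 :: int ^ 'n::finite)) \<and>
    measure (kernel_measure M) (unit_cell (1/2) (0 :: int ^ 'n) - core_cell \<delta> 0)
      \<le> \<epsilon> * measure (kernel_measure M) (unit_cell (1/2) (0 :: int ^ 'n))"
proof -
  let ?n = "CARD('n)" and ?Q = "unit_cell (1/2) (0 :: int ^ 'n)"
  define h where "h y = (1 + cos (2 * pi * y)) / 2" for y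
  have h0: "0 \<le> h y" "h y \<le> 1" for y
    unfolding h_def by (rule half_one_plus_cos)+
  have hmono: "h y \<le> h x" if "\<bar>x\<bar> \<le> \<bar>y\<bar>" "\<bar>y\<bar> \<le> 1/2" for x y
  proof -
    have "cos (2 * pi * \<bar>y\<bar>) \<le> cos (2 * pi * \<bar>x\<bar>)"
      by (rule cos_monotone_0_pi_le) (use that in \<open>auto intro!: mult_left_mono\<close>)
    moreover have "cos (2 * pi * \<bar>u\<bar>) = cos (2 * pi * u)" for u by (cases "0 \<le> u") auto
    ultimately show ?thesis by (simp add: h_def)
  qed
  define q where "q = h \<delta>"
  have q: "0 \<le> q" "q < 1"
  proof -
    show "0 \<le> q" using h0 by (simp add: q_def)
    have "cos (2 * pi * \<delta>) < cos 0" by (rule cos_monotone_0_pi) (use assms in auto)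
    then show "q < 1" by (simp add: q_def h_def)
  qed
  have "isCont (\<lambda>y. h y ^ ?n) 0" unfolding h_def by (intro continuous_intros) simp
  moreover have "h 0 ^ ?n = 1" by (simp add: h_def)
  ultimately have "((\<lambda>y. h y ^ ?n) \<longlongrightarrow> 1) (at_right 0)"
    by (auto simp: isCont_def intro: tendsto_within_subset)
  then have "\<forall>\<^sub>F y in at_right 0. q < h y ^ ?n" using q by (intro order_tendstoD(1)) auto
  moreover have "\<forall>\<^sub>F y in at_right (0::real). y \<in> {0<..<1/2}" by (rule eventually_at_right_real) simp
  ultimately have "\<forall>\<^sub>F y in at_right (0::real). q < h y ^ ?n \<and> y \<in> {0<..<1/2}" by eventually_elim auto
  then obtain \<rho> where \<rho>: "q < h \<rho> ^ ?n" "0 < \<rho>" "\<rho> < 1/2"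
    using eventually_happens[of _ "at_right (0::real)"] by (auto simp: trivial_limit_at_right_real)
  define r where "r = h \<rho> ^ ?n"
  have r: "0 < r" using q \<rho> by (simp add: r_def)
  have "\<exists>M. (q / r) ^ M < \<epsilon> * (2 * \<rho>) ^ ?n"
    by (rule real_arch_pow_inv) (use assms \<rho> r in \<open>auto simp: r_def\<close>)
  then obtain M where M: "(q / r) ^ M < \<epsilon> * (2 * \<rho>) ^ ?n" by blast
  have T: "bump_kernel M x = (\<Prod>i\<in>UNIV. h (x $ i) ^ M)" for x :: "real ^ 'n" by (simp add: bump_kernel_def h_def)
  have lo: "r ^ M * (2 * \<rho>) ^ ?n \<le> measure (kernel_measure M) ?Q"
  proof -
    let ?B = "cbox (\<chi> i. - \<rho>) (\<chi> i. \<rho>) :: (real ^ 'n) set"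
    have "?B \<noteq> {}" using \<rho> by (auto simp: cbox_cart intro!: exI[of _ 0])
    then have vB: "measure lborel ?B = (2 * \<rho>) ^ ?n" by (simp add: content_cbox_cart)
    have "r ^ M * (2 * \<rho>) ^ ?n = (LINT x|lborel. indicator ?B x * r ^ M)"
      by (simp add: vB)
    also have "\<dots> \<le> (LINT x|lborel. indicator ?Q x * bump_kernel M x)"
    proof (rule integral_mono)
      show "integrable lborel (\<lambda>x. indicator ?B x * r ^ M)"
        using emeasure_bounded_finite[OF bounded_cbox]
        by (intro integrable_mult_left integrable_real_indicator) auto
      show "integrable lborel (\<lambda>x. indicator ?Q x * bump_kernel M x)"
        by (intro kernel_measure_integrable bounded_cell unit_cell_borel)
      fix x :: "real ^ 'n"
      show "indicator ?B x * r ^ M \<le> indicator ?Q x * bump_kernel M x"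
      proof (cases "x \<in> ?B")
        case True
        then have xi: "\<bar>x $ i\<bar> \<le> \<rho>" for i by (auto simp: mem_box_cart abs_le_iff minus_le_iff)
        have "x \<in> ?Q"
          unfolding unit_cell_iff
        proof
          fix i show "real_of_int ((0 :: int ^ 'n) $ i) - 1/2 \<le> x $ i \<and> x $ i < real_of_int ((0 :: int ^ 'n) $ i) - 1/2 + 1"
            using xi[of i] \<rho>(3) unfolding abs_le_iff zero_index of_int_0 by linarith
        qed
        moreover have "r ^ M \<le> bump_kernel M x"
        proof -
          have "h \<rho> \<le> h (x $ i)" for i using xi[of i] \<rho> by (intro hmono) auto
          then have "(\<Prod>i\<in>(UNIV :: 'n set). h \<rho> ^ M) \<le> (\<Prod>i\<in>UNIV. h (x $ i) ^ M)"
            using h0 by (intro prod_mono) (auto intro: power_mono)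
          then show ?thesis by (simp add: T r_def power_mult[symmetric] mult.commute)
        qed
        ultimately show ?thesis using True by simp
      qed (simp add: bump_kernel_bounds)
    qed
    also have "\<dots> = measure (kernel_measure M) ?Q"
      by (rule kernel_measure_bounded(2)[symmetric]) (simp_all add: bounded_cell unit_cell_borel)
    finally show ?thesis .
  qed
  have up: "measure (kernel_measure M) (?Q - core_cell \<delta> 0) \<le> q ^ M"
  proof -
    have "measure (kernel_measure M) (?Q - core_cell \<delta> 0) = (LINT x|lborel. indicator (?Q - core_cell \<delta> 0) x * bump_kernel M x)"
      by (rule kernel_measure_bounded(2)) (auto simp: bounded_cell unit_cell_borel core_cell_borel bounded_diff)
    also have "\<dots> \<le> (LINT x|lborel. indicator ?Q x * q ^ M)"
    proof (rule integral_mono)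
      show "integrable lborel (\<lambda>x. indicator (?Q - core_cell \<delta> 0) x * bump_kernel M x)"
        by (intro kernel_measure_integrable) (auto simp: bounded_cell unit_cell_borel core_cell_borel bounded_diff)
      show "integrable lborel (\<lambda>x. indicator ?Q x * q ^ M)"
        using emeasure_bounded_finite[OF bounded_cell] unit_cell_borel
        by (intro integrable_mult_left integrable_real_indicator) auto
      fix x :: "real ^ 'n"
      show "indicator (?Q - core_cell \<delta> 0) x * bump_kernel M x \<le> indicator ?Q x * q ^ M"
      proof (cases "x \<in> ?Q - core_cell \<delta> 0")
        case True
        then obtain i where i: "\<delta> < \<bar>x $ i\<bar>" by (auto simp: core_cell_def not_le)
        have "- (1/2) \<le> x $ i \<and> x $ i < 1/2" using True by (simp add: unit_cell_iff)
        then have xi: "\<bar>x $ i\<bar> \<le> 1/2" by linarith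
        have "bump_kernel M x = h (x $ i) ^ M * (\<Prod>j\<in>UNIV - {i}. h (x $ j) ^ M)"
          unfolding T by (rule prod.remove) auto
        also have "\<dots> \<le> h (x $ i) ^ M * 1"
          using h0 by (intro mult_left_mono prod_le_1) (auto intro: power_le_one)
        also have "\<dots> \<le> q ^ M * 1"
          using hmono[of \<delta> "x $ i"] i xi assms(1) h0 by (auto simp: q_def intro: power_mono)
        finally show ?thesis using True by simp
      qed (use q in simp)
    qed
    also have "\<dots> = measure lborel ?Q * q ^ M" by simp
    also have "measure lborel ?Q = 1" using measure_cell[of "1/2" "0 :: int ^ 'n"] measure_completion[of ?Q lborel] unit_cell_borel[of "1/2" "0 :: int ^ 'n"] by auto
    finally show ?thesis by simp
  qed
  have "q ^ M \<le> \<epsilon> * (r ^ M * (2 * \<rho>) ^ ?n)"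
    using M r by (simp add: power_divide field_simps)
  also have "\<dots> \<le> \<epsilon> * measure (kernel_measure M) ?Q" using lo assms(3) by (intro mult_left_mono) auto
  finally have "measure (kernel_measure M) (?Q - core_cell \<delta> 0) \<le> \<epsilon> * measure (kernel_measure M) ?Q" using up by linarith
  moreover have "0 < measure (kernel_measure M) ?Q"
    using lo r \<rho> by (smt (verit) mult_pos_pos zero_less_power)
  ultimately show ?thesis by blast
qed

section \<open>Counting lattice points with the kernel\<close>

context positive_cuboid begin

lemma core_shift:
  assumes "x \<in> core_cell \<delta> z"
  shows "norm (scaled a x) \<le> norm (scaled a (real_vec z)) + \<delta> * cell_diam"
    "norm (scaled a (real_vec z)) \<le> norm (scaled a x) + \<delta> * cell_diam"
proof -
  have "norm (scaled a (x - real_vec z)) \<le> \<delta> * cell_diam"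
    by (rule norm_scaled_le) (use assms in \<open>auto simp: core_cell_def\<close>)
  then show "norm (scaled a x) \<le> norm (scaled a (real_vec z)) + \<delta> * cell_diam"
    "norm (scaled a (real_vec z)) \<le> norm (scaled a x) + \<delta> * cell_diam"
    unfolding scaled_diff
    using norm_triangle_ineq2[of "scaled a x" "scaled a (real_vec z)"] norm_triangle_ineq2[of "scaled a (real_vec z)" "scaled a x"]
    by (simp_all add: norm_minus_commute)
qed

text \<open>The lattice points whose centred cells may cross the surface of the ellipsoid. Every
  other cell lies entirely inside or entirely outside.\<close>

definition boundary_points :: "real \<Rightarrow> (int ^ 'n) set" where
  "boundary_points t = {z \<in> full_points a (t + cell_diam). t - cell_diam < norm (scaled a (real_vec z))}"

lemma finite_boundary_points: "finite (boundary_points t)"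
  using finite_full_points by (simp add: boundary_points_def)

text \<open>The cells of these points lie in the shell between the radii t - 2
  \<open>cell_diam\<close> and t + 2 \<open>cell_diam\<close>, whose volume is of order
  t^(n-1).\<close>

lemma card_boundary_points:
  assumes "1 \<le> t" "2 * cell_diam \<le> t"
  shows "card (boundary_points t) \<le> measure lborel (ball (0 :: real ^ 'n) 1) * (\<Prod>i\<in>UNIV. a $ i) *
     (2 * (1 + 2 * cell_diam) ^ CARD('n)) * t ^ (CARD('n) - 1)"
proof -
  let ?\<kappa> = "2 * cell_diam" and ?n = "CARD('n)"
  define K where "K = measure lborel (ball (0 :: real ^ 'n) 1) * (\<Prod>i\<in>UNIV. a $ i)"
  have K: "0 \<le> K" unfolding K_def using side_pos by (intro mult_nonneg_nonneg prod_nonneg) (auto intro: less_imp_le)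
  have k0: "0 \<le> ?\<kappa>" using cell_diam_pos by simp
  have "card (boundary_points t) \<le> measure lebesgue (ellipsoid a (t + ?\<kappa>) - ellipsoid a (t - ?\<kappa>))"
  proof (rule card_le_measure[where c = "1/2", OF finite_boundary_points])
    show "ellipsoid a (t + ?\<kappa>) - ellipsoid a (t - ?\<kappa>) \<in> lmeasurable"
      by (intro fmeasurable.Diff lmeasurable_ellipsoid)
    fix z assume z: "z \<in> boundary_points t"
    show "unit_cell (1/2) z \<subseteq> ellipsoid a (t + ?\<kappa>) - ellipsoid a (t - ?\<kappa>)"
      using cell_shift(1,2) z by (force simp: ellipsoid_def boundary_points_def full_points_def)
  qed
  also have "\<dots> = measure lebesgue (ellipsoid a (t + ?\<kappa>)) - measure lebesgue (ellipsoid a (t - ?\<kappa>))"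
    using k0 by (intro measurable_measure_Diff lmeasurable_ellipsoid fmeasurableD) (auto simp: ellipsoid_def)
  also have "\<dots> = K * ((t + ?\<kappa>) ^ ?n - (t - ?\<kappa>) ^ ?n)"
    using assms k0 by (simp add: measure_ellipsoid K_def algebra_simps)
  also have "\<dots> \<le> K * (2 * (1 + ?\<kappa>) ^ ?n * t ^ (?n - 1))"
    using power_perturb[OF assms(1) k0, of ?n] assms(2) by (intro mult_left_mono K) linarith
  finally show ?thesis by (simp add: K_def mult.assoc)
qed

lemma kernel_measure_finite_cells:
  assumes "finite Z" "S \<in> sets borel" "bounded S"
  shows "measure (kernel_measure M) (\<Union>z\<in>Z. unit_cell (1/2) z \<inter> S) = (\<Sum>z\<in>Z. measure (kernel_measure M) (unit_cell (1/2) z \<inter> S))"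
proof (rule measure_UNION_AE[OF assms(1)])
  show "unit_cell (1/2) z \<inter> S \<in> fmeasurable (kernel_measure M)" for z
    using assms unit_cell_borel by (intro kernel_measure_bounded) (auto intro: bounded_subset)
  show "pairwise (\<lambda>z w. AE x in kernel_measure M. x \<notin> unit_cell (1/2) z \<inter> S \<or> x \<notin> unit_cell (1/2) w \<inter> S) Z"
    by (auto simp: pairwise_def unit_cell_def vec_eq_iff intro!: AE_I2)
qed

text \<open>If z is counted, its core lies in the ellipsoid enlarged by \<delta>
  \<open>cell_diam\<close>, so at most the share \<epsilon> of the mass \<open>I\<close> of its cell
  is lost; if z is not counted, its core misses the correspondingly shrunken ellipsoid. A loss or
  gain happens only at boundary points, so the total error is \<epsilon> \<open>I\<close> times
  their number.\<close>

lemma kernel_sandwich: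
  fixes M :: nat
  defines "I \<equiv> measure (kernel_measure M) (unit_cell (1/2) (0 :: int ^ 'n))"
  assumes \<delta>: "0 \<le> \<delta>" "\<delta> \<le> 1" and eps: "0 \<le> \<epsilon>"
    and conc: "measure (kernel_measure M) (unit_cell (1/2) (0 :: int ^ 'n) - core_cell \<delta> 0) \<le> \<epsilon> * I"
  shows "I * card (full_points a t) \<le> ellipsoid_integral (bump_kernel M) a (t + \<delta> * cell_diam) + \<epsilon> * I * card (boundary_points t)"
    and "ellipsoid_integral (bump_kernel M) a (t - \<delta> * cell_diam) \<le> I * card (full_points a t) + \<epsilon> * I * card (boundary_points t)"
proof -
  let ?\<mu> = "kernel_measure M" and ?Q = "unit_cell (1/2) :: int ^ 'n \<Rightarrow> _" and ?F = "full_points a t"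
  have I0: "0 \<le> I" by (simp add: I_def)
  have ei: "ellipsoid_integral (bump_kernel M) a s = measure ?\<mu> (ellipsoid a s)" for s
    unfolding ellipsoid_integral_def using kernel_measure_bounded(2)[OF bounded_ellipsoid ellipsoid_borel] by simp
  have Qf: "?Q z \<in> fmeasurable ?\<mu>" "?Q z - core_cell \<delta> z \<in> fmeasurable ?\<mu>" for z
    by (intro kernel_measure_bounded; auto simp: bounded_cell unit_cell_borel core_cell_borel bounded_diff)+
  have Ef: "ellipsoid a s \<in> fmeasurable ?\<mu>" for s
    by (intro kernel_measure_bounded bounded_ellipsoid ellipsoid_borel)
  have QI: "measure ?\<mu> (?Q z) = I" for z unfolding I_def by (rule kernel_measure_cell)
  have off: "measure ?\<mu> (?Q z - core_cell \<delta> z) \<le> \<epsilon> * I" for z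
    using conc kernel_measure_off_core[of M z \<delta>] by simp
  have dk: "0 \<le> \<delta> * cell_diam" "\<delta> * cell_diam \<le> cell_diam" using \<delta> cell_diam_pos by (auto simp: mult_le_cancel_right2)
  have cardB: "(\<Sum>z\<in>Z. \<epsilon> * I * of_bool (z \<in> boundary_points t)) \<le> \<epsilon> * I * card (boundary_points t)" if "finite Z" for Z
  proof -
    have "(\<Sum>z\<in>Z. \<epsilon> * I * of_bool (z \<in> boundary_points t)) = \<epsilon> * I * card (Z \<inter> boundary_points t)"
      using that by (simp add: sum_distrib_left[symmetric] sum_of_bool_eq)
    also have "\<dots> \<le> \<epsilon> * I * card (boundary_points t)"
      using eps I0 finite_boundary_points by (intro mult_left_mono) (auto intro: card_mono)
    finally show ?thesis .
  qed
  let ?E = "ellipsoid a (t + \<delta> * cell_diam)"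
  have piece: "I - \<epsilon> * I * of_bool (z \<in> boundary_points t) \<le> measure ?\<mu> (?Q z \<inter> ?E)" if z: "z \<in> ?F" for z
  proof -
    have nz: "norm (scaled a (real_vec z)) \<le> t" using z by (simp add: full_points_def)
    show ?thesis
    proof (cases "z \<in> boundary_points t")
      case True
      have sub: "?Q z - ?E \<subseteq> ?Q z - core_cell \<delta> z"
        using core_shift(1)[of _ \<delta> z] nz by (force simp: ellipsoid_def)
      have "measure ?\<mu> ((?Q z \<inter> ?E) \<union> (?Q z - ?E)) \<le> measure ?\<mu> (?Q z \<inter> ?E) + measure ?\<mu> (?Q z - ?E)"
        by (intro measure_Un_le) (simp_all add: unit_cell_borel ellipsoid_borel sets.Int sets.Diff)
      then have "I \<le> measure ?\<mu> (?Q z \<inter> ?E) + measure ?\<mu> (?Q z - ?E)"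
        by (simp add: Int_Diff_Un QI)
      moreover have "measure ?\<mu> (?Q z - ?E) \<le> \<epsilon> * I"
        using measure_mono_fmeasurable[OF sub _ Qf(2)] off[of z]
        by (simp add: unit_cell_borel ellipsoid_borel sets.Diff)
      ultimately show ?thesis using True by simp
    next
      case False
      then have "norm (scaled a (real_vec z)) \<le> t - cell_diam"
        using nz cell_diam_pos by (auto simp: boundary_points_def full_points_def)
      then have "?Q z \<subseteq> ?E" using cell_shift(1)[of _ z] dk by (force simp: ellipsoid_def)
      then have "?Q z \<inter> ?E = ?Q z" by blast
      then show ?thesis using QI False by simp
    qed
  qed
  have "I * card ?F - \<epsilon> * I * card (boundary_points t) \<le> (\<Sum>z\<in>?F. I - \<epsilon> * I * of_bool (z \<in> boundary_points t))"
    unfolding sum_subtractf using cardB[OF finite_full_points] by (simp add: mult.commute)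
  also have "\<dots> \<le> (\<Sum>z\<in>?F. measure ?\<mu> (?Q z \<inter> ?E))" by (rule sum_mono) (rule piece)
  also have "\<dots> = measure ?\<mu> (\<Union>z\<in>?F. ?Q z \<inter> ?E)"
    by (rule kernel_measure_finite_cells[symmetric, OF finite_full_points ellipsoid_borel bounded_ellipsoid])
  also have "\<dots> \<le> measure ?\<mu> ?E"
    by (intro measure_mono_fmeasurable Ef sets.finite_UN finite_full_points)
      (auto simp: unit_cell_borel ellipsoid_borel sets.Int)
  finally show "I * card ?F \<le> ellipsoid_integral (bump_kernel M) a (t + \<delta> * cell_diam) + \<epsilon> * I * card (boundary_points t)"
    unfolding ei by linarith
  let ?E' = "ellipsoid a (t - \<delta> * cell_diam)" and ?W = "full_points a (t + cell_diam)"
  have piece': "measure ?\<mu> (?Q z \<inter> ?E') \<le> I * of_bool (z \<in> ?F) + \<epsilon> * I * of_bool (z \<in> boundary_points t)" if z: "z \<in> ?W" for z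
  proof (cases "z \<in> ?F")
    case True
    have "measure ?\<mu> (?Q z \<inter> ?E') \<le> measure ?\<mu> (?Q z)"
      by (intro measure_mono_fmeasurable Qf) (auto simp: unit_cell_borel ellipsoid_borel sets.Int)
    moreover have "0 \<le> \<epsilon> * I * of_bool (z \<in> boundary_points t)" using eps I0 by simp
    ultimately show ?thesis using True QI[of z] by (simp only: of_bool_eq(2) mult_1_right)
  next
    case False
    then have nz: "t < norm (scaled a (real_vec z))" by (simp add: full_points_def)
    then have "z \<in> boundary_points t" using z cell_diam_pos by (simp add: boundary_points_def)
    moreover have "?Q z \<inter> ?E' \<subseteq> ?Q z - core_cell \<delta> z"
      using core_shift(2)[of _ \<delta> z] nz by (force simp: ellipsoid_def)
    then have "measure ?\<mu> (?Q z \<inter> ?E') \<le> measure ?\<mu> (?Q z - core_cell \<delta> z)"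
      by (intro measure_mono_fmeasurable Qf) (auto simp: unit_cell_borel ellipsoid_borel sets.Int)
    ultimately show ?thesis using off[of z] False by simp
  qed
  have cover: "?E' \<subseteq> (\<Union>z\<in>?W. ?Q z \<inter> ?E')"
  proof
    fix x assume x: "x \<in> ?E'"
    define z where "z = (\<chi> i. \<lfloor>x $ i + 1/2\<rfloor>)"
    have xz: "x \<in> ?Q z" by (simp add: z_def unit_cell_def)
    have "z \<in> ?W" using cell_shift(2)[OF xz] x dk by (simp add: ellipsoid_def full_points_def)
    then show "x \<in> (\<Union>z\<in>?W. ?Q z \<inter> ?E')" using x xz by blast
  qed
  have FW: "?F \<subseteq> ?W" using cell_diam_pos by (auto simp: full_points_def)
  have "measure ?\<mu> ?E' \<le> measure ?\<mu> (\<Union>z\<in>?W. ?Q z \<inter> ?E')"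
  proof (rule measure_mono_fmeasurable[OF cover])
    show "?E' \<in> sets ?\<mu>" by (simp add: ellipsoid_borel)
    show "(\<Union>z\<in>?W. ?Q z \<inter> ?E') \<in> fmeasurable ?\<mu>"
      using Qf(1) Ef finite_full_points by (intro fmeasurable.finite_UN fmeasurable.Int) auto
  qed
  also have "\<dots> = (\<Sum>z\<in>?W. measure ?\<mu> (?Q z \<inter> ?E'))"
    by (rule kernel_measure_finite_cells[OF finite_full_points ellipsoid_borel bounded_ellipsoid])
  also have "\<dots> \<le> (\<Sum>z\<in>?W. I * of_bool (z \<in> ?F) + \<epsilon> * I * of_bool (z \<in> boundary_points t))"
    by (rule sum_mono) (rule piece')
  also have "\<dots> = I * card ?F + (\<Sum>z\<in>?W. \<epsilon> * I * of_bool (z \<in> boundary_points t))"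
    using FW finite_full_points by (simp add: sum.distrib sum_distrib_left[symmetric] sum_of_bool_eq Int_absorb1 del: sum_of_bool_mult_eq)
  also have "\<dots> \<le> I * card ?F + \<epsilon> * I * card (boundary_points t)"
    using cardB[OF finite_full_points] by simp
  finally show "ellipsoid_integral (bump_kernel M) a (t - \<delta> * cell_diam) \<le> I * card ?F + \<epsilon> * I * card (boundary_points t)"
    unfolding ei .
qed

end

text \<open>In contrast to \<open>power_perturb\<close> the bound is linear in x, so shifting the
  radius by a small x costs only a small multiple of t^(n-1).\<close>

lemma power_perturb_linear:
  fixes t x k :: real
  assumes "1 \<le> t" "0 \<le> x" "x \<le> k"
  shows "(t + x) ^ n - t ^ n \<le> n * x * (1 + k) ^ (n - 1) * t ^ (n - 1)"
    and "x \<le> t \<Longrightarrow> t ^ n - (t - x) ^ n \<le> n * x * (1 + k) ^ (n - 1) * t ^ (n - 1)"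
proof -
  have gen: "s ^ n - (s - x) ^ n \<le> n * x * s ^ (n - 1)" if "x \<le> s" "0 < s" for s
    using power_minus_linear[OF that(2,1), of n] by linarith
  have k: "0 \<le> k" using assms by linarith
  have "(t + x) ^ n - t ^ n \<le> n * x * (t + x) ^ (n - 1)" using gen[of "t + x"] assms by simp
  also have "\<dots> \<le> n * x * ((1 + k) * t) ^ (n - 1)"
  proof (intro mult_left_mono power_mono)
    have "x * 1 \<le> k * t" using assms k by (intro mult_mono) auto
    then show "t + x \<le> (1 + k) * t" by (simp add: algebra_simps)
  qed (use assms in auto)
  finally show "(t + x) ^ n - t ^ n \<le> n * x * (1 + k) ^ (n - 1) * t ^ (n - 1)"
    by (simp add: power_mult_distrib mult.assoc)
  assume "x \<le> t"
  then have "t ^ n - (t - x) ^ n \<le> n * x * t ^ (n - 1)" using gen[of t] assms by simp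
  also have "\<dots> \<le> n * x * ((1 + k) ^ (n - 1) * t ^ (n - 1))"
    using assms k by (intro mult_left_mono) (auto simp: mult_le_cancel_right1)
  finally show "t ^ n - (t - x) ^ n \<le> n * x * (1 + k) ^ (n - 1) * t ^ (n - 1)"
    by (simp add: mult.assoc)
qed

text \<open>Plain packing and covering by cells give an error of order t^(n-1). This suffices for
  comparing main terms of order t^n when the mean of the kernel is identified.\<close>

lemma (in positive_cuboid) card_full_points_crude:
  assumes "1 \<le> t" "cell_diam \<le> t"
  shows "\<bar>card (full_points a t) - measure lebesgue (ellipsoid a t)\<bar>
    \<le> measure lborel (ball (0 :: real ^ 'n) 1) * (\<Prod>i\<in>UNIV. a $ i) * (1 + cell_diam) ^ CARD('n) * t ^ (CARD('n) - 1)"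
proof -
  let ?n = "CARD('n)"
  define K where "K = measure lborel (ball (0 :: real ^ 'n) 1) * (\<Prod>i\<in>UNIV. a $ i)"
  have K: "0 \<le> K" unfolding K_def using side_pos by (intro mult_nonneg_nonneg prod_nonneg) (auto intro: less_imp_le)
  have vol: "measure lebesgue (ellipsoid a s) = K * s ^ ?n" if "0 \<le> s" for s
    using measure_ellipsoid[OF that] by (simp add: K_def)
  have k0: "0 \<le> cell_diam" using cell_diam_pos by simp
  have "card (full_points a t) \<le> measure lebesgue (ellipsoid a (t + cell_diam))"
  proof (rule card_le_measure[where c = "1/2", OF finite_full_points lmeasurable_ellipsoid])
    fix z assume "z \<in> full_points a t"
    then show "unit_cell (1/2) z \<subseteq> ellipsoid a (t + cell_diam)"
      using cell_shift(1)[of _ z] by (force simp: ellipsoid_def full_points_def)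
  qed
  also have "\<dots> = K * (t + cell_diam) ^ ?n" using assms k0 by (intro vol) auto
  also have "\<dots> \<le> K * (t ^ ?n + (1 + cell_diam) ^ ?n * t ^ (?n - 1))"
    using power_perturb(1)[OF assms(1) k0] K by (rule mult_left_mono)
  finally have up: "card (full_points a t) \<le> K * t ^ ?n + K * (1 + cell_diam) ^ ?n * t ^ (?n - 1)"
    by (simp add: algebra_simps)
  have "K * (t ^ ?n - (1 + cell_diam) ^ ?n * t ^ (?n - 1)) \<le> K * (t - cell_diam) ^ ?n"
    using power_perturb(2)[OF assms(1) k0 assms(2)] K by (rule mult_left_mono)
  also have "\<dots> = measure lebesgue (ellipsoid a (t - cell_diam))" using assms by (intro vol[symmetric]) auto
  also have "\<dots> \<le> card (full_points a t)"
  proof (rule measure_le_card[where c = "1/2", OF finite_full_points lmeasurable_ellipsoid])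
    fix x assume x: "x \<in> ellipsoid a (t - cell_diam)"
    define z where "z = (\<chi> i. \<lfloor>x $ i + 1/2\<rfloor>)"
    have xz: "x \<in> unit_cell (1/2) z" by (simp add: z_def unit_cell_def)
    have "z \<in> full_points a t" using cell_shift(2)[OF xz] x by (simp add: ellipsoid_def full_points_def)
    then show "(\<chi> i. \<lfloor>x $ i + 1/2\<rfloor>) \<in> full_points a t" by (simp add: z_def)
  qed
  finally have lo: "K * t ^ ?n - K * (1 + cell_diam) ^ ?n * t ^ (?n - 1) \<le> card (full_points a t)"
    by (simp add: algebra_simps)
  have "measure lebesgue (ellipsoid a t) = K * t ^ ?n" using assms by (intro vol) auto
  then show ?thesis using up lo unfolding K_def by linarith
qed

text \<open>Both sides are asymptotic to \<open>\<integral>\<close> of the kernel over the unit ball dilated by \<open>t\<close>, which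
  identifies the mean of the kernel as a trigonometric polynomial with its integral over a cell.\<close>

lemma kernel_mean_eq_cell:
  assumes n: "2 \<le> CARD('n::finite)"
    and m: "\<And>\<alpha> \<beta> e. 0 < \<alpha> \<Longrightarrow> 0 < e \<Longrightarrow> \<exists>t0. \<forall>t\<ge>t0. \<forall>a :: real ^ 'n. (\<forall>i. \<alpha> \<le> a $ i \<and> a $ i \<le> \<beta>) \<longrightarrow>
     \<bar>ellipsoid_integral (bump_kernel M) a t - m * measure lebesgue (ellipsoid a t)\<bar> \<le> e * t ^ (CARD('n) - 1)"
  shows "m = measure (kernel_measure M) (unit_cell (1/2) (0 :: int ^ 'n))"
proof -
  let ?n = "CARD('n)" and ?a = "(\<chi> i. 1) :: real ^ 'n" and ?V = "measure lborel (ball (0 :: real ^ 'n) 1)"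
  define I where "I = measure (kernel_measure M) (unit_cell (1/2) (0 :: int ^ 'n))"
  have I0: "0 \<le> I" by (simp add: I_def)
  define k where "k = unit_cube.cell_diam TYPE('n)"
  have k0: "0 < k" unfolding k_def by (rule unit_cube.cell_diam_pos)
  have V: "0 < ?V" by simp
  obtain t0 where t0: "\<And>t. t0 \<le> t \<Longrightarrow> \<bar>ellipsoid_integral (bump_kernel M) ?a t - m * measure lebesgue (ellipsoid ?a t)\<bar> \<le> 1 * t ^ (?n - 1)"
    using m[of 1 1 1] by (metis (no_types, lifting) order_refl vec_lambda_beta zero_less_one)
  have vol: "measure lebesgue (ellipsoid ?a t) = ?V * t ^ ?n" if "0 \<le> t" for t
    using unit_cube.measure_ellipsoid[OF that, where 'n='n] by simp
  define C where "C = 1 + I * (?V * (2 * (1 + 2 * k) ^ ?n)) + I * (?V * (1 + k) ^ ?n)"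
  have C: "0 \<le> C" using I0 V k0 by (simp add: C_def)
  have main: "\<bar>m - I\<bar> * ?V * t \<le> C" if t: "max (max 1 (2 * k)) t0 \<le> t" for t
  proof -
    have t1: "1 \<le> t" "2 * k \<le> t" "t0 \<le> t" using t by auto
    \<comment> \<open>With \<delta> = 0 and \<epsilon> = 1 the concentration hypothesis is trivial.
      The resulting error of order t^(n-1) is still smaller than the terms of order t^n, so |m - I|
      t stays bounded as t grows and m must equal \<open>I\<close>.\<close>
    have conc: "measure (kernel_measure M) (unit_cell (1/2) (0 :: int ^ 'n) - core_cell 0 0) \<le> 1 * I"
      unfolding I_def mult_1
      by (rule measure_mono_fmeasurable) (auto simp: bounded_cell unit_cell_borel core_cell_borel intro: kernel_measure_bounded)
    note sw = unit_cube.kernel_sandwich[where 'n='n and \<delta> = 0 and \<epsilon> = 1 and M = M and t = t, folded I_def, OF _ _ _ conc, simplified]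
    define N B where "N = real (card (full_points ?a t))" and "B = real (card (unit_cube.boundary_points t :: (int ^ 'n) set))"
    have s: "I * N \<le> ellipsoid_integral (bump_kernel M) ?a t + I * B" "ellipsoid_integral (bump_kernel M) ?a t \<le> I * N + I * B"
      using sw by (simp_all add: N_def B_def)
    have "B \<le> ?V * (2 * (1 + 2 * k) ^ ?n) * t ^ (?n - 1)"
      using unit_cube.card_boundary_points[where 'n='n, of t] t1 by (simp add: B_def k_def)
    then have b: "I * B \<le> I * (?V * (2 * (1 + 2 * k) ^ ?n)) * t ^ (?n - 1)"
      using I0 by (simp add: mult_left_mono mult.assoc)
    have "\<bar>N - ?V * t ^ ?n\<bar> \<le> ?V * (1 + k) ^ ?n * t ^ (?n - 1)"
      using unit_cube.card_full_points_crude[where 'n='n, of t] t1 k0 vol[of t] by (simp add: N_def k_def)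
    then have c: "\<bar>I * N - I * (?V * t ^ ?n)\<bar> \<le> I * (?V * (1 + k) ^ ?n) * t ^ (?n - 1)"
      unfolding right_diff_distrib[symmetric] abs_mult using I0 by (simp add: mult_left_mono mult.assoc)
    have d: "\<bar>ellipsoid_integral (bump_kernel M) ?a t - m * (?V * t ^ ?n)\<bar> \<le> t ^ (?n - 1)"
      using t0[OF t1(3)] vol[of t] t1 by simp
    have "\<bar>m * (?V * t ^ ?n) - I * (?V * t ^ ?n)\<bar> \<le> C * t ^ (?n - 1)"
      using s b c d unfolding C_def distrib_right by linarith
    also have "\<bar>m * (?V * t ^ ?n) - I * (?V * t ^ ?n)\<bar> = (\<bar>m - I\<bar> * ?V * t) * t ^ (?n - 1)"
    proof -
      have "t ^ ?n = t * t ^ (?n - 1)" using n by (cases ?n) auto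
      then show ?thesis unfolding left_diff_distrib[symmetric] abs_mult using t1 V by simp
    qed
    finally show ?thesis using t1 by (simp add: mult_le_cancel_right)
  qed
  have "\<bar>m - I\<bar> = 0"
  proof (rule ccontr)
    assume "\<bar>m - I\<bar> \<noteq> 0"
    then have p: "0 < \<bar>m - I\<bar> * ?V" using V by simp
    define t where "t = max (max (max 1 (2 * k)) t0) ((C + 1) / (\<bar>m - I\<bar> * ?V))"
    have "(C + 1) / (\<bar>m - I\<bar> * ?V) \<le> t" by (simp add: t_def)
    then have "C + 1 \<le> \<bar>m - I\<bar> * ?V * t" using p by (simp add: field_simps)
    also have "\<dots> \<le> C" by (rule main) (simp add: t_def)
    finally show False by simp
  qed
  then show ?thesis by (simp add: I_def)
qed

text \<open>The error e is divided into three equal parts: \<delta> pays for the shift of the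
  radius, \<epsilon> for the mass off the cores at boundary points, and \<open>e1\<close> for the
  nonconstant waves. The order of choices matters: M depends on \<delta> and \<epsilon>, and the
  threshold for t depends on M.\<close>

theorem full_points_asymptotic:
  fixes \<alpha> \<beta> e :: real
  assumes n: "2 \<le> CARD('n::finite)" and "0 < \<alpha>" "0 < e"
  shows "\<exists>t0. \<forall>t\<ge>t0. \<forall>a :: real ^ 'n. (\<forall>i. \<alpha> \<le> a $ i \<and> a $ i \<le> \<beta>) \<longrightarrow>
    \<bar>card (full_points a t) - measure lborel (ball (0 :: real ^ 'n) 1) * t ^ CARD('n) * (\<Prod>i\<in>UNIV. a $ i)\<bar>
      \<le> e * t ^ (CARD('n) - 1)"
proof -
  let ?n = "CARD('n)" and ?V = "measure lborel (ball (0 :: real ^ 'n) 1)"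
  define b where "b = max 1 \<beta>"
  define k where "k = ?n / \<alpha>"
  define W where "W = ?V * b ^ ?n"
  define D where "D = W * (?n * k * (1 + k) ^ (?n - 1))"
  define B where "B = W * (2 * (1 + 2 * k) ^ ?n)"
  have k0: "0 \<le> k" using assms by (simp add: k_def)
  have b1: "1 \<le> b" by (simp add: b_def)
  have W: "0 \<le> W" using b1 by (simp add: W_def)
  have DB: "0 \<le> D" "0 \<le> B" using W k0 by (simp_all add: D_def B_def)
  have cancel: "e / (3 * d) * d = e / 3" if "d \<noteq> 0" for d using that by simp
  define \<delta> where "\<delta> = min (1/4) (e / (3 * (D + 1)))"
  have \<delta>: "0 < \<delta>" "\<delta> < 1/2" "\<delta> * D \<le> e / 3"
  proof -
    show "0 < \<delta>" "\<delta> < 1/2" using assms DB by (simp_all add: \<delta>_def)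
    have "\<delta> * D \<le> e / (3 * (D + 1)) * (D + 1)" using DB assms by (intro mult_mono) (auto simp: \<delta>_def)
    also have "\<dots> = e / 3" using cancel[of "D + 1"] DB by linarith
    finally show "\<delta> * D \<le> e / 3" .
  qed
  define \<epsilon> where "\<epsilon> = e / (3 * (B + 1))"
  have \<epsilon>: "0 < \<epsilon>" "\<epsilon> * B \<le> e / 3"
  proof -
    show "0 < \<epsilon>" using assms DB by (simp add: \<epsilon>_def)
    then have "\<epsilon> * B \<le> \<epsilon> * (B + 1)" by simp
    also have "\<dots> = e / 3" unfolding \<epsilon>_def using cancel[of "B + 1"] DB by linarith
    finally show "\<epsilon> * B \<le> e / 3" .
  qed
  obtain M where M: "0 < measure (kernel_measure M) (unit_cell (1/2) (0 :: int ^ 'n))"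
    "measure (kernel_measure M) (unit_cell (1/2) (0 :: int ^ 'n) - core_cell \<delta> 0)
      \<le> \<epsilon> * measure (kernel_measure M) (unit_cell (1/2) (0 :: int ^ 'n))"
    using kernel_concentration[OF \<delta>(1,2) \<epsilon>(1)] by blast
  define I where "I = measure (kernel_measure M) (unit_cell (1/2) (0 :: int ^ 'n))"
  have I: "0 < I" using M(1) by (simp add: I_def)
  have mean: "\<exists>t0. \<forall>t\<ge>t0. \<forall>a :: real ^ 'n. (\<forall>i. \<alpha>' \<le> a $ i \<and> a $ i \<le> \<beta>') \<longrightarrow>
     \<bar>ellipsoid_integral (bump_kernel M) a t - I * measure lebesgue (ellipsoid a t)\<bar> \<le> e' * t ^ (?n - 1)"
    if "0 < \<alpha>'" "0 < e'" for \<alpha>' \<beta>' e'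
  proof -
    obtain m where m: "\<And>\<alpha> \<beta> e. 0 < \<alpha> \<Longrightarrow> 0 < e \<Longrightarrow> \<exists>t0. \<forall>t\<ge>t0. \<forall>a :: real ^ 'n. (\<forall>i. \<alpha> \<le> a $ i \<and> a $ i \<le> \<beta>) \<longrightarrow>
     \<bar>ellipsoid_integral (bump_kernel M) a t - m * measure lebesgue (ellipsoid a t)\<bar> \<le> e * t ^ (?n - 1)"
      using trig_poly_ellipsoid_mean[OF n trig_poly_bump_kernel[of M]] by blast
    have "m = I" unfolding I_def by (rule kernel_mean_eq_cell[OF n m])
    then show ?thesis using m[OF that] by simp
  qed
  \<comment> \<open>The wave estimate is used at radius at most (1 + k) t; the denominator (1 +
    k)^(n-1) returns it to t. The factor \<open>I\<close> is divided out at the end.\<close>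
  define e1 where "e1 = e * I / (3 * (1 + k) ^ (?n - 1))"
  have e1: "0 < e1" using assms I k0 by (simp add: e1_def add_pos_nonneg)
  obtain t0 where t0: "\<And>t a. t0 \<le> t \<Longrightarrow> (\<forall>i. \<alpha> \<le> a $ i \<and> a $ i \<le> \<beta>) \<Longrightarrow>
     \<bar>ellipsoid_integral (bump_kernel M) (a :: real ^ 'n) t - I * measure lebesgue (ellipsoid a t)\<bar> \<le> e1 * t ^ (?n - 1)"
    using mean[OF \<open>0 < \<alpha>\<close> e1, of \<beta>] by blast
  show ?thesis
  proof (rule exI[of _ "max (max 1 (2 * k)) (t0 + k)"], intro allI impI)
    fix t and a :: "real ^ 'n"
    assume tt: "max (max 1 (2 * k)) (t0 + k) \<le> t" and a: "\<forall>i. \<alpha> \<le> a $ i \<and> a $ i \<le> \<beta>"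
    interpret positive_cuboid a using a \<open>0 < \<alpha>\<close> by unfold_locales (auto intro: less_le_trans)
    have t: "1 \<le> t" "2 * k \<le> t" "t0 + k \<le> t" using tt by auto
    define P where "P = (\<Prod>i\<in>UNIV. a $ i)"
    have P: "0 \<le> P" "P \<le> b ^ ?n"
    proof -
      show "0 \<le> P" unfolding P_def using side_pos by (intro prod_nonneg) (auto intro: less_imp_le)
      have "(\<Prod>i\<in>UNIV. a $ i) \<le> (\<Prod>i\<in>(UNIV :: 'n set). b)"
        using a side_pos by (intro prod_mono) (auto simp: b_def intro: less_imp_le max.coboundedI2)
      then show "P \<le> b ^ ?n" by (simp add: P_def)
    qed
    have VP: "0 \<le> ?V * P" "?V * P \<le> W" using P by (auto simp: W_def intro: mult_left_mono)
    have cd: "cell_diam \<le> k"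
    proof -
      have "cell_diam \<le> (\<Sum>i\<in>(UNIV :: 'n set). 1 / \<alpha>)"
        unfolding cell_diam_def using a assms(2) by (intro sum_mono divide_left_mono mult_pos_pos side_pos) auto
      then show ?thesis by (simp add: k_def)
    qed
    have cd0: "0 < cell_diam" by (rule cell_diam_pos)
    define x where "x = \<delta> * cell_diam"
    have x: "0 \<le> x" "x \<le> k" "x \<le> \<delta> * k"
    proof -
      show "0 \<le> x" using \<delta> cd0 by (simp add: x_def)
      show xk: "x \<le> \<delta> * k" using \<delta> cd by (simp add: x_def)
      have "\<delta> * k \<le> 1 * k" using \<delta> k0 by (intro mult_right_mono) auto
      then show "x \<le> k" using xk by simp
    qed
    let ?N = "real (card (full_points a t))" and ?vol = "\<lambda>s. measure lebesgue (ellipsoid a s)"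
    let ?p = "t ^ (?n - 1)"
    have p0: "0 \<le> ?p" using t by simp
    have vol: "?vol s = ?V * P * s ^ ?n" if "0 \<le> s" for s
      using measure_ellipsoid[OF that] by (simp add: P_def)
    have bd: "card (boundary_points t) \<le> B * ?p"
    proof -
      have "card (boundary_points t) \<le> ?V * P * (2 * (1 + 2 * cell_diam) ^ ?n) * ?p"
        using card_boundary_points[of t] t cd unfolding P_def by simp
      also have "\<dots> \<le> W * (2 * (1 + 2 * k) ^ ?n) * ?p"
        using VP cd cd0 p0 W by (intro mult_right_mono mult_mono power_mono) auto
      finally show ?thesis by (simp add: B_def)
    qed
    have D: "?V * P * (?n * x * (1 + k) ^ (?n - 1) * ?p) \<le> e / 3 * ?p"
    proof -
      have "?V * P * (?n * x * (1 + k) ^ (?n - 1) * ?p) \<le> W * (?n * (\<delta> * k) * (1 + k) ^ (?n - 1) * ?p)"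
        using VP x k0 p0 W by (intro mult_mono mult_right_mono mult_left_mono) auto
      also have "\<dots> = \<delta> * D * ?p" by (simp add: D_def)
      also have "\<dots> \<le> e / 3 * ?p" using \<delta>(3) p0 by (rule mult_right_mono)
      finally show ?thesis .
    qed
    have v1: "?vol (t + x) \<le> ?vol t + e / 3 * ?p"
    proof -
      have "?vol (t + x) - ?vol t = ?V * P * ((t + x) ^ ?n - t ^ ?n)" using vol t x by (simp add: right_diff_distrib)
      also have "\<dots> \<le> ?V * P * (?n * x * (1 + k) ^ (?n - 1) * ?p)"
        using power_perturb_linear(1)[OF t(1) x(1,2)] VP(1) by (rule mult_left_mono)
      finally show ?thesis using D by linarith
    qed
    have v2: "?vol t - e / 3 * ?p \<le> ?vol (t - x)"
    proof -
      have xt: "x \<le> t" using x t k0 by linarith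
      have "?vol t - ?vol (t - x) = ?V * P * (t ^ ?n - (t - x) ^ ?n)" using vol t xt by (simp add: right_diff_distrib)
      also have "\<dots> \<le> ?V * P * (?n * x * (1 + k) ^ (?n - 1) * ?p)"
        using power_perturb_linear(2)[OF t(1) x(1,2) xt] VP(1) by (rule mult_left_mono)
      finally show ?thesis using D by linarith
    qed
    have eb: "e1 * s ^ (?n - 1) \<le> e / 3 * I * ?p" if "0 \<le> s" "s \<le> t + k" for s
    proof -
      have "k * 1 \<le> k * t" using k0 t by (intro mult_left_mono) auto
      then have "s \<le> (1 + k) * t" using that by (simp add: algebra_simps)
      then have "s ^ (?n - 1) \<le> ((1 + k) * t) ^ (?n - 1)" using that by (intro power_mono)
      then have "e1 * s ^ (?n - 1) \<le> e1 * ((1 + k) ^ (?n - 1) * ?p)"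
        using e1 by (simp add: power_mult_distrib)
      also have "\<dots> = e / 3 * I * ?p" using k0 by (simp add: e1_def add_nonneg_eq_0_iff)
      finally show ?thesis .
    qed
    have int1: "ellipsoid_integral (bump_kernel M) a (t + x) \<le> I * ?vol (t + x) + e / 3 * I * ?p"
    proof -
      have r: "t0 \<le> t + x" "0 \<le> t + x" "t + x \<le> t + k" using t x k0 by linarith+
      show ?thesis using t0[OF r(1) a] eb[OF r(2,3)] by linarith
    qed
    have int2: "I * ?vol (t - x) - e / 3 * I * ?p \<le> ellipsoid_integral (bump_kernel M) a (t - x)"
    proof -
      have r: "t0 \<le> t - x" "0 \<le> t - x" "t - x \<le> t + k" using t x k0 by linarith+
      show ?thesis using t0[OF r(1) a] eb[OF r(2,3)] by linarith
    qed
    have conc: "measure (kernel_measure M) (unit_cell (1/2) (0 :: int ^ 'n) - core_cell \<delta> 0) \<le> \<epsilon> * I"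
      using M(2) by (simp add: I_def)
    have sw: "I * ?N \<le> ellipsoid_integral (bump_kernel M) a (t + x) + \<epsilon> * I * card (boundary_points t)"
      "ellipsoid_integral (bump_kernel M) a (t - x) \<le> I * ?N + \<epsilon> * I * card (boundary_points t)"
      using kernel_sandwich[of \<delta> \<epsilon> M t, folded I_def, OF _ _ _ conc] \<delta> \<epsilon> by (auto simp: x_def)
    have bI: "\<epsilon> * I * card (boundary_points t) \<le> I * (e / 3 * ?p)"
    proof -
      have "\<epsilon> * card (boundary_points t) \<le> \<epsilon> * (B * ?p)" using bd \<epsilon> by (intro mult_left_mono) auto
      also have "\<dots> = (\<epsilon> * B) * ?p" by simp
      also have "\<dots> \<le> e / 3 * ?p" using \<epsilon>(2) p0 by (rule mult_right_mono)
      finally have "I * (\<epsilon> * card (boundary_points t)) \<le> I * (e / 3 * ?p)" using I by (intro mult_left_mono) auto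
      then show ?thesis by (simp add: mult_ac)
    qed
    have "I * ?vol (t + x) \<le> I * (?vol t + e / 3 * ?p)" "I * (?vol t - e / 3 * ?p) \<le> I * ?vol (t - x)"
      using v1 v2 I by (auto intro: mult_left_mono)
    then have "I * ?N \<le> I * (?vol t + e * ?p)" "I * (?vol t - e * ?p) \<le> I * ?N"
      using sw int1 int2 bI by (simp_all add: algebra_simps)
    then have "?N \<le> ?vol t + e * ?p" "?vol t - e * ?p \<le> ?N" using I by (simp_all only: mult_le_cancel_left_pos)
    then show "\<bar>?N - ?V * t ^ ?n * (\<Prod>i\<in>UNIV. a $ i)\<bar> \<le> e * ?p"
      using vol[of t] t by (simp add: P_def[symmetric] abs_le_iff algebra_simps)
  qed
qed

section \<open>Minimising cuboids\<close>

text \<open>Carries a bound over to T when the counting function being bounded is controlled only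
  for s < T and may jump at T.\<close>

lemma le_at_left_limit:
  fixes f :: "real \<Rightarrow> real"
  assumes "isCont f T" "l < T" "\<And>s. l < s \<Longrightarrow> s < T \<Longrightarrow> f s \<le> R"
  shows "f T \<le> R"
proof (rule tendsto_upperbound)
  show "(f \<longlongrightarrow> f T) (at_left T)"
    using assms(1) by (auto simp: isCont_def intro: tendsto_within_subset)
  show "\<forall>\<^sub>F s in at_left T. f s \<le> R"
    using eventually_at_left_real[OF assms(2)] by eventually_elim (use assms(3) in auto)
qed simp

section \<open>The k-th eigenvalue and the counting function\<close>

context positive_cuboid begin

text \<open>The infimum that defines the k-th eigenvalue is attained because the counting function
  is a step function continuous from the right. The lower bound for lattice counts shows that the
  set is nonempty.\<close>

lemma dirichlet_lambda_counts:
  assumes "1 \<le> k"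
  shows "0 \<le> dirichlet_lambda k (box 0 a)"
    and "k \<le> dirichlet_count (box 0 a) (dirichlet_lambda k (box 0 a))"
    and "\<And>x. x < dirichlet_lambda k (box 0 a) \<Longrightarrow> dirichlet_count (box 0 a) x < k"
proof -
  define N where "N = dirichlet_count (box 0 a)"
  define S where "S = {x. k \<le> N x}"
  have N: "N x = card {j \<in> positive_points. mode_eigenvalue j \<le> x}" for x
    by (simp add: N_def dirichlet_count_eq)
  have fin: "finite {j \<in> positive_points. mode_eigenvalue j \<le> x}" for x
    using finite_modes_le[of x] by (rule finite_subset[rotated]) auto
  have mono: "N x \<le> N y" if "x \<le> y" for x y
    unfolding N using that by (intro card_mono fin) auto
  have pos: "0 \<le> x" if "x \<in> S" for x
  proof (rule ccontr)
    assume "\<not> 0 \<le> x"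
    then have "\<not> mode_eigenvalue j \<le> x" for j using mode_eigenvalue_nonneg[of j] by linarith
    then have "N x = 0" by (simp add: N)
    then show False using that assms by (simp add: S_def)
  qed
  have ne: "S \<noteq> {}"
  proof -
    define V where "V = measure lebesgue (orthant_ball :: ((real, 'n) vec) set) * (\<Prod>j\<in>UNIV. a $ j)"
    have V: "0 < V" unfolding V_def using measure_slabs_pos(3) side_pos by (intro mult_pos_pos prod_pos) auto
    define y where "y = max 1 (k / V)"
    have y: "1 \<le> y" "k / V \<le> y" by (auto simp: y_def)
    have "k \<le> V * y" using y(2) V by (simp add: field_simps)
    also have "\<dots> \<le> V * y ^ CARD('n)"
      using V y(1) power_increasing[of 1 "CARD('n)" y] by (simp add: Suc_le_eq)
    also have "\<dots> \<le> pos_count a (y + cell_diam)"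
      using pos_count_lower_bound[of "y + cell_diam"] y(1) by (simp add: V_def mult_ac)
    finally have "k \<le> N ((pi * (y + cell_diam))\<^sup>2)"
      using dirichlet_count_eq_pos_count[of "y + cell_diam"] y(1) cell_diam_pos by (simp add: N_def)
    then show ?thesis by (auto simp: S_def)
  qed
  have bdd: "bdd_below S" using pos by (rule bdd_belowI)
  define L where "L = Inf S"
  have Leq: "dirichlet_lambda k (box 0 a) = L" by (simp add: L_def S_def N_def dirichlet_lambda_def)
  show "0 \<le> dirichlet_lambda k (box 0 a)" unfolding Leq L_def using ne pos by (intro cInf_greatest) auto
  show "dirichlet_count (box 0 a) x < k" if "x < dirichlet_lambda k (box 0 a)" for x
  proof (rule ccontr)
    assume "\<not> ?thesis"
    then have "x \<in> S" by (simp add: S_def N_def)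
    then have "L \<le> x" unfolding L_def using bdd by (rule cInf_lower)
    then show False using that Leq by simp
  qed
  \<comment> \<open>\<open>Min D\<close> is the next eigenvalue above L, capped at L + 1 so that the
    set is finite and nonempty. No eigenvalue lies strictly between L and \<open>Min D\<close>, so
    the count there equals the count at L.\<close>
  define D where "D = insert (L + 1) (mode_eigenvalue ` {j \<in> positive_points. mode_eigenvalue j \<le> L + 1}) \<inter> {L<..}"
  have D: "finite D" "D \<noteq> {}" using fin by (auto simp: D_def)
  have LD: "L < Min D" using D by (subst Min_gr_iff) (auto simp: D_def)
  then obtain s where s: "s \<in> S" "s < Min D" using cInf_lessD[OF ne, of "Min D"] by (auto simp: L_def)
  have sub: "{j \<in> positive_points. mode_eigenvalue j \<le> s} \<subseteq> {j \<in> positive_points. mode_eigenvalue j \<le> L}"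
  proof
    fix j assume "j \<in> {j \<in> positive_points. mode_eigenvalue j \<le> s}"
    then have j: "j \<in> positive_points" "mode_eigenvalue j < Min D" using s by auto
    have "mode_eigenvalue j \<le> L"
    proof (rule ccontr)
      assume c: "\<not> ?thesis"
      have "L + 1 \<in> D" by (simp add: D_def)
      then have "Min D \<le> L + 1" using D by (intro Min_le)
      then have "mode_eigenvalue j \<in> D" using j c by (auto simp: D_def)
      then have "Min D \<le> mode_eigenvalue j" using D by (intro Min_le)
      then show False using j by simp
    qed
    then show "j \<in> {j \<in> positive_points. mode_eigenvalue j \<le> L}" using j by simp
  qed
  have "k \<le> N s" using s by (simp add: S_def)
  also have "N s \<le> N L" unfolding N using sub by (intro card_mono fin)
  finally show "k \<le> dirichlet_count (box 0 a) (dirichlet_lambda k (box 0 a))" by (simp add: Leq N_def)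
qed

end

lemma unit_cuboid_ones: "unit_cuboid ((\<chi> i. 1) :: real ^ 'n::{finite,linorder})"
  by (simp add: unit_cuboid_def)

lemma unit_cuboid_positive: "unit_cuboid a \<Longrightarrow> positive_cuboid a"
  by (simp add: unit_cuboid_def positive_cuboid_def)

lemma unit_cuboid_coprod: "unit_cuboid a \<Longrightarrow> (\<Prod>j\<in>UNIV - {i}. a $ j) = 1 / a $ i"
  using prod.remove[of UNIV i "($) a"] by (simp add: unit_cuboid_def eq_divide_eq mult.commute less_imp_neq[THEN not_sym])

text \<open>T is the square root of the minimal k-th eigenvalue divided by pi. Minimality against
  the unit cube says that the k-th eigenvalue of the cube is no smaller, so the cube counts fewer
  than k at every s < T.\<close>

lemma minimiser_counts:
  fixes a :: "real ^ 'n::{finite,linorder}"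
  assumes "1 \<le> k" and min: "dirichlet_minimiser k a"
  obtains T where "0 \<le> T" "k \<le> pos_count a T"
    "\<And>s. 0 \<le> s \<Longrightarrow> s < T \<Longrightarrow> pos_count ((\<chi> i. 1) :: (real, 'n) vec) s < k"
proof -
  have u: "unit_cuboid a" using min by (simp add: dirichlet_minimiser_def)
  interpret A: positive_cuboid a by (rule unit_cuboid_positive[OF u])
  define L where "L = dirichlet_lambda k (box 0 a)"
  have L: "0 \<le> L" "L \<le> dirichlet_lambda k (box 0 ((\<chi> i. 1) :: (real, 'n) vec))"
    unfolding L_def using A.dirichlet_lambda_counts(1)[OF assms(1)] min unit_cuboid_ones
    unfolding dirichlet_minimiser_def by blast+
  define T where "T = sqrt L / pi"
  have T: "0 \<le> T" "(pi * T)\<^sup>2 = L" using L by (simp_all add: T_def)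
  have "k \<le> pos_count a T"
    using A.dirichlet_lambda_counts(2)[OF assms(1)] A.dirichlet_count_eq_pos_count[OF T(1)] T(2) by (simp add: L_def)
  moreover have "pos_count ((\<chi> i. 1) :: (real, 'n) vec) s < k" if s: "0 \<le> s" "s < T" for s
  proof -
    have "(pi * s)\<^sup>2 < (pi * T)\<^sup>2" using s by (intro power_strict_mono) auto
    then have "(pi * s)\<^sup>2 < dirichlet_lambda k (box 0 ((\<chi> i. 1) :: (real, 'n) vec))" using T L by linarith
    from unit_cube.dirichlet_lambda_counts(3)[OF assms(1) this] show ?thesis
      by (simp add: unit_cube.dirichlet_count_eq_pos_count[OF s(1)])
  qed
  ultimately show ?thesis using T(1) that by blast
qed

lemma unit_cuboid_bounds:
  fixes a :: "real ^ 'n::{finite,linorder}"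
  assumes u: "unit_cuboid a" and "0 < \<alpha>" "\<And>i. \<alpha> \<le> a $ i"
  shows "a $ i \<le> (1 / \<alpha>) ^ (CARD('n) - 1)"
proof -
  have "\<alpha> ^ (CARD('n) - 1) = (\<Prod>j\<in>UNIV - {i}. \<alpha>)" by (simp add: card_Diff_singleton)
  also have "\<dots> \<le> (\<Prod>j\<in>UNIV - {i}. a $ j)" using assms by (intro prod_mono) auto
  also have "\<dots> = 1 / a $ i" by (rule unit_cuboid_coprod[OF u])
  finally have "\<alpha> ^ (CARD('n) - 1) \<le> 1 / a $ i" .
  moreover have "0 < a $ i" using u by (simp add: unit_cuboid_def)
  ultimately show ?thesis using assms(2) by (simp add: power_divide field_simps)
qed

text \<open>A short side costs a boundary term of order \<open>t\<^sup>n\<^sup>-\<^sup>1 / a\<^sub>i\<close> that the cube does not pay.\<close>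

lemma minimisers_precompact:
  assumes n: "2 \<le> CARD('n::{finite,linorder})"
  obtains \<alpha> where "0 < \<alpha>" "\<alpha> \<le> 1"
    "\<And>k (a :: (real, 'n) vec) i. 1 \<le> k \<Longrightarrow> dirichlet_minimiser k a \<Longrightarrow> \<alpha> \<le> a $ i"
proof -
  let ?n = "CARD('n)"
  define V where "V = measure lebesgue (orthant_ball :: ((real, 'n) vec) set)"
  have V: "0 < V" unfolding V_def by (rule measure_slabs_pos)
  define c where "c i = measure lebesgue (orthant_slab (i :: 'n)) / (64 * 2 ^ (?n - 2))" for i
  have c: "0 < c i" for i unfolding c_def using measure_slabs_pos(1)[of i] by simp
  define \<gamma> where "\<gamma> = Min (range c)"
  have \<gamma>: "0 < \<gamma>" "\<And>i. \<gamma> \<le> c i" unfolding \<gamma>_def using c by (auto simp: Min_gr_iff)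
  \<comment> \<open>The second entry serves T > n: the lower bound V (T - n)^n for the cube, whose
    \<open>cell_diam\<close> is n, falls short of V T^n by at most V n^2 T^(n-1), and the boundary
    loss c_i / a_i cannot exceed V n^2. For T \<le> n a counted point has z_i \<ge> 1, so 1 \<le>
    a_i n, which explains the first entry.\<close>
  define \<alpha> where "\<alpha> = min (1 / ?n) (\<gamma> / (V * (?n * ?n)))"
  have "\<alpha> \<le> a $ i" if k: "1 \<le> k" and min: "dirichlet_minimiser k a" for k and a :: "(real, 'n) vec" and i
  proof -
    have u: "unit_cuboid a" using min by (simp add: dirichlet_minimiser_def)
    interpret A: positive_cuboid a by (rule unit_cuboid_positive[OF u])
    obtain T where T: "0 \<le> T" "k \<le> pos_count a T"
      "\<And>s. 0 \<le> s \<Longrightarrow> s < T \<Longrightarrow> pos_count ((\<chi> i. 1) :: (real, 'n) vec) s < k"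
      using minimiser_counts[OF k min] by blast
    have ne: "pos_count a T \<noteq> 0" using T(2) k by simp
    have ai: "0 < a $ i" by (rule A.side_pos)
    have up: "pos_count a T \<le> V * T ^ ?n - c i / a $ i * T ^ (?n - 1)"
      using A.pos_count_upper_bound[OF n T(1) ne, of i] u
      unfolding unit_cuboid_coprod[OF u] by (simp add: unit_cuboid_def V_def c_def mult_ac)
    have Bd: "unit_cube.cell_diam TYPE('n) = ?n" by (simp add: unit_cube.cell_diam_def[where 'n='n])
    show ?thesis
    proof (cases "?n < T")
      case True
      have "V * (T - ?n) ^ ?n \<le> V * T ^ ?n - c i / a $ i * T ^ (?n - 1)"
      proof (rule le_at_left_limit[where f = "\<lambda>s :: real. V * (s - ?n) ^ ?n", OF _ True])
        show "isCont (\<lambda>s :: real. V * (s - ?n) ^ ?n) T" by (intro continuous_intros)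
        fix s :: real assume s: "?n < s" "s < T"
        have "V * (s - ?n) ^ ?n \<le> pos_count ((\<chi> i. 1) :: (real, 'n) vec) s"
          using unit_cube.pos_count_lower_bound[where 'n='n, of s] s by (simp add: Bd V_def)
        also have "\<dots> \<le> pos_count a T" using T(3)[of s] T(2) s by simp
        finally show "V * (s - ?n) ^ ?n \<le> V * T ^ ?n - c i / a $ i * T ^ (?n - 1)" using up by linarith
      qed
      moreover have "V * (T ^ ?n - ?n * ?n * T ^ (?n - 1)) \<le> V * (T - ?n) ^ ?n"
        using power_minus_linear[of T "?n" ?n] True V by (intro mult_left_mono) auto
      ultimately have "c i / a $ i * T ^ (?n - 1) \<le> V * (?n * ?n) * T ^ (?n - 1)"
        unfolding right_diff_distrib mult.assoc by linarith
      moreover have "0 < T ^ (?n - 1)" using True by (intro zero_less_power) (meson le_less_trans of_nat_0_le_iff)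
      ultimately have "c i / a $ i \<le> V * (?n * ?n)" by (simp only: mult_le_cancel_right_pos)
      then have "\<gamma> \<le> V * (?n * ?n) * a $ i" using \<gamma>(2)[of i] ai by (simp add: field_simps)
      then have "\<gamma> / (V * (?n * ?n)) \<le> a $ i" using V by (simp add: field_simps)
      then show ?thesis by (simp add: \<alpha>_def)
    next
      case False
      have "full_points a T \<inter> positive_points \<noteq> {}" using ne by (auto simp: pos_count_def)
      then obtain z where z: "z \<in> full_points a T" "z \<in> positive_points" by blast
      have "0 < z $ i" using z by (simp add: positive_points_def)
      then have "1 \<le> real_of_int (z $ i)" by linarith
      also have "\<dots> \<le> a $ i * norm (scaled a (real_vec z))"
        using A.component_le_norm_scaled[of "real_vec z" i] by simp
      also have "\<dots> \<le> a $ i * ?n"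
        using z ai False by (intro mult_left_mono) (auto simp: full_points_def)
      finally have "1 / ?n \<le> a $ i" by (simp add: field_simps)
      then show ?thesis by (simp add: \<alpha>_def)
    qed
  qed
  moreover have "0 < \<alpha>" using \<gamma> V by (simp add: \<alpha>_def)
  moreover have "\<alpha> \<le> 1" by (rule order_trans[of _ "1 / ?n"]) (simp_all add: \<alpha>_def)
  ultimately show ?thesis using that by blast
qed

text \<open>A common form for two remainders: a multiple of t^\<theta> from an admissible exponent,
  and e t^(n-1) with arbitrary e > 0 from the independent asymptotics.\<close>

definition count_error_le :: "'n::finite itself \<Rightarrow> real \<Rightarrow> real \<Rightarrow> real \<Rightarrow> (real \<Rightarrow> real) \<Rightarrow> bool" where
  "count_error_le (_ :: 'n itself) \<alpha> \<beta> t1 err \<longleftrightarrow>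
     (\<forall>t\<ge>t1. \<forall>a :: real ^ 'n. (\<forall>i. \<alpha> \<le> a $ i \<and> a $ i \<le> \<beta>) \<longrightarrow>
        \<bar>card (full_points a t) - measure lborel (ball (0 :: real ^ 'n) 1) * t ^ CARD('n) * (\<Prod>i\<in>UNIV. a $ i)\<bar> \<le> err t)"

text \<open>The main terms cancel since both cuboids have measure one. The remainder enters twice,
  once for each cuboid, whence 2 \<open>err\<close>. The constants c and C are fixed before
  \<open>err\<close>, which allows a remainder chosen in terms of c. The bound of k by T^n makes T
  large with k.\<close>

lemma minimiser_comparison:
  assumes n: "2 \<le> CARD('n::{finite,linorder})" and \<alpha>: "0 < \<alpha>" "\<alpha> \<le> 1" "1 \<le> \<beta>"
  obtains c C where "0 < c" "0 \<le> C"
    "\<And>k (a :: (real, 'n) vec) err t1. 1 \<le> k \<Longrightarrow> dirichlet_minimiser k a \<Longrightarrow> \<forall>i. \<alpha> \<le> a $ i \<and> a $ i \<le> \<beta> \<Longrightarrow>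
      \<forall>t>0. isCont err t \<Longrightarrow> count_error_le TYPE('n) \<alpha> \<beta> t1 err \<Longrightarrow>
      \<exists>T\<ge>0. k \<le> measure lebesgue (orthant_ball :: ((real, 'n) vec) set) * T ^ CARD('n) \<and>
        (max 1 t1 < T \<longrightarrow> c * ((\<Sum>i\<in>UNIV. 1 / a $ i) - CARD('n)) * T ^ (CARD('n) - 1) \<le> 2 * err T + C * T ^ (CARD('n) - 2))"
proof -
  let ?n = "CARD('n)" and ?V = "measure lborel (ball (0 :: (real, 'n) vec) 1)"
  obtain i0 :: 'n where True by simp
  define c where "c = measure lebesgue (full_slab i0)"
  have c: "0 < c" unfolding c_def by (rule measure_slabs_pos)
  obtain C0 where C0: "\<And>(a :: (real, 'n) vec) t. (\<forall>i. \<alpha> \<le> a $ i \<and> a $ i \<le> \<beta>) \<Longrightarrow> 1 \<le> t \<Longrightarrow>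
    \<bar>2 ^ ?n * real (pos_count a t) - card (full_points a t)
      + c * (\<Sum>i\<in>UNIV. \<Prod>j\<in>UNIV - {i}. a $ j) * t ^ (?n - 1)\<bar> \<le> C0 * t ^ (?n - 2)"
    using pos_count_uniform[OF \<alpha>(1) n, of \<beta> i0] unfolding c_def by blast
  define C where "C = 2 * \<bar>C0\<bar>"
  have main: "\<exists>T\<ge>0. k \<le> measure lebesgue (orthant_ball :: ((real, 'n) vec) set) * T ^ ?n \<and>
        (max 1 t1 < T \<longrightarrow> c * ((\<Sum>i\<in>UNIV. 1 / a $ i) - ?n) * T ^ (?n - 1) \<le> 2 * err T + C * T ^ (?n - 2))"
    if k: "1 \<le> k" and min: "dirichlet_minimiser k a" and a: "\<forall>i. \<alpha> \<le> a $ i \<and> a $ i \<le> \<beta>"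
      and cont: "\<forall>t>0. isCont err t" and ce: "count_error_le TYPE('n) \<alpha> \<beta> t1 err"
    for k and a :: "(real, 'n) vec" and err t1
  proof -
    have err: "\<bar>card (full_points b t) - ?V * t ^ ?n * (\<Prod>i\<in>UNIV. b $ i)\<bar> \<le> err t"
      if "t1 \<le> t" "\<forall>i. \<alpha> \<le> b $ i \<and> b $ i \<le> \<beta>" for t and b :: "(real, 'n) vec"
      using ce that unfolding count_error_le_def by blast
    have u: "unit_cuboid a" using min by (simp add: dirichlet_minimiser_def)
    interpret A: positive_cuboid a by (rule unit_cuboid_positive[OF u])
    let ?one = "(\<chi> i. 1) :: (real, 'n) vec"
    obtain T where T: "0 \<le> T" "k \<le> pos_count a T"
      "\<And>s. 0 \<le> s \<Longrightarrow> s < T \<Longrightarrow> pos_count ?one s < k"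
      using minimiser_counts[OF k min] by blast
    have ne: "pos_count a T \<noteq> 0" using T(2) k by simp
    have p1: "(\<Prod>i\<in>UNIV. a $ i) = 1" using u by (simp add: unit_cuboid_def)
    have "k \<le> measure lebesgue (orthant_ball :: ((real, 'n) vec) set) * T ^ ?n"
    proof -
      have "0 \<le> measure lebesgue (orthant_slab i0) * (\<Prod>j\<in>UNIV - {i0}. a $ j) * T ^ (?n - 1) / (64 * 2 ^ (?n - 2))"
        using T(1) A.side_pos by (intro divide_nonneg_nonneg mult_nonneg_nonneg prod_nonneg) (auto intro: less_imp_le)
      then show ?thesis using A.pos_count_upper_bound[OF n T(1) ne, of i0] T(2) p1 by simp
    qed
    moreover have "c * ((\<Sum>i\<in>UNIV. 1 / a $ i) - ?n) * T ^ (?n - 1) \<le> 2 * err T + C * T ^ (?n - 2)" if Tt: "max 1 t1 < T"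
    proof -
      define S where "S = (\<Sum>i\<in>UNIV. 1 / a $ i)"
      have SA: "(\<Sum>i\<in>UNIV. \<Prod>j\<in>UNIV - {i}. a $ j) = S" by (simp add: S_def unit_cuboid_coprod[OF u])
      have one': "\<forall>i. \<alpha> \<le> ?one $ i \<and> ?one $ i \<le> \<beta>" using \<alpha> by simp
      have "2 ^ ?n * real (pos_count a T) \<le> card (full_points a T) - c * S * T ^ (?n - 1) + C0 * T ^ (?n - 2)"
        using C0[OF a, of T] Tt unfolding SA by linarith
      moreover have "card (full_points a T) \<le> ?V * T ^ ?n + err T"
        using err[of T a] a Tt p1 by simp
      ultimately have up: "2 ^ ?n * real (pos_count a T) \<le> ?V * T ^ ?n + err T - c * S * T ^ (?n - 1) + C0 * T ^ (?n - 2)"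
        by linarith
      \<comment> \<open>A continuous minorant of 2^n times the count of the cube; the count itself
        may jump at T.\<close>
      define f where "f s = ?V * s ^ ?n - err s - c * ?n * s ^ (?n - 1) - C0 * s ^ (?n - 2)" for s
      have "f T \<le> ?V * T ^ ?n + err T - c * S * T ^ (?n - 1) + C0 * T ^ (?n - 2)"
      proof (rule le_at_left_limit[where f = f, OF _ Tt])
        show "isCont f T" unfolding f_def using Tt cont by (intro continuous_intros) auto
        fix s assume s: "max 1 t1 < s" "s < T"
        have "card (full_points ?one s) - c * ?n * s ^ (?n - 1) - C0 * s ^ (?n - 2) \<le> 2 ^ ?n * real (pos_count ?one s)"
          using C0[OF one', of s] s by simp
        moreover have "?V * s ^ ?n - err s \<le> card (full_points ?one s)"
          using err[of s ?one] one' s by simp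
        ultimately have "f s \<le> 2 ^ ?n * real (pos_count ?one s)" unfolding f_def by linarith
        also have "\<dots> \<le> 2 ^ ?n * real (pos_count a T)"
          using T(3)[of s] T(2) s by simp
        finally show "f s \<le> ?V * T ^ ?n + err T - c * S * T ^ (?n - 1) + C0 * T ^ (?n - 2)" using up by linarith
      qed
      then have "c * S * T ^ (?n - 1) - c * ?n * T ^ (?n - 1) \<le> 2 * err T + 2 * (C0 * T ^ (?n - 2))"
        unfolding f_def by linarith
      moreover have "C0 * T ^ (?n - 2) \<le> \<bar>C0\<bar> * T ^ (?n - 2)" using T(1) by (intro mult_right_mono) auto
      ultimately have "c * S * T ^ (?n - 1) - c * ?n * T ^ (?n - 1) \<le> 2 * err T + C * T ^ (?n - 2)"
        unfolding C_def by linarith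
      then show ?thesis by (simp add: S_def algebra_simps)
    qed
    ultimately show ?thesis using T(1) by blast
  qed
  show ?thesis
    by (rule that[of c C]) (use c main in \<open>auto simp: C_def\<close>)
qed

text \<open>Quantitative arithmetic-geometric mean inequality: sum \<open>ln x \<le> x - 1\<close> over the
  reciprocals of the sides, keeping the second-order term of the longest side.\<close>

lemma longest_side_deviation:
  fixes a :: "real ^ 'n::{finite,linorder}"
  assumes u: "unit_cuboid a" and \<beta>: "\<And>i. a $ i \<le> \<beta>"
  shows "1 \<le> a $ Max UNIV" "(a $ Max UNIV - 1)\<^sup>2 \<le> 2 * \<beta>\<^sup>2 * ((\<Sum>i\<in>UNIV. 1 / a $ i) - CARD('n))"
proof -
  define x where "x = a $ Max UNIV"
  have pos: "0 < a $ i" for i using u by (simp add: unit_cuboid_def)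
  have le: "a $ i \<le> x" for i unfolding x_def using u by (simp add: unit_cuboid_def)
  have p1: "(\<Prod>i\<in>UNIV. a $ i) = 1" using u by (simp add: unit_cuboid_def)
  show x1: "1 \<le> a $ Max UNIV"
  proof (rule ccontr)
    assume "\<not> ?thesis"
    then have x: "x < 1" "0 < x" using pos by (auto simp: x_def)
    have "(\<Prod>i\<in>UNIV. a $ i) \<le> (\<Prod>i\<in>(UNIV :: 'n set). x)" using pos le by (intro prod_mono) (auto intro: less_imp_le)
    also have "\<dots> < 1" using x by (simp add: power_less_one_iff)
    finally show False using p1 by simp
  qed
  have sumln: "(\<Sum>i\<in>UNIV. ln (1 / a $ i)) = 0"
  proof -
    have "(\<Sum>i\<in>UNIV. ln (a $ i)) = ln (\<Prod>i\<in>UNIV. a $ i)" using pos by (intro ln_prod[symmetric]) (auto simp: less_imp_neq[THEN not_sym])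
    moreover have "ln (1 / a $ i) = - ln (a $ i)" for i using pos[of i] by (simp add: ln_div)
    ultimately show ?thesis using p1 by (simp add: sum_negf)
  qed
  define y where "y = 1 / x"
  have y: "0 < y" "y \<le> 1" using x1 by (auto simp: y_def x_def)
  have "(1 - y)\<^sup>2 / 2 \<le> y - 1 - ln y"
  proof -
    \<comment> \<open>The derivative is -(1 - v)^2 / v, so g decreases to g 1 = 0 on (0, 1]. The
      reciprocal y of the longest side lies in this interval.\<close>
    define g where "g v = v - 1 - ln v - (1 - v)\<^sup>2 / 2" for v :: real
    have "g 1 \<le> g y"
    proof (rule DERIV_nonpos_imp_nonincreasing[OF y(2)])
      fix v assume v: "y \<le> v" "v \<le> 1"
      then have v0: "0 < v" using y by linarith
      have "(g has_real_derivative 1 - 1 / v + (1 - v)) (at v)"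
        unfolding g_def using v0 by (auto intro!: derivative_eq_intros simp: field_simps)
      moreover have "1 - 1 / v + (1 - v) \<le> 0"
      proof -
        have "1 - 1 / v + (1 - v) = - ((1 - v)\<^sup>2 / v)" using v0 by (simp add: field_simps power2_eq_square)
        then show ?thesis using v0 by simp
      qed
      ultimately show "\<exists>d. (g has_real_derivative d) (at v) \<and> d \<le> 0" by blast
    qed
    then show ?thesis by (simp add: g_def)
  qed
  also have "\<dots> \<le> (\<Sum>i\<in>UNIV. 1 / a $ i - 1 - ln (1 / a $ i))"
    unfolding y_def x_def using pos ln_le_minus_one
    by (intro member_le_sum[of _ _ "\<lambda>i. 1 / a $ i - 1 - ln (1 / a $ i)"]) auto
  also have "\<dots> = (\<Sum>i\<in>UNIV. 1 / a $ i) - CARD('n)" unfolding sum_subtractf sumln by simp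
  finally have d: "(1 - y)\<^sup>2 \<le> 2 * ((\<Sum>i\<in>UNIV. 1 / a $ i) - CARD('n))" by simp
  have "(x - 1)\<^sup>2 = x\<^sup>2 * (1 - y)\<^sup>2"
    unfolding power_mult_distrib[symmetric] using x1 by (simp add: y_def x_def right_diff_distrib)
  also have "\<dots> \<le> \<beta>\<^sup>2 * (1 - y)\<^sup>2" using x1 \<beta>[of "Max UNIV"] by (intro mult_right_mono power_mono) (auto simp: x_def)
  also have "\<dots> \<le> \<beta>\<^sup>2 * (2 * ((\<Sum>i\<in>UNIV. 1 / a $ i) - CARD('n)))" using d by (intro mult_left_mono) auto
  finally show "(a $ Max UNIV - 1)\<^sup>2 \<le> 2 * \<beta>\<^sup>2 * ((\<Sum>i\<in>UNIV. 1 / a $ i) - CARD('n))" by (simp add: x_def algebra_simps)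
qed

section \<open>Remainder bounds from admissible exponents\<close>

lemma full_points_eq:
  assumes "0 \<le> t"
  shows "{z :: int ^ 'n::finite. (\<Sum>i\<in>UNIV. (real_of_int (z $ i))\<^sup>2 / (a $ i)\<^sup>2) \<le> t\<^sup>2} = full_points a t"
proof -
  have "(\<Sum>i\<in>UNIV. (real_of_int (z $ i))\<^sup>2 / (a $ i)\<^sup>2) = (norm (scaled a (real_vec z)))\<^sup>2" for z :: "(int, 'n) vec"
    by (simp add: norm_scaled_power2)
  then show ?thesis unfolding full_points_def using assms by (auto simp: abs_le_square_iff[symmetric])
qed

lemma admissible_exponent_full_points:
  assumes "admissible_exponent TYPE('n::finite) \<theta>" "0 < \<alpha>"
  obtains C t1 where "0 \<le> C" "count_error_le TYPE('n) \<alpha> \<beta> t1 (\<lambda>t. C * t powr \<theta>)"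
proof -
  have "compact {\<alpha>..\<beta>} \<and> {\<alpha>..\<beta>} \<subseteq> {0<..}" using assms(2) by auto
  then obtain C where "\<forall>\<^sub>F t in at_top. \<forall>a :: (real, 'n) vec. (\<forall>i. a $ i \<in> {\<alpha>..\<beta>}) \<longrightarrow>
          \<bar>real (card {z :: (int, 'n) vec. (\<Sum>i\<in>UNIV. (real_of_int (z $ i))\<^sup>2 / (a $ i)\<^sup>2) \<le> t\<^sup>2})
            - measure lborel (ball (0 :: (real, 'n) vec) 1) * t ^ CARD('n) * (\<Prod>i\<in>UNIV. a $ i)\<bar>
          \<le> C * t powr \<theta>"
    using assms(1) unfolding admissible_exponent_def by blast
  then obtain t0 where t0: "\<And>t (a :: (real, 'n) vec). t0 \<le> t \<Longrightarrow> (\<forall>i. a $ i \<in> {\<alpha>..\<beta>}) \<Longrightarrow>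
          \<bar>real (card {z :: (int, 'n) vec. (\<Sum>i\<in>UNIV. (real_of_int (z $ i))\<^sup>2 / (a $ i)\<^sup>2) \<le> t\<^sup>2})
            - measure lborel (ball (0 :: (real, 'n) vec) 1) * t ^ CARD('n) * (\<Prod>i\<in>UNIV. a $ i)\<bar>
          \<le> C * t powr \<theta>"
    unfolding eventually_at_top_linorder by blast
  show ?thesis
  proof (rule that[of "\<bar>C\<bar>" "max 0 t0"])
    show "count_error_le TYPE('n) \<alpha> \<beta> (max 0 t0) (\<lambda>t. \<bar>C\<bar> * t powr \<theta>)"
      unfolding count_error_le_def
    proof (intro allI impI)
      fix t and a :: "(real, 'n) vec" assume t: "max 0 t0 \<le> t" and a: "\<forall>i. \<alpha> \<le> a $ i \<and> a $ i \<le> \<beta>"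
      have "\<bar>card (full_points a t) - measure lborel (ball (0 :: (real, 'n) vec) 1) * t ^ CARD('n) * (\<Prod>i\<in>UNIV. a $ i)\<bar> \<le> C * t powr \<theta>"
        using t0[of t a] t a full_points_eq[of t a] by simp
      also have "\<dots> \<le> \<bar>C\<bar> * t powr \<theta>" by (intro mult_right_mono) auto
      finally show "\<bar>card (full_points a t) - measure lborel (ball (0 :: (real, 'n) vec) 1) * t ^ CARD('n) * (\<Prod>i\<in>UNIV. a $ i)\<bar> \<le> \<bar>C\<bar> * t powr \<theta>" .
    qed
  qed simp
qed

text \<open>For the cube the count is constant for \<open>m \<le> t\<^sup>2 \<le> m + 1/2\<close> while the volume grows by a multiple
  of \<open>t\<^sup>n\<^sup>-\<^sup>2\<close>, so the error term cannot be smaller.\<close>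

lemma admissible_exponent_ge:
  assumes n: "2 \<le> CARD('n::finite)" and adm: "admissible_exponent TYPE('n) \<theta>"
  shows "real CARD('n) - 2 \<le> \<theta>"
proof (rule ccontr)
  let ?n = "CARD('n)" and ?V = "measure lborel (ball (0 :: (real, 'n) vec) 1)"
  let ?one = "(\<chi> i. 1) :: (real, 'n) vec"
  assume "\<not> ?thesis"
  then have lt: "\<theta> < real ?n - 2" by simp
  define d where "d = real ?n - 2 - \<theta>"
  have d: "0 < d" using lt by (simp add: d_def)
  obtain C t1 where C: "0 \<le> C" and ct: "\<And>t (a :: (real, 'n) vec). t1 \<le> t \<Longrightarrow> (\<forall>i. 1 \<le> a $ i \<and> a $ i \<le> 1) \<Longrightarrow>
    \<bar>card (full_points a t) - ?V * t ^ ?n * (\<Prod>i\<in>UNIV. a $ i)\<bar> \<le> C * t powr \<theta>"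
    using admissible_exponent_full_points[OF adm, of 1 1] unfolding count_error_le_def by (metis zero_less_one)
  have V: "0 < ?V" by simp
  \<comment> \<open>With d = n - 2 - \<theta> > 0 the two error bounds give t^d \<le> B, while m is
    chosen so large that t^d \<ge> B + 1. The factor 2^|\<theta>| compares the powers at t' \<le> 2
    t and at t for either sign of \<theta>.\<close>
  define B where "B = 2 * (C + C * 2 powr \<bar>\<theta>\<bar>) / ?V"
  have B: "0 \<le> B" using C V by (simp add: B_def)
  define m where "m = nat \<lceil>(max (max 1 t1) ((B + 1) powr (1 / d)))\<^sup>2\<rceil>"
  define t where "t = sqrt m"
  define t' where "t' = sqrt (m + 1/2)"
  have mt: "max (max 1 t1) ((B + 1) powr (1 / d)) \<le> t"
  proof -
    have "(max (max 1 t1) ((B + 1) powr (1 / d)))\<^sup>2 \<le> m" unfolding m_def by linarith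
    then show ?thesis unfolding t_def by (rule real_le_rsqrt)
  qed
  then have t: "1 \<le> t" "t1 \<le> t" "(B + 1) powr (1 / d) \<le> t" by auto
  have t2: "t\<^sup>2 = m" "t'\<^sup>2 = m + 1/2" by (simp_all add: t_def t'_def)
  have tt': "t \<le> t'" by (simp add: t_def t'_def)
  have "t' \<le> 2 * t"
  proof -
    have "t'\<^sup>2 \<le> (2 * t)\<^sup>2" unfolding power_mult_distrib t2 using t(1) one_le_power[OF t(1), of 2] t2(1) by simp
    then show ?thesis by (rule power2_le_imp_le) (use t(1) in simp)
  qed
  have same: "full_points ?one t = full_points ?one t'"
  proof -
    have A: "(norm (scaled ?one (real_vec z)))\<^sup>2 = real_of_int (\<Sum>i\<in>UNIV. (z $ i)\<^sup>2)" for z :: "(int, 'n) vec"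
      unfolding norm_scaled_power2 by simp
    have B: "real_of_int s \<le> real m \<longleftrightarrow> real_of_int s \<le> real m + 1/2" for s
    proof
      assume "real_of_int s \<le> real m + 1/2"
      then have "real_of_int s < real_of_int (int m + 1)" by simp
      then have "s \<le> int m" unfolding of_int_less_iff by linarith
      then have "real_of_int s \<le> real_of_int (int m)" by (simp only: of_int_le_iff)
      then show "real_of_int s \<le> real m" by simp
    qed simp
    have "norm (scaled ?one (real_vec z)) \<le> t \<longleftrightarrow> norm (scaled ?one (real_vec z)) \<le> t'" for z :: "(int, 'n) vec"
    proof -
      have "(norm (scaled ?one (real_vec z)))\<^sup>2 \<le> t\<^sup>2 \<longleftrightarrow> (norm (scaled ?one (real_vec z)))\<^sup>2 \<le> t'\<^sup>2"
        unfolding t2 A by (rule B)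
      then show ?thesis
        unfolding abs_le_square_iff[symmetric] using t(1) tt' by (simp del: scaled_ones)
    qed
    then show ?thesis unfolding full_points_def by blast
  qed
  have e1: "\<bar>card (full_points ?one t) - ?V * t ^ ?n\<bar> \<le> C * t powr \<theta>"
    using ct[of t ?one] t by simp
  have e2: "\<bar>card (full_points ?one t) - ?V * t' ^ ?n\<bar> \<le> C * t' powr \<theta>"
    unfolding same using ct[of t' ?one] t tt' by simp
  have pw: "t' powr \<theta> \<le> 2 powr \<bar>\<theta>\<bar> * t powr \<theta>"
  proof (cases "0 \<le> \<theta>")
    case True
    then have "t' powr \<theta> \<le> (2 * t) powr \<theta>" using \<open>t' \<le> 2 * t\<close> tt' t by (intro powr_mono2) auto
    then show ?thesis using True t by (simp add: powr_mult)
  next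
    case False
    then have "t' powr \<theta> \<le> t powr \<theta>" using tt' t by (intro powr_mono2') auto
    also have "\<dots> \<le> 2 powr \<bar>\<theta>\<bar> * t powr \<theta>" by (simp add: mult_le_cancel_right1 ge_one_powr_ge_zero)
    finally show ?thesis .
  qed
  have nn: "?n = Suc (Suc (?n - 2))" using n by simp
  have "t ^ (?n - 2) * (t'\<^sup>2 - t\<^sup>2) \<le> t' ^ ?n - t ^ ?n"
  proof -
    have "t ^ (?n - 2) * t'\<^sup>2 \<le> t' ^ (?n - 2) * t'\<^sup>2" using tt' t by (intro mult_right_mono power_mono) auto
    moreover have "s ^ ?n = s ^ (?n - 2) * s\<^sup>2" for s :: real by (subst nn) (simp add: power2_eq_square)
    ultimately show ?thesis by (simp add: right_diff_distrib)
  qed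
  then have "?V * (t ^ (?n - 2) * (1/2)) \<le> ?V * (t' ^ ?n - t ^ ?n)" using V t2 by (intro mult_left_mono) auto
  also have "\<dots> \<le> C * t powr \<theta> + C * t' powr \<theta>" using e1 e2 unfolding right_diff_distrib by linarith
  also have "\<dots> \<le> C * t powr \<theta> + C * (2 powr \<bar>\<theta>\<bar> * t powr \<theta>)"
    using pw C by (intro add_left_mono mult_left_mono)
  finally have "t ^ (?n - 2) * ?V \<le> 2 * (C + C * 2 powr \<bar>\<theta>\<bar>) * t powr \<theta>"
    by (simp add: algebra_simps)
  then have le: "t ^ (?n - 2) \<le> B * t powr \<theta>" using V by (simp add: B_def field_simps)
  have "t ^ (?n - 2) = t powr d * t powr \<theta>"
  proof -
    have "t ^ (?n - 2) = t powr real (?n - 2)" using t by (simp add: powr_realpow)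
    also have "real (?n - 2) = d + \<theta>" using n by (simp add: d_def)
    finally show ?thesis by (simp add: powr_add)
  qed
  with le have "t powr d \<le> B" using t by simp
  moreover have "B + 1 \<le> t powr d"
  proof -
    have "B + 1 = ((B + 1) powr (1 / d)) powr d" using B d by (simp add: powr_powr)
    also have "\<dots> \<le> t powr d" using t(3) d by (intro powr_mono2) auto
    finally show ?thesis .
  qed
  ultimately show False by simp
qed

theorem theorem1p1:
  fixes a :: "nat \<Rightarrow> real ^ 'n::{finite,linorder}"
  assumes "CARD('n) \<ge> 2"
    and "\<And>k. k \<ge> 1 \<Longrightarrow> dirichlet_minimiser k (a k)"
  shows "(\<forall>\<theta>. admissible_exponent TYPE('n) \<theta> \<longrightarrow>
            (\<lambda>k. a k $ Max UNIV - 1) \<in>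
              O(\<lambda>k. real k powr ((\<theta> - (real CARD('n) - 1)) / (2 * real CARD('n)))))
         \<and> (\<forall>i. (\<lambda>k. a k $ i) \<longlonglongrightarrow> 1)"
proof -
  let ?n = "CARD('n)"
  note n = assms(1)
  obtain \<alpha> where \<alpha>: "0 < \<alpha>" "\<alpha> \<le> 1"
    "\<And>k (b :: (real, 'n) vec) i. 1 \<le> k \<Longrightarrow> dirichlet_minimiser k b \<Longrightarrow> \<alpha> \<le> b $ i"
    using minimisers_precompact[OF n] by blast
  define \<beta> where "\<beta> = (1 / \<alpha>) ^ (?n - 1)"
  have \<beta>: "1 \<le> \<beta>" unfolding \<beta>_def using \<alpha> by (intro one_le_power) simp
  have u: "unit_cuboid (a k)" if "1 \<le> k" for k
    using assms(2)[OF that] by (simp add: dirichlet_minimiser_def)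
  have ab: "\<alpha> \<le> a k $ i \<and> a k $ i \<le> \<beta>" if "1 \<le> k" for k i
    unfolding \<beta>_def using \<alpha>(3)[OF that assms(2)[OF that]] unit_cuboid_bounds[OF u[OF that] \<alpha>(1)] by auto
  define V where "V = measure lebesgue (orthant_ball :: ((real, 'n) vec) set)"
  have V: "0 < V" unfolding V_def by (rule measure_slabs_pos)
  obtain c C where cC: "0 < c" "0 \<le> C" and comparison:
    "\<And>k (b :: (real, 'n) vec) err t1. 1 \<le> k \<Longrightarrow> dirichlet_minimiser k b \<Longrightarrow> \<forall>i. \<alpha> \<le> b $ i \<and> b $ i \<le> \<beta> \<Longrightarrow>
      \<forall>t>0. isCont err t \<Longrightarrow> count_error_le TYPE('n) \<alpha> \<beta> t1 err \<Longrightarrow>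
      \<exists>T\<ge>0. k \<le> measure lebesgue (orthant_ball :: ((real, 'n) vec) set) * T ^ ?n \<and>
        (max 1 t1 < T \<longrightarrow> c * ((\<Sum>i\<in>UNIV. 1 / b $ i) - ?n) * T ^ (?n - 1) \<le> 2 * err T + C * T ^ (?n - 2))"
    by (rule minimiser_comparison[OF n \<alpha>(1,2) \<beta>]) blast
  note comparison = comparison[folded V_def]
  define x where "x k = a k $ Max UNIV" for k
  define S where "S k = (\<Sum>i\<in>UNIV. 1 / a k $ i) - ?n" for k
  have x1: "1 \<le> x k" "(x k - 1)\<^sup>2 \<le> 2 * \<beta>\<^sup>2 * S k" if "1 \<le> k" for k
    unfolding x_def S_def using longest_side_deviation[OF u[OF that], of \<beta>] ab[OF that] by auto
  \<comment> \<open>Turns largeness of k into largeness of T, so that thresholds for the remainder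
    can be met by discarding finitely many k.\<close>
  have Tlarge: "r < T" if "0 \<le> T" "real k \<le> V * T ^ ?n" "V * (max 0 r) ^ ?n < real k" for r T k
  proof (rule ccontr)
    assume "\<not> r < T"
    then have "T ^ ?n \<le> (max 0 r) ^ ?n" using that(1) by (intro power_mono) auto
    then have "V * T ^ ?n \<le> V * (max 0 r) ^ ?n" using V by simp
    then show False using that by linarith
  qed
  have evk: "\<forall>\<^sub>F k in sequentially. R < real k" for R
    using filterlim_real_sequentially by (simp add: filterlim_at_top_dense)
  have nn: "T ^ (?n - 1) = T * T ^ (?n - 2)" for T :: real
  proof -
    have "?n - 1 = Suc (?n - 2)" using n by simp
    then show ?thesis by simp
  qed
  have rate: "(\<lambda>k. a k $ Max UNIV - 1) \<in> O(\<lambda>k. real k powr ((\<theta> - (real ?n - 1)) / (2 * real ?n)))"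
    if adm: "admissible_exponent TYPE('n) \<theta>" for \<theta>
  proof -
    define \<eta> where "\<eta> = \<theta> - (real ?n - 1)"
    \<comment> \<open>This makes T^(n-2) = T^(-1) T^(n-1) at most T^\<eta> T^(n-1) = T^\<theta> for
      T \<ge> 1, so the lower-order terms are absorbed by the remainder.\<close>
    have \<eta>: "- 1 \<le> \<eta>" using admissible_exponent_ge[OF n adm] by (simp add: \<eta>_def)
    obtain C1 t1 where C1: "0 \<le> C1" and ct: "count_error_le TYPE('n) \<alpha> \<beta> t1 (\<lambda>t. C1 * t powr \<theta>)"
      using admissible_exponent_full_points[OF adm \<alpha>(1), of \<beta>] by blast
    define A where "A = 2 * \<beta>\<^sup>2 * ((2 * C1 + C) / c)"
    have A: "0 \<le> A" using C1 cC by (simp add: A_def)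
    show ?thesis
    \<comment> \<open>The inequality k \<le> V T^n bounds T from below, which controls T^\<eta> for
      \<eta> \<le> 0. For \<eta> > 0 the powers of k are at least one, and the bound \<beta> for the
      sides suffices.\<close>
    proof (cases "\<eta> \<le> 0")
      case True
      define Q where "Q = sqrt A * (1 / V) powr (\<eta> / (2 * ?n))"
      show ?thesis
      proof (rule bigoI[of _ Q])
        show "\<forall>\<^sub>F k in sequentially. norm (a k $ Max UNIV - 1) \<le> Q * norm (real k powr ((\<theta> - (real ?n - 1)) / (2 * real ?n)))"
          using evk[of "max 1 (V * (max 0 (max 1 t1)) ^ ?n)"]
        proof eventually_elim
          case (elim k)
          then have k: "1 \<le> k" and kV: "V * (max 0 (max 1 t1)) ^ ?n < k" by auto
          have "\<exists>T\<ge>0. k \<le> V * T ^ ?n \<and>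
             (max 1 t1 < T \<longrightarrow> c * ((\<Sum>i\<in>UNIV. 1 / a k $ i) - ?n) * T ^ (?n - 1) \<le> 2 * (C1 * T powr \<theta>) + C * T ^ (?n - 2))"
            by (rule comparison[OF k assms(2)[OF k] _ _ ct]) (use ab[OF k] in \<open>auto intro!: continuous_intros\<close>)
          then obtain T where T: "0 \<le> T" "k \<le> V * T ^ ?n"
             "max 1 t1 < T \<longrightarrow> c * S k * T ^ (?n - 1) \<le> 2 * (C1 * T powr \<theta>) + C * T ^ (?n - 2)"
            unfolding S_def by blast
          have Tt: "max 1 t1 < T" by (rule Tlarge[OF T(1,2) kV])
          then have T1: "1 < T" by simp
          have "c * S k * T ^ (?n - 1) \<le> (2 * C1 + C) * T powr \<eta> * T ^ (?n - 1)"
          proof -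
            have e1: "T powr \<theta> = T powr \<eta> * T ^ (?n - 1)"
            proof -
              have "T ^ (?n - 1) = T powr real (?n - 1)" using T1 by (simp add: powr_realpow del: of_nat_diff)
              also have "real (?n - 1) = real ?n - 1" using n by simp
              finally show ?thesis unfolding \<eta>_def by (simp add: powr_add[symmetric])
            qed
            have "T powr (-1) \<le> T powr \<eta>" using \<eta> T1 by (intro powr_mono) auto
            then have "1 / T \<le> T powr \<eta>" using T1 by (simp add: powr_minus_divide)
            then have "1 / T * T ^ (?n - 1) \<le> T powr \<eta> * T ^ (?n - 1)" using T1 by (intro mult_right_mono) auto
            then have "T ^ (?n - 2) \<le> T powr \<eta> * T ^ (?n - 1)" using T1 nn[of T] by simp
            then have "C * T ^ (?n - 2) \<le> C * (T powr \<eta> * T ^ (?n - 1))" using cC by (intro mult_left_mono)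
            then show ?thesis using T(3) Tt unfolding e1 by (simp add: algebra_simps)
          qed
          then have "c * S k \<le> (2 * C1 + C) * T powr \<eta>" using T1 by (simp only: mult_le_cancel_right_pos zero_less_power)
          then have Sk: "S k \<le> (2 * C1 + C) / c * T powr \<eta>" using cC by (simp add: field_simps)
          have "(x k - 1)\<^sup>2 \<le> 2 * \<beta>\<^sup>2 * S k" by (rule x1(2)[OF k])
          also have "\<dots> \<le> 2 * \<beta>\<^sup>2 * ((2 * C1 + C) / c * T powr \<eta>)" using Sk by (intro mult_left_mono) auto
          also have "\<dots> = A * T powr \<eta>" by (simp add: A_def)
          finally have "sqrt ((x k - 1)\<^sup>2) \<le> sqrt (A * T powr \<eta>)" by (rule real_sqrt_le_mono)
          then have "x k - 1 \<le> sqrt A * T powr (\<eta> / 2)"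
            using x1(1)[OF k] T1 by (simp add: real_sqrt_mult powr_half_sqrt[symmetric] powr_powr)
          \<comment> \<open>The square root has halved \<eta>, and T^n \<ge> k / V divides the
            exponent by n once more; this is the origin of 2 n in the rate.\<close>
          also have "T powr (\<eta> / 2) \<le> (k / V) powr (\<eta> / (2 * ?n))"
          proof -
            have "k / V \<le> T ^ ?n" using T(2) V by (simp add: field_simps)
            then have "(T ^ ?n) powr (\<eta> / (2 * ?n)) \<le> (k / V) powr (\<eta> / (2 * ?n))"
              using True k V by (intro powr_mono2') (auto intro!: divide_nonpos_nonneg)
            moreover have "(T ^ ?n) powr (\<eta> / (2 * ?n)) = T powr (\<eta> / 2)"
              using T1 by (simp add: powr_realpow[symmetric] powr_powr)
            ultimately show ?thesis by simp
          qed
          also have "sqrt A * (k / V) powr (\<eta> / (2 * ?n)) = Q * real k powr (\<eta> / (2 * ?n))"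
            using V k by (simp add: Q_def powr_divide)
          finally show ?case
            using x1(1)[OF k] A by (simp add: x_def \<eta>_def mult_left_mono)
        qed
      qed
    next
      case False
      show ?thesis
      proof (rule bigoI[of _ \<beta>])
        show "\<forall>\<^sub>F k in sequentially. norm (a k $ Max UNIV - 1) \<le> \<beta> * norm (real k powr ((\<theta> - (real ?n - 1)) / (2 * real ?n)))"
          using evk[of 1]
        proof eventually_elim
          case (elim k)
          then have k: "1 \<le> k" by simp
          have "1 \<le> real k powr (\<eta> / (2 * ?n))" using False k by (intro ge_one_powr_ge_zero) auto
          then have "\<beta> * 1 \<le> \<beta> * real k powr (\<eta> / (2 * ?n))" using \<beta> by (intro mult_left_mono) auto
          moreover have "\<bar>x k - 1\<bar> \<le> \<beta>" using x1(1)[OF k] ab[OF k, of "Max UNIV"] by (simp add: x_def)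
          ultimately show ?case by (simp add: x_def \<eta>_def)
        qed
      qed
    qed
  qed
  have xlim: "x \<longlonglongrightarrow> 1"
  proof (rule LIMSEQ_I)
    fix r :: real assume r: "0 < r"
    \<comment> \<open>For T > C / e the term C T^(n-2) is at most e T^(n-1), so S k \<le> 3 e / c
      and (x k - 1)^2 \<le> 6 \<beta>^2 e / c, which is 3/8 r^2 for this e.\<close>
    define e where "e = c * r\<^sup>2 / (16 * \<beta>\<^sup>2)"
    have e: "0 < e" using r cC \<beta> by (simp add: e_def)
    obtain t1 where ct: "count_error_le TYPE('n) \<alpha> \<beta> t1 (\<lambda>t. e * t ^ (?n - 1))"
      using full_points_asymptotic[OF n \<alpha>(1) e, of \<beta>] unfolding count_error_le_def by blast
    define t2 where "t2 = max (max 1 t1) (C / e)"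
    have "\<forall>\<^sub>F k in sequentially. norm (x k - 1) < r"
      using evk[of "max 1 (V * (max 0 t2) ^ ?n)"]
    proof eventually_elim
      case (elim k)
      then have k: "1 \<le> k" and kV: "V * (max 0 t2) ^ ?n < k" by auto
      have "\<exists>T\<ge>0. k \<le> V * T ^ ?n \<and>
         (max 1 t1 < T \<longrightarrow> c * ((\<Sum>i\<in>UNIV. 1 / a k $ i) - ?n) * T ^ (?n - 1) \<le> 2 * (e * T ^ (?n - 1)) + C * T ^ (?n - 2))"
        by (rule comparison[OF k assms(2)[OF k] _ _ ct]) (use ab[OF k] in \<open>auto intro!: continuous_intros\<close>)
      then obtain T where T: "0 \<le> T" "k \<le> V * T ^ ?n"
         "max 1 t1 < T \<longrightarrow> c * S k * T ^ (?n - 1) \<le> 2 * (e * T ^ (?n - 1)) + C * T ^ (?n - 2)"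
        unfolding S_def by blast
      have "t2 < T" by (rule Tlarge[OF T(1,2) kV])
      then have Tt: "max 1 t1 < T" "1 < T" "C / e < T" by (auto simp: t2_def)
      have "C \<le> e * T" using Tt(3) e by (simp add: field_simps)
      then have "C * T ^ (?n - 2) \<le> e * T * T ^ (?n - 2)" using T(1) by (intro mult_right_mono) auto
      moreover have "e * T * T ^ (?n - 2) = e * T ^ (?n - 1)" by (simp only: nn mult.assoc)
      ultimately have "c * S k * T ^ (?n - 1) \<le> 3 * e * T ^ (?n - 1)" using T(3) Tt(1) by linarith
      then have "c * S k \<le> 3 * e" using Tt(2) by (simp only: mult_le_cancel_right_pos zero_less_power)
      then have Sk: "S k \<le> 3 * e / c" using cC by (simp add: field_simps)
      have "(x k - 1)\<^sup>2 \<le> 2 * \<beta>\<^sup>2 * S k" by (rule x1(2)[OF k])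
      also have "\<dots> \<le> 2 * \<beta>\<^sup>2 * (3 * e / c)" using Sk by (intro mult_left_mono) auto
      also have "\<dots> = 3 / 8 * r\<^sup>2" using cC \<beta> by (simp add: e_def)
      also have "\<dots> < r\<^sup>2" using r by simp
      finally have "\<bar>x k - 1\<bar>\<^sup>2 < r\<^sup>2" by (simp only: power2_abs)
      then have "\<bar>x k - 1\<bar> < r" by (rule power2_less_imp_less) (use r in simp)
      then show ?case by simp
    qed
    then show "\<exists>no. \<forall>k\<ge>no. norm (x k - 1) < r" by (simp add: eventually_sequentially)
  qed
  \<comment> \<open>The longest side controls the others: each is at most x k, and since the product
    is one, each is at least the reciprocal of x k to the power n - 1.\<close>
  have "(\<lambda>k. a k $ i) \<longlonglongrightarrow> 1" for i
  proof (rule tendsto_sandwich[OF _ _ _ xlim])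
    have "(\<lambda>k. (1 / x k) ^ (?n - 1)) \<longlonglongrightarrow> (1 / 1) ^ (?n - 1)"
      by (intro tendsto_intros xlim) simp
    then show "(\<lambda>k. (1 / x k) ^ (?n - 1)) \<longlonglongrightarrow> 1" by simp
    have le: "a k $ j \<le> x k" if "1 \<le> k" for k j
      using u[OF that] unfolding x_def unit_cuboid_def by simp
    show "\<forall>\<^sub>F k in sequentially. a k $ i \<le> x k"
      using eventually_ge_at_top[of 1] by eventually_elim (rule le)
    show "\<forall>\<^sub>F k in sequentially. (1 / x k) ^ (?n - 1) \<le> a k $ i"
      using eventually_ge_at_top[of 1]
    proof eventually_elim
      case (elim k)
      have pos: "0 < a k $ j" for j using u[OF elim] by (simp add: unit_cuboid_def)
      have "1 / a k $ i = (\<Prod>j\<in>UNIV - {i}. a k $ j)" by (rule unit_cuboid_coprod[OF u[OF elim], symmetric])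
      also have "\<dots> \<le> (\<Prod>j\<in>UNIV - {i}. x k)" using le[OF elim] pos by (intro prod_mono) (auto intro: less_imp_le)
      also have "\<dots> = x k ^ (?n - 1)" by (simp add: card_Diff_singleton)
      finally show ?case using pos[of i] x1(1)[OF elim] by (simp add: power_divide field_simps)
    qed
  qed
  then show ?thesis using rate by blast
qed

end
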